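(* Let $\varepsilon>0$. For smooth mean-zero $\rho$ on $\mathbb{T}^2$ with $1+\varepsilon\rho>0$, and with the periodic polar factor represented on the perturbative lift (i.e. $\varepsilon\|D^2\psi_\varepsilon[\rho]\|_{L^\infty}\le\eta_0$), the functional $\mathcal H_\varepsilon(\rho)=\frac{1}{2\varepsilon^2}W_2^2((1+\varepsilon\rho)\,dx,dx)$ is $C^1$ and $$D\mathcal H_\varepsilon(\rho)[h]=-\int_{\mathbb{T}^2}\psi_\varepsilon[\rho]\,h\,dx$$ for every smooth mean-zero perturbation $h$. Equivalently, $\dfrac{\delta\mathcal H_\varepsilon}{\delta\rho}=-\psi_\varepsilon[\rho]$.
   Context: $\mathbb{T}^2=\mathbb{R}^2/\mathbb{Z}^2$ is the flat torus with unit volume. $W_2$ is the quadratic Wasserstein distance for the cost given by the squared flat-torus distance $d_{\mathbb{T}^2}^2$. For smooth mean-zero $\rho$ with $m_\varepsilon=1+\varepsilon\rho>0$, let $P_\varepsilon[\rho](x)=\frac{|x|^2}{2}+\varepsilon\psi_\varepsilon[\rho](x)$ be the periodic optimal-transport potential: $\psi_\varepsilon$ is $\mathbb{Z}^2$-periodic with zero mean, $P_\varepsilon$ is convex, $\det D^2P_\varepsilon=m_\varepsilon$, and $\nabla P_\varepsilon$ pushes $m_\varepsilon dx$ forward to $dx$ (existence and uniqueness by Brenier--McCann). Here $\eta_0>0$ is a fixed sufficiently small universal constant; in particular $\varepsilon\|D^2\psi_\varepsilon\|_{L^\infty}\le\eta_0$ implies $\|\varepsilon\nabla\psi_\varepsilon\|_{L^\infty}<\tfrac12$,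 so that $d_{\mathbb{T}^2}(x,\nabla P_\varepsilon(x))=|\varepsilon\nabla\psi_\varepsilon(x)|$ and $\mathcal H_\varepsilon(\rho)=\frac12\int_{\mathbb{T}^2}(1+\varepsilon\rho)|\nabla\psi_\varepsilon|^2dx$. $D\mathcal H_\varepsilon(\rho)[h]$ denotes the derivative of $\tau\mapsto\mathcal H_\varepsilon(\rho+\tau h)$ at $\tau=0$. The functional derivative $\delta F/\delta\rho$ is the function representing $DF(\rho)$ through the $L^2$ pairing on mean-zero perturbations (normalized to have zero mean). *)

theory Defs
  imports "HOL-Analysis.Analysis" "HOL-Probability.Essential_Supremum"
begin

section \<open>The flat torus\<close>

text \<open>Points of the torus are represented in the fundamental cell \<open>[0,1)\<^sup>2\<close>, functions on the torus by
  \<open>\<int>\<^sup>2\<close>-periodic functions on the plane. The Borel structure of the cell is that of the torus.\<close>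

type_synonym plane = "real^2"

definition lattice :: "plane set" where
  "lattice = {k. \<forall>i. k $ i \<in> \<int>}"

definition cell :: "plane set" where
  "cell = {x. \<forall>i. 0 \<le> x $ i \<and> x $ i < 1}"

definition torus :: "plane measure" where
  "torus = restrict_space lborel cell"

definition torus_dist :: "plane \<Rightarrow> plane \<Rightarrow> real" where
  "torus_dist x y = (INF k\<in>lattice. norm (x - y - k))"

definition reduce :: "plane \<Rightarrow> plane" where
  "reduce x = (\<chi> i. frac (x $ i))"

definition periodic :: "(plane \<Rightarrow> 'a) \<Rightarrow> bool" where
  "periodic f \<longleftrightarrow> (\<forall>x. \<forall>k\<in>lattice. f (x + k) = f x)"

definition mean_zero :: "(plane \<Rightarrow> real) \<Rightarrow> bool" where
  "mean_zero f \<longleftrightarrow> (LINT x|torus. f x) = 0"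

fun Ck :: "nat \<Rightarrow> ('a::real_normed_vector \<Rightarrow> real) \<Rightarrow> bool" where
  "Ck 0 f \<longleftrightarrow> continuous_on UNIV f"
| "Ck (Suc n) f \<longleftrightarrow> f differentiable_on UNIV \<and> (\<forall>v. Ck n (\<lambda>x. frechet_derivative f (at x) v))"

definition smooth :: "('a::real_normed_vector \<Rightarrow> real) \<Rightarrow> bool" where
  "smooth f \<longleftrightarrow> (\<forall>n. Ck n f)"

definition grad :: "(plane \<Rightarrow> real) \<Rightarrow> plane \<Rightarrow> plane" where
  "grad f x = (\<chi> i. frechet_derivative f (at x) (axis i 1))"

definition hess :: "(plane \<Rightarrow> real) \<Rightarrow> plane \<Rightarrow> real^2^2" where
  "hess f x = jacobian (grad f) (at x)"


section \<open>Optimal transport\<close>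

definition couplings :: "'a measure \<Rightarrow> 'a measure \<Rightarrow> ('a \<times> 'a) measure set" where
  "couplings \<mu> \<nu> = {\<pi>. sets \<pi> = sets (\<mu> \<Otimes>\<^sub>M \<nu>) \<and> distr \<pi> \<mu> fst = \<mu> \<and> distr \<pi> \<nu> snd = \<nu>}"

definition W2 :: "plane measure \<Rightarrow> plane measure \<Rightarrow> real" where
  "W2 \<mu> \<nu> = sqrt (enn2real (INF \<pi>\<in>couplings \<mu> \<nu>.
      \<integral>\<^sup>+ z. ennreal ((torus_dist (fst z) (snd z))\<^sup>2) \<partial>\<pi>))"

definition dens_measure :: "real \<Rightarrow> (plane \<Rightarrow> real) \<Rightarrow> plane measure" where
  "dens_measure \<epsilon> \<rho> = density torus (\<lambda>x. ennreal (1 + \<epsilon> * \<rho> x))"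

definition H_fun :: "real \<Rightarrow> (plane \<Rightarrow> real) \<Rightarrow> real" where
  "H_fun \<epsilon> \<rho> = 1 / (2 * \<epsilon>\<^sup>2) * (W2 (dens_measure \<epsilon> \<rho>) torus)\<^sup>2"

definition brenier :: "real \<Rightarrow> (plane \<Rightarrow> real) \<Rightarrow> plane \<Rightarrow> real" where
  "brenier \<epsilon> \<psi> x = (norm x)\<^sup>2 / 2 + \<epsilon> * \<psi> x"

text \<open>Only \<open>C\<^sup>2\<close> regularity is imposed, so that the Monge--Ampere equation makes sense pointwise.
  The gradient of the potential is a self-map of the torus after reduction modulo \<open>\<int>\<^sup>2\<close>.\<close>

definition is_potential :: "real \<Rightarrow> (plane \<Rightarrow> real) \<Rightarrow> (plane \<Rightarrow> real) \<Rightarrow> bool" where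
  "is_potential \<epsilon> \<rho> \<psi> \<longleftrightarrow>
     Ck 2 \<psi> \<and> periodic \<psi> \<and> mean_zero \<psi> \<and>
     convex_on UNIV (brenier \<epsilon> \<psi>) \<and>
     (\<forall>x. det (hess (brenier \<epsilon> \<psi>) x) = 1 + \<epsilon> * \<rho> x) \<and>
     distr (dens_measure \<epsilon> \<rho>) torus (\<lambda>x. reduce (grad (brenier \<epsilon> \<psi>) x)) = torus"

definition psi :: "real \<Rightarrow> (plane \<Rightarrow> real) \<Rightarrow> plane \<Rightarrow> real" where
  "psi \<epsilon> \<rho> = (THE \<psi>. is_potential \<epsilon> \<rho> \<psi>)"


section \<open>Differential calculus for functionals of periodic densities\<close>

definition smooth_mean_zero :: "(plane \<Rightarrow> real) set" where
  "smooth_mean_zero = {\<rho>. smooth \<rho> \<and> periodic \<rho> \<and> mean_zero \<rho>}"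

definition positive_densities :: "real \<Rightarrow> (plane \<Rightarrow> real) set" where
  "positive_densities \<epsilon> = {\<rho>\<in>smooth_mean_zero. \<forall>x. 1 + \<epsilon> * \<rho> x > 0}"

text \<open>The densities whose polar factor is represented on the perturbative lift. The first conjunct
  records that \<open>psi \<epsilon> \<rho>\<close>, a definite description, really denotes the potential.\<close>

definition perturbative :: "real \<Rightarrow> real \<Rightarrow> (plane \<Rightarrow> real) set" where
  "perturbative \<eta> \<epsilon> = {\<rho>\<in>positive_densities \<epsilon>.
     (\<exists>\<psi>. is_potential \<epsilon> \<rho> \<psi>) \<and>
     ereal \<epsilon> * esssup torus (\<lambda>x. ereal (norm (hess (psi \<epsilon> \<rho>) x))) \<le> ereal \<eta>}"

definition L2_norm :: "(plane \<Rightarrow> real) \<Rightarrow> real" where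
  "L2_norm f = sqrt (LINT x|torus. (f x)\<^sup>2)"

text \<open>Frechet derivative at \<open>\<rho>\<close>, with respect to the \<open>L\<^sup>2\<close> norm on smooth mean-zero perturbations,
  of a functional whose domain is \<open>M\<close>.\<close>

definition has_L2_frechet ::
  "((plane \<Rightarrow> real) \<Rightarrow> real) \<Rightarrow> (plane \<Rightarrow> real) set \<Rightarrow> (plane \<Rightarrow> real) \<Rightarrow> ((plane \<Rightarrow> real) \<Rightarrow> real) \<Rightarrow> bool"
where
  "has_L2_frechet F M \<rho> L \<longleftrightarrow>
     (\<forall>g\<in>smooth_mean_zero. \<forall>h\<in>smooth_mean_zero. \<forall>a b.
        L (\<lambda>x. a * g x + b * h x) = a * L g + b * L h) \<and>
     (\<exists>C. \<forall>h\<in>smooth_mean_zero. \<bar>L h\<bar> \<le> C * L2_norm h) \<and>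
     (\<forall>e>0. \<exists>d>0. \<forall>h\<in>smooth_mean_zero. (\<lambda>x. \<rho> x + h x) \<in> M \<and> L2_norm h < d \<longrightarrow>
        \<bar>F (\<lambda>x. \<rho> x + h x) - F \<rho> - L h\<bar> \<le> e * L2_norm h)"

text \<open>\<open>F\<close>, with domain \<open>M\<close>, is \<open>C\<^sup>1\<close> on \<open>A\<close>: differentiable at the points of \<open>A\<close>, with derivative
  continuous on \<open>A\<close> in the operator norm.\<close>

definition C1_functional ::
  "((plane \<Rightarrow> real) \<Rightarrow> real) \<Rightarrow> (plane \<Rightarrow> real) set \<Rightarrow> (plane \<Rightarrow> real) set \<Rightarrow> bool"
where
  "C1_functional F M A \<longleftrightarrow> (\<exists>D.
     (\<forall>\<rho>\<in>A. has_L2_frechet F M \<rho> (D \<rho>)) \<and>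
     (\<forall>\<rho>\<in>A. \<forall>e>0. \<exists>d>0. \<forall>\<rho>'\<in>A. L2_norm (\<lambda>x. \<rho>' x - \<rho> x) < d \<longrightarrow>
        (\<forall>h\<in>smooth_mean_zero. \<bar>D \<rho>' h - D \<rho> h\<bar> \<le> e * L2_norm h)))"

definition has_functional_derivative ::
  "((plane \<Rightarrow> real) \<Rightarrow> real) \<Rightarrow> (plane \<Rightarrow> real) \<Rightarrow> (plane \<Rightarrow> real) \<Rightarrow> bool"
where
  "has_functional_derivative F \<rho> g \<longleftrightarrow>
     continuous_on UNIV g \<and> periodic g \<and> mean_zero g \<and>
     (\<forall>h\<in>smooth_mean_zero.
        ((\<lambda>\<tau>. F (\<lambda>x. \<rho> x + \<tau> * h x)) has_real_derivative (LINT x|torus. g x * h x)) (at 0))"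

definition functional_derivative :: "((plane \<Rightarrow> real) \<Rightarrow> real) \<Rightarrow> (plane \<Rightarrow> real) \<Rightarrow> plane \<Rightarrow> real" where
  "functional_derivative F \<rho> = (THE g. has_functional_derivative F \<rho> g)"

end

(*
  Let T = grad P be the optimal map for rho. Weak duality with the potential of rho bounds H(rho')
  from below by the affine function H(rho) - int psi (rho' - rho), because the convex conjugate of P
  is attained along T. Conversely, if gamma couples m' = 1 + eps rho' with m = 1 + eps rho, then
  (id, T) gamma is admissible for rho', and a second-order expansion of psi shows that its cost
  exceeds the affine function by at most O(int |x - z|^2 d gamma). Since m is bounded below, mass can
  be moved from m' to m through a chain of many short steps that use m itself as an intermediary,
  which makes this error o(|rho' - rho|) in L^2. No potential for rho' is needed.
  The two bounds give differentiability; testing them at rho with the direction -t (psi' - psi)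
  shows that psi depends continuously on rho; this is uniform because convexity and periodicity
  bound |eps psi| by 1. The gradient determines psi because the derivative
  is tested on all trigonometric polynomials.
*)
theory Submission
  imports Defs "HOL-Probability.Probability"
begin

section \<open>The unit square as a torus\<close>

text \<open>At a nearby density no potential is available, so both bounds must come from the one
  potential at \<rho>. Duality gives the lower one without loss. For the upper one the error has to
  be small relative to the L^1 distance s of the two densities. Moving the surplus straight to the
  deficit costs s times a squared distance of order 1, which is as large as the linear term. With n
  relays the moved mass grows to n s, but the squared length of a move drops to order 1/n^2, for a
  total of order s/n. The relays must find mass to push on: every cell of area 1/n^2 has to hold at
  least n s of common mass. This is why n is fixed first, in terms of the tolerance, and the radius
  only afterwards. The continuity argument evaluates the functional at a trial density that is only
  as regular as the potentials, so the estimates are proved for continuous positive densities and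
  specialised to smooth ones at the end.\<close>

lemma space_torus [simp]: "space torus = cell"
  by (simp add: torus_def space_restrict_space)

lemma cell_borel [measurable]: "cell \<in> sets borel"
proof -
  have "cell = (\<Inter>i. {x. 0 \<le> x $ i \<and> x $ i < 1})" by (auto simp: cell_def)
  also have "\<dots> \<in> sets borel" by measurable
  finally show ?thesis .
qed

lemma emeasure_lborel_cbox_cart:
  fixes a b :: "real^'n"
  assumes "\<And>i. a $ i \<le> b $ i"
  shows "emeasure lborel (cbox a b) = ennreal (\<Prod>i\<in>UNIV. b $ i - a $ i)"
proof -
  have "cbox a b \<noteq> {}" using assms by (simp add: interval_ne_empty_cart)
  then have "measure lborel (cbox a b) = (\<Prod>i\<in>UNIV. b $ i - a $ i)"
    by (rule content_cbox_cart)
  then show ?thesis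
    using emeasure_eq_ennreal_measure[of lborel "cbox a b"] emeasure_lborel_cbox_finite[of a b]
    by (simp add: less_top)
qed

lemma emeasure_lborel_box_cart:
  fixes a b :: "real^'n"
  assumes "\<And>i. a $ i \<le> b $ i"
  shows "emeasure lborel (box a b) = ennreal (\<Prod>i\<in>UNIV. b $ i - a $ i)"
proof -
  have "emeasure lborel (box a b) = emeasure lborel (cbox a b)"
    by (simp add: emeasure_lborel_box_eq emeasure_lborel_cbox_eq)
  then show ?thesis using emeasure_lborel_cbox_cart[OF assms] by simp
qed

lemma emeasure_torus: "A \<subseteq> cell \<Longrightarrow> emeasure torus A = emeasure lborel A"
  unfolding torus_def by (rule emeasure_restrict_space) auto

lemma box_subset_cell: "box 0 1 \<subseteq> cell"
  by (auto simp: mem_box_cart cell_def less_imp_le)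

lemma cell_subset_cbox: "cell \<subseteq> cbox 0 1"
  by (auto simp: mem_box_cart cell_def less_imp_le)

text \<open>The half-open cell lies between the open and the closed unit box, both of measure
  1.\<close>

lemma prob_space_torus: "prob_space torus"
proof
  have "emeasure lborel (box 0 1 :: plane set) \<le> emeasure lborel cell"
    by (intro emeasure_mono box_subset_cell) auto
  moreover have "emeasure lborel cell \<le> emeasure lborel (cbox 0 1 :: plane set)"
    by (intro emeasure_mono cell_subset_cbox) auto
  ultimately show "emeasure torus (space torus) = 1"
    by (simp add: emeasure_torus emeasure_lborel_box_cart emeasure_lborel_cbox_cart)
qed

interpretation torus: prob_space torus
  by (rule prob_space_torus)

lemma borel_measurable_torusI [measurable (raw)]:
  "f \<in> borel_measurable borel \<Longrightarrow> f \<in> borel_measurable torus"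
  by (simp add: torus_def measurable_restrict_space1)

lemma continuous_imp_borel_torus:
  "continuous_on UNIV f \<Longrightarrow> f \<in> borel_measurable torus"
  by (intro borel_measurable_torusI borel_measurable_continuous_onI)

lemma compact_unit_square: "compact (cbox 0 (1::plane))" by (rule compact_cbox)

lemma continuous_bounded_cell:
  fixes f :: "plane \<Rightarrow> real"
  assumes "continuous_on UNIV f"
  obtains B where "0 \<le> B" "\<And>x. x \<in> cbox 0 1 \<Longrightarrow> \<bar>f x\<bar> \<le> B"
proof -
  have "bounded (f ` cbox 0 1)"
    by (intro compact_imp_bounded compact_continuous_image continuous_on_subset[OF assms]) auto
  then obtain B where B: "\<And>x. x \<in> cbox 0 1 \<Longrightarrow> \<bar>f x\<bar> \<le> B" by (auto simp: bounded_iff)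
  from B[of 0] have "0 \<le> B" by (auto simp: mem_box_cart)
  with B that show ?thesis by blast
qed

lemma integrable_torus_continuous:
  fixes f :: "plane \<Rightarrow> real"
  assumes "continuous_on UNIV f"
  shows "integrable torus f"
proof -
  obtain B where "\<And>x. x \<in> cbox 0 1 \<Longrightarrow> \<bar>f x\<bar> \<le> B" using continuous_bounded_cell[OF assms] by blast
  then show ?thesis
    using cell_subset_cbox
    by (intro torus.integrable_const_bound[of _ B] AE_I2 continuous_imp_borel_torus assms) auto
qed

section \<open>Reduction modulo the lattice and the torus distance\<close>

lemma lattice_floor: "(\<chi> i. of_int \<lfloor>x $ i\<rfloor>) \<in> lattice"
  by (simp add: lattice_def)

lemma reduce_eq: "reduce x = x - (\<chi> i. of_int \<lfloor>x $ i\<rfloor>)"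
  by (simp add: reduce_def vec_eq_iff frac_def)

lemma reduce_in_cell [simp]: "reduce x \<in> cell"
  by (simp add: reduce_def cell_def frac_lt_1)

lemma lattice_uminus: "k \<in> lattice \<Longrightarrow> - k \<in> lattice"
  by (simp add: lattice_def)

lemma periodic_reduce: "periodic f \<Longrightarrow> f (reduce x) = f x"
  using lattice_uminus[OF lattice_floor, of x] by (auto simp: periodic_def reduce_eq diff_conv_add_uminus simp del: add_uminus_conv_diff)

lemma reduce_measurable: "reduce \<in> borel_measurable borel"
proof (subst borel_measurable_euclidean_space, intro ballI)
  fix b :: plane assume "b \<in> Basis"
  then obtain i where "b = axis i 1" by (auto simp: Basis_vec_def)
  then have "(\<lambda>x. reduce x \<bullet> b) = (\<lambda>x. x $ i - of_int \<lfloor>x $ i\<rfloor>)"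
    by (simp add: reduce_def inner_axis frac_def fun_eq_iff)
  also have "\<dots> \<in> borel_measurable borel" by measurable
  finally show "(\<lambda>x. reduce x \<bullet> b) \<in> borel_measurable borel" .
qed

text \<open>As the distance to a set, the cost becomes continuous in the difference of its
  arguments, hence measurable.\<close>

lemma torus_dist_infdist: "torus_dist x y = infdist (x - y) lattice"
proof -
  have "lattice \<noteq> {}" using lattice_floor by blast
  then show ?thesis by (simp add: torus_dist_def infdist_def dist_norm)
qed

lemma torus_dist_le: "k \<in> lattice \<Longrightarrow> torus_dist x y \<le> norm (x - y - k)"
  by (simp add: torus_dist_infdist infdist_le flip: dist_norm)

lemma torus_dist_nonneg: "0 \<le> torus_dist x y"
  by (simp add: torus_dist_infdist infdist_nonneg)

lemma torus_dist_greatest: "(\<And>k. k \<in> lattice \<Longrightarrow> v \<le> norm (x - y - k)) \<Longrightarrow> v \<le> torus_dist x y"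
  using lattice_floor unfolding torus_dist_def by (intro cINF_greatest) auto

text \<open>Duality gives a bound for each lattice translate separately. The passage to the infimum
  goes through the unsquared bound \<open>sqrt (2 * v)\<close>, which carries information only for
  positive \<open>v\<close>; hence the case distinction.\<close>

lemma half_torus_dist_sq_greatest:
  assumes "\<And>k. k \<in> lattice \<Longrightarrow> v \<le> (norm (x - y - k))\<^sup>2 / 2"
  shows "v \<le> (torus_dist x y)\<^sup>2 / 2"
proof (cases "v \<le> 0")
  case True
  then show ?thesis by (meson divide_nonneg_pos order_trans zero_le_power2 zero_less_numeral)
next
  case False
  have "sqrt (2 * v) \<le> norm (x - y - k)" if "k \<in> lattice" for k
    using assms[OF that] by (intro real_le_lsqrt) auto
  then have "sqrt (2 * v) \<le> torus_dist x y" by (rule torus_dist_greatest)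
  then have "(sqrt (2 * v))\<^sup>2 \<le> (torus_dist x y)\<^sup>2" using False by (intro power_mono) auto
  then show ?thesis using False by simp
qed

lemma torus_dist_sq_le:
  assumes "k \<in> lattice"
  shows "(torus_dist x y)\<^sup>2 \<le> (norm (x - y - k))\<^sup>2"
  by (intro power_mono torus_dist_le assms torus_dist_nonneg)

lemma torus_dist_reduce_le: "(torus_dist x (reduce y))\<^sup>2 \<le> (norm (x - y))\<^sup>2"
  using torus_dist_sq_le[OF lattice_floor, of x "reduce y" y] by (simp add: reduce_eq)

lemma torus_dist_measurable:
  "(\<lambda>z. torus_dist (fst z) (snd z)) \<in> borel_measurable (borel \<Otimes>\<^sub>M borel)"
  unfolding borel_prod torus_dist_infdist
  by (intro borel_measurable_continuous_onI continuous_intros)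

lemma measurable_into_torus:
  assumes "f \<in> borel_measurable M" "\<And>x. x \<in> space M \<Longrightarrow> f x \<in> cell"
  shows "f \<in> measurable M torus"
  unfolding torus_def using assms by (intro measurable_restrict_space2) auto

section \<open>Couplings from mass flows between cells\<close>

text \<open>The density \<open>S\<close> stays in place, \<open>P\<close> leaves and \<open>T\<close> arrives. Of the mass \<open>P\<close> in cell
  \<open>v\<close> the amount \<open>u v w\<close> goes to cell \<open>w\<close>, where it is distributed proportionally to \<open>T\<close>.\<close>

locale mass_flow = prob_space M for M :: "'a measure" +
  fixes q :: "'a \<Rightarrow> 'i" and I :: "'i set" and u :: "'i \<Rightarrow> 'i \<Rightarrow> real" and S P T :: "'a \<Rightarrow> real"
  assumes fin: "finite I" and q_in: "\<And>x. x \<in> space M \<Longrightarrow> q x \<in> I"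
    and q_meas [measurable]: "q \<in> measurable M (count_space UNIV)"
    and S_int: "integrable M S" and P_int: "integrable M P" and T_int: "integrable M T"
    and S_nonneg: "\<And>x. x \<in> space M \<Longrightarrow> 0 \<le> S x"
    and P_nonneg: "\<And>x. x \<in> space M \<Longrightarrow> 0 \<le> P x"
    and T_nonneg: "\<And>x. x \<in> space M \<Longrightarrow> 0 \<le> T x"
    and u_nonneg: "\<And>v w. 0 \<le> u v w"
    and out: "\<And>v. v \<in> I \<Longrightarrow> (\<Sum>w\<in>I. u v w) = (LINT x|M. (if q x = v then P x else 0))"
    and inc: "\<And>w. w \<in> I \<Longrightarrow> (\<Sum>v\<in>I. u v w) = (LINT x|M. (if q x = w then T x else 0))"
begin

text \<open>A factor that is constant on each cell leaves the integral cell by cell. This turns the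
  marginals of the moving mass into the finite sums of \<open>out\<close> and
  \<open>inc\<close>.\<close>

lemma nn_integral_by_cells:
  assumes f: "integrable M f" "\<And>x. x \<in> space M \<Longrightarrow> 0 \<le> f x" and k: "\<And>w. 0 \<le> k w"
  shows "(\<integral>\<^sup>+x. ennreal (k (q x) * f x) \<partial>M) = ennreal (\<Sum>w\<in>I. k w * (LINT x|M. (if q x = w then f x else 0)))"
proof -
  have [measurable]: "f \<in> borel_measurable M" using f by auto
  have int: "integrable M (\<lambda>x. if q x = w then f x else 0)" for w
    by (rule Bochner_Integration.integrable_bound[OF f(1)]) auto
  have eq: "k (q x) * f x = (\<Sum>w\<in>I. k w * (if q x = w then f x else 0))" if "x \<in> space M" for x
  proof -
    have "(\<Sum>w\<in>I. k w * (if q x = w then f x else 0)) = (\<Sum>w\<in>I. if w = q x then k (q x) * f x else 0)"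
      by (rule sum.cong) auto
    also have "\<dots> = k (q x) * f x" using q_in[OF that] fin by (simp only: sum.delta if_True)
    finally show ?thesis by (rule sym)
  qed
  have "(\<integral>\<^sup>+x. ennreal (k (q x) * f x) \<partial>M)
      = (\<integral>\<^sup>+x. ennreal (\<Sum>w\<in>I. k w * (if q x = w then f x else 0)) \<partial>M)"
    by (intro nn_integral_cong arg_cong[where f=ennreal] eq)
  also have "\<dots> = ennreal (LINT x|M. (\<Sum>w\<in>I. k w * (if q x = w then f x else 0)))"
    using int f k by (intro nn_integral_eq_integral) (auto intro!: AE_I2 sum_nonneg)
  also have "(LINT x|M. (\<Sum>w\<in>I. k w * (if q x = w then f x else 0)))
     = (\<Sum>w\<in>I. k w * (LINT x|M. (if q x = w then f x else 0)))"
    using int by (subst Bochner_Integration.integral_sum) auto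
  finally show ?thesis .
qed

abbreviation "outflow v \<equiv> \<Sum>w\<in>I. u v w"
abbreviation "inflow w \<equiv> \<Sum>v\<in>I. u v w"

text \<open>Normalising \<open>P\<close> on the source cell by its outflow and \<open>T\<close> on
  the target cell by its inflow makes this density carry exactly \<open>u v w\<close> from cell
  \<open>v\<close> to cell \<open>w\<close>. Where a total is zero, division yields 0, and the
  marginals have to account for that.\<close>

definition moving :: "'a \<Rightarrow> 'a \<Rightarrow> real" where
  "moving x y = u (q x) (q y) / (outflow (q x) * inflow (q y)) * P x * T y"

text \<open>\<open>f\<close> is arbitrary and the index type need not be countable, so the
  composition is rewritten as a finite sum over the pairs of cells that occur.\<close>

lemma measurable_q2 [measurable]: "(\<lambda>z. f (q (fst z)) (q (snd z)) :: real) \<in> borel_measurable (M \<Otimes>\<^sub>M M)"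
proof -
  have "(\<lambda>z. f (q (fst z)) (q (snd z))) \<in> borel_measurable (M \<Otimes>\<^sub>M M) \<longleftrightarrow>
     (\<lambda>z. \<Sum>v\<in>I. \<Sum>w\<in>I. if q (fst z) = v \<and> q (snd z) = w then f v w else 0) \<in> borel_measurable (M \<Otimes>\<^sub>M M)"
  proof (rule measurable_cong)
    fix z assume z: "z \<in> space (M \<Otimes>\<^sub>M M)"
    have "(\<Sum>v\<in>I. \<Sum>w\<in>I. if q (fst z) = v \<and> q (snd z) = w then f v w else 0)
        = (\<Sum>v\<in>I. if v = q (fst z) then \<Sum>w\<in>I. if w = q (snd z) then f v w else 0 else 0)"
      by (rule sum.cong) (auto intro: sum.cong)
    also have "\<dots> = f (q (fst z)) (q (snd z))"
      using z q_in[of "fst z"] q_in[of "snd z"] by (auto simp: space_pair_measure sum.delta[OF fin])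
    finally show "f (q (fst z)) (q (snd z)) = (\<Sum>v\<in>I. \<Sum>w\<in>I. if q (fst z) = v \<and> q (snd z) = w then f v w else 0)"
      by simp
  qed
  also have \<dots> by measurable
  finally show ?thesis .
qed

lemma moving_measurable [measurable]: "(\<lambda>z. moving (fst z) (snd z)) \<in> borel_measurable (M \<Otimes>\<^sub>M M)"
proof -
  have [measurable]: "P \<in> borel_measurable M" "T \<in> borel_measurable M" using P_int T_int by auto
  show ?thesis unfolding moving_def by measurable
qed

lemma moving_measurable_fst [measurable]: "y \<in> space M \<Longrightarrow> (\<lambda>x. moving x y) \<in> borel_measurable M"
  using measurable_Pair1[OF moving_measurable, of y] by simp

lemma moving_measurable_snd [measurable]: "x \<in> space M \<Longrightarrow> (\<lambda>y. moving x y) \<in> borel_measurable M"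
  using measurable_Pair2[OF moving_measurable, of x] by simp

text \<open>Handles the cells where \<open>moving\<close> divides by zero: a nonnegative function
  with zero integral over a cell vanishes there almost everywhere, so the default value 0 is right
  up to a null set.\<close>

lemma cell_null:
  fixes f :: "'a \<Rightarrow> real"
  assumes f: "integrable M f" "\<And>x. x \<in> space M \<Longrightarrow> 0 \<le> f x"
    and N: "\<And>v. v \<in> I \<Longrightarrow> N v = (LINT x|M. (if q x = v then f x else 0))"
  shows "AE x in M. N (q x) = 0 \<longrightarrow> f x = 0"
proof -
  have [measurable]: "f \<in> borel_measurable M" using f by auto
  have int: "integrable M (\<lambda>x. if q x = w then f x else 0)" for w
    by (rule Bochner_Integration.integrable_bound[OF f(1)]) auto
  have "AE x in M. q x = v \<longrightarrow> N v = 0 \<longrightarrow> f x = 0" if "v \<in> I" for v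
  proof (cases "N v = 0")
    case True
    then have "AE x in M. (if q x = v then f x else 0) = 0"
      using N[OF that] int f(2) by (subst integral_nonneg_eq_0_iff_AE[symmetric]) (auto intro!: AE_I2)
    then show ?thesis by eventually_elim (auto split: if_splits)
  qed simp
  then have "AE x in M. \<forall>v\<in>I. q x = v \<longrightarrow> N v = 0 \<longrightarrow> f x = 0"
    using fin by (subst AE_finite_all) auto
  then show ?thesis using AE_space by eventually_elim (use q_in in auto)
qed

lemma u_zero_inflow: "v \<in> I \<Longrightarrow> w \<in> I \<Longrightarrow> inflow w = 0 \<Longrightarrow> u v w = 0"
  using sum_nonneg_eq_0_iff[OF fin, of "\<lambda>v. u v w"] u_nonneg by auto

lemma u_zero_outflow: "v \<in> I \<Longrightarrow> w \<in> I \<Longrightarrow> outflow v = 0 \<Longrightarrow> u v w = 0"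
  using sum_nonneg_eq_0_iff[OF fin, of "\<lambda>w. u v w"] u_nonneg by auto

text \<open>Integration over a target cell \<open>w\<close> cancels \<open>inflow w\<close>; summing
  \<open>u (q x) w\<close> over \<open>w\<close> then cancels \<open>outflow (q x)\<close>. In a
  cell without outflow both sides are 0 almost everywhere.\<close>

lemma moving_fst: "AE x in M. (\<integral>\<^sup>+y. ennreal (moving x y) \<partial>M) = ennreal (P x)"
proof -
  have "AE x in M. outflow (q x) = 0 \<longrightarrow> P x = 0"
    by (rule cell_null[OF P_int]) (auto intro: P_nonneg out)
  with AE_space show ?thesis
proof eventually_elim
  case (elim x)
  have v: "q x \<in> I" using elim q_in by auto
  have "(\<integral>\<^sup>+y. ennreal (moving x y) \<partial>M)
     = (\<integral>\<^sup>+y. ennreal ((u (q x) (q y) / (outflow (q x) * inflow (q y)) * P x) * T y) \<partial>M)"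
    by (simp add: moving_def)
  also have "\<dots> = ennreal (\<Sum>w\<in>I. (u (q x) w / (outflow (q x) * inflow w) * P x) * inflow w)"
    using elim P_nonneg u_nonneg
    by (subst nn_integral_by_cells[OF T_int T_nonneg, of "\<lambda>w. u (q x) w / (outflow (q x) * inflow w) * P x"])
      (auto simp: inc intro!: mult_nonneg_nonneg divide_nonneg_nonneg sum_nonneg)
  also have "(\<Sum>w\<in>I. (u (q x) w / (outflow (q x) * inflow w) * P x) * inflow w)
      = (\<Sum>w\<in>I. u (q x) w / outflow (q x) * P x)"
  proof (intro sum.cong refl)
    fix w assume "w \<in> I"
    then show "(u (q x) w / (outflow (q x) * inflow w) * P x) * inflow w = u (q x) w / outflow (q x) * P x"
      using u_zero_inflow[OF v] by (cases "inflow w = 0") auto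
  qed
  also have "\<dots> = outflow (q x) / outflow (q x) * P x"
    by (simp only: sum_divide_distrib sum_distrib_right)
  also have "\<dots> = P x" using elim(2) by (cases "outflow (q x) = 0") (simp_all only: divide_self mult_1 mult_zero_right simp_thms)
  finally show ?case .
qed
qed

lemma moving_snd: "AE y in M. (\<integral>\<^sup>+x. ennreal (moving x y) \<partial>M) = ennreal (T y)"
proof -
  have "AE x in M. inflow (q x) = 0 \<longrightarrow> T x = 0"
    by (rule cell_null[OF T_int]) (auto intro: T_nonneg inc)
  with AE_space show ?thesis
proof eventually_elim
  case (elim y)
  have w: "q y \<in> I" using elim q_in by auto
  have "(\<integral>\<^sup>+x. ennreal (moving x y) \<partial>M)
     = (\<integral>\<^sup>+x. ennreal ((u (q x) (q y) / (outflow (q x) * inflow (q y)) * T y) * P x) \<partial>M)"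
    by (simp add: moving_def mult_ac)
  also have "\<dots> = ennreal (\<Sum>v\<in>I. (u v (q y) / (outflow v * inflow (q y)) * T y) * outflow v)"
    using elim T_nonneg u_nonneg
    by (subst nn_integral_by_cells[OF P_int P_nonneg, of "\<lambda>v. u v (q y) / (outflow v * inflow (q y)) * T y"])
      (auto simp: out intro!: mult_nonneg_nonneg divide_nonneg_nonneg sum_nonneg)
  also have "(\<Sum>v\<in>I. (u v (q y) / (outflow v * inflow (q y)) * T y) * outflow v)
      = (\<Sum>v\<in>I. u v (q y) / inflow (q y) * T y)"
  proof (intro sum.cong refl)
    fix v assume "v \<in> I"
    then show "(u v (q y) / (outflow v * inflow (q y)) * T y) * outflow v = u v (q y) / inflow (q y) * T y"
      using u_zero_outflow[OF _ w] by (cases "outflow v = 0") auto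
  qed
  also have "\<dots> = inflow (q y) / inflow (q y) * T y"
    by (simp only: sum_divide_distrib sum_distrib_right)
  also have "\<dots> = T y" using elim(2) by (cases "inflow (q y) = 0") (simp_all only: divide_self mult_1 mult_zero_right simp_thms)
  finally show ?case .
qed
qed

text \<open>The Boolean tag separates the moving mass from the resting mass, so that the plan, a sum of an
  absolutely continuous measure and a measure on the diagonal, is the image of a single density.\<close>

definition weight :: "('a \<times> 'a) \<times> bool \<Rightarrow> ennreal" where
  "weight z = (if snd z then ennreal (moving (fst (fst z)) (snd (fst z))) else ennreal (S (fst (fst z))))"

definition plan :: "('a \<times> 'a) measure" where
  "plan = distr (density ((M \<Otimes>\<^sub>M M) \<Otimes>\<^sub>M count_space UNIV) weight) (M \<Otimes>\<^sub>M M)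
     (\<lambda>z. (fst (fst z), if snd z then snd (fst z) else fst (fst z)))"

lemma sets_plan [simp]: "sets plan = sets (M \<Otimes>\<^sub>M M)"
  by (simp add: plan_def)

lemma nn_integral_plan:
  assumes [measurable]: "F \<in> borel_measurable (M \<Otimes>\<^sub>M M)"
  shows "(\<integral>\<^sup>+z. F z \<partial>plan) = (\<integral>\<^sup>+z. ennreal (moving (fst z) (snd z)) * F z \<partial>(M \<Otimes>\<^sub>M M))
     + (\<integral>\<^sup>+x. ennreal (S x) * F (x, x) \<partial>M)"
proof -
  have [measurable]: "S \<in> borel_measurable M" using S_int by auto
  let ?B = "count_space (UNIV :: bool set)"
  let ?N = "(M \<Otimes>\<^sub>M M) \<Otimes>\<^sub>M ?B"
  have snd_meas [measurable]: "Measurable.pred ?N snd"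
    by simp
  have [measurable]: "weight \<in> borel_measurable ?N" unfolding weight_def by measurable
  have phi [measurable]: "(\<lambda>z. (fst (fst z), if snd z then snd (fst z) else fst (fst z))) \<in> measurable ?N (M \<Otimes>\<^sub>M M)"
    by measurable
  interpret B: sigma_finite_measure ?B by (rule sigma_finite_measure_count_space_finite) simp
  have "(\<integral>\<^sup>+z. F z \<partial>plan) = (\<integral>\<^sup>+z. weight z * F (fst (fst z), if snd z then snd (fst z) else fst (fst z)) \<partial>?N)"
    unfolding plan_def by (subst nn_integral_distr) (auto simp: nn_integral_density)
  also have "\<dots> = (\<integral>\<^sup>+y. \<integral>\<^sup>+b. weight (y, b) * F (fst y, if b then snd y else fst y) \<partial>?B \<partial>(M \<Otimes>\<^sub>M M))"
    by (subst B.nn_integral_fst[symmetric]) (simp_all cong: if_cong)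
  also have "\<dots> = (\<integral>\<^sup>+y. ennreal (moving (fst y) (snd y)) * F y + ennreal (S (fst y)) * F (fst y, fst y) \<partial>(M \<Otimes>\<^sub>M M))"
    by (intro nn_integral_cong) (simp add: nn_integral_count_space_finite UNIV_bool weight_def add.commute)
  also have "\<dots> = (\<integral>\<^sup>+y. ennreal (moving (fst y) (snd y)) * F y \<partial>(M \<Otimes>\<^sub>M M))
      + (\<integral>\<^sup>+y. ennreal (S (fst y)) * F (fst y, fst y) \<partial>(M \<Otimes>\<^sub>M M))"
    by (intro nn_integral_add) auto
  \<comment> \<open>Resting mass ignores the second coordinate, and integrating it out gives the
    factor 1 because \<open>M\<close> is a probability measure.\<close>
  also have "(\<integral>\<^sup>+y. ennreal (S (fst y)) * F (fst y, fst y) \<partial>(M \<Otimes>\<^sub>M M)) = (\<integral>\<^sup>+x. ennreal (S x) * F (x, x) \<partial>M)"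
    by (subst nn_integral_fst[symmetric]) (auto simp: emeasure_space_1)
  finally show ?thesis .
qed

lemma distr_plan_fst: "distr plan M fst = density M (\<lambda>x. ennreal (S x + P x))"
proof (rule measure_eqI)
  have [measurable]: "S \<in> borel_measurable M" "P \<in> borel_measurable M" using S_int P_int by auto
  fix A assume "A \<in> sets (distr plan M fst)"
  then have A [measurable]: "A \<in> sets M" by simp
  have fst_meas: "fst \<in> measurable plan M" using measurable_fst[of M M] unfolding measurable_cong_sets[OF sets_plan refl] .
  have "emeasure (distr plan M fst) A = (\<integral>\<^sup>+x. indicator A x \<partial>distr plan M fst)"
    by simp
  also have "\<dots> = (\<integral>\<^sup>+z. indicator A (fst z) \<partial>plan)"
    by (subst nn_integral_distr[OF fst_meas]) auto
  also have "\<dots> = (\<integral>\<^sup>+z. ennreal (moving (fst z) (snd z)) * indicator A (fst z) \<partial>(M \<Otimes>\<^sub>M M))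
     + (\<integral>\<^sup>+x. ennreal (S x) * indicator A x \<partial>M)"
    by (subst nn_integral_plan) auto
  also have "(\<integral>\<^sup>+z. ennreal (moving (fst z) (snd z)) * indicator A (fst z) \<partial>(M \<Otimes>\<^sub>M M))
     = (\<integral>\<^sup>+x. (\<integral>\<^sup>+y. ennreal (moving x y) * indicator A x \<partial>M) \<partial>M)"
    by (subst nn_integral_fst[symmetric]) auto
  also have "\<dots> = (\<integral>\<^sup>+x. (\<integral>\<^sup>+y. ennreal (moving x y) \<partial>M) * indicator A x \<partial>M)"
    by (intro nn_integral_cong nn_integral_multc) measurable
  also have "\<dots> = (\<integral>\<^sup>+x. ennreal (P x) * indicator A x \<partial>M)"
    using moving_fst by (auto intro!: nn_integral_cong_AE elim!: eventually_mono)
  also have "(\<integral>\<^sup>+x. ennreal (P x) * indicator A x \<partial>M) + (\<integral>\<^sup>+x. ennreal (S x) * indicator A x \<partial>M)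
      = (\<integral>\<^sup>+x. ennreal (P x) * indicator A x + ennreal (S x) * indicator A x \<partial>M)"
    by (intro nn_integral_add[symmetric]) auto
  also have "\<dots> = (\<integral>\<^sup>+x. ennreal (S x + P x) * indicator A x \<partial>M)"
    by (intro nn_integral_cong) (simp add: S_nonneg P_nonneg ennreal_plus distrib_right add.commute del: ennreal_plus[symmetric])
  also have "\<dots> = emeasure (density M (\<lambda>x. ennreal (S x + P x))) A"
    by (simp add: emeasure_density)
  finally show "emeasure (distr plan M fst) A = emeasure (density M (\<lambda>x. ennreal (S x + P x))) A" .
qed simp

lemma distr_plan_snd: "distr plan M snd = density M (\<lambda>x. ennreal (S x + T x))"
proof (rule measure_eqI)
  have [measurable]: "S \<in> borel_measurable M" "T \<in> borel_measurable M" using S_int T_int by auto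
  interpret MM: pair_sigma_finite M M ..
  fix A assume "A \<in> sets (distr plan M snd)"
  then have A [measurable]: "A \<in> sets M" by simp
  have snd_meas: "snd \<in> measurable plan M" using measurable_snd[of M M] unfolding measurable_cong_sets[OF sets_plan refl] .
  have "emeasure (distr plan M snd) A = (\<integral>\<^sup>+x. indicator A x \<partial>distr plan M snd)"
    by simp
  also have "\<dots> = (\<integral>\<^sup>+z. indicator A (snd z) \<partial>plan)"
    by (subst nn_integral_distr[OF snd_meas]) auto
  also have "\<dots> = (\<integral>\<^sup>+z. ennreal (moving (fst z) (snd z)) * indicator A (snd z) \<partial>(M \<Otimes>\<^sub>M M))
     + (\<integral>\<^sup>+x. ennreal (S x) * indicator A x \<partial>M)"
    by (subst nn_integral_plan) auto
  also have "(\<integral>\<^sup>+z. ennreal (moving (fst z) (snd z)) * indicator A (snd z) \<partial>(M \<Otimes>\<^sub>M M))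
     = (\<integral>\<^sup>+y. (\<integral>\<^sup>+x. ennreal (moving x y) * indicator A y \<partial>M) \<partial>M)"
    by (subst MM.nn_integral_snd[symmetric]) (auto simp: case_prod_beta')
  also have "\<dots> = (\<integral>\<^sup>+y. (\<integral>\<^sup>+x. ennreal (moving x y) \<partial>M) * indicator A y \<partial>M)"
    by (intro nn_integral_cong nn_integral_multc) measurable
  also have "\<dots> = (\<integral>\<^sup>+x. ennreal (T x) * indicator A x \<partial>M)"
    using moving_snd by (auto intro!: nn_integral_cong_AE elim!: eventually_mono)
  also have "(\<integral>\<^sup>+x. ennreal (T x) * indicator A x \<partial>M) + (\<integral>\<^sup>+x. ennreal (S x) * indicator A x \<partial>M)
      = (\<integral>\<^sup>+x. ennreal (T x) * indicator A x + ennreal (S x) * indicator A x \<partial>M)"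
    by (intro nn_integral_add[symmetric]) auto
  also have "\<dots> = (\<integral>\<^sup>+x. ennreal (S x + T x) * indicator A x \<partial>M)"
    by (intro nn_integral_cong) (simp add: S_nonneg T_nonneg ennreal_plus distrib_right add.commute del: ennreal_plus[symmetric])
  also have "\<dots> = emeasure (density M (\<lambda>x. ennreal (S x + T x))) A"
    by (simp add: emeasure_density)
  finally show "emeasure (distr plan M snd) A = emeasure (density M (\<lambda>x. ennreal (S x + T x))) A" .
qed simp

text \<open>Resting mass lies on the diagonal and is free, and the moving density vanishes where
  \<open>u\<close> does. So \<open>F\<close> has to be controlled only between cells that exchange
  mass, and what remains is the total mass in motion.\<close>

lemma plan_cost_le:
  assumes [measurable]: "F \<in> borel_measurable (M \<Otimes>\<^sub>M M)"
    and diag: "\<And>x. x \<in> space M \<Longrightarrow> F (x, x) = 0"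
    and K: "0 \<le> K"
    and F: "\<And>x y. x \<in> space M \<Longrightarrow> y \<in> space M \<Longrightarrow> u (q x) (q y) > 0 \<Longrightarrow> F (x, y) \<le> ennreal K"
  shows "(\<integral>\<^sup>+z. F z \<partial>plan) \<le> ennreal (K * (\<Sum>v\<in>I. \<Sum>w\<in>I. u v w))"
proof -
  have [measurable]: "P \<in> borel_measurable M" using P_int by auto
  have "(\<integral>\<^sup>+z. F z \<partial>plan) = (\<integral>\<^sup>+z. ennreal (moving (fst z) (snd z)) * F z \<partial>(M \<Otimes>\<^sub>M M))
     + (\<integral>\<^sup>+x. ennreal (S x) * F (x, x) \<partial>M)"
    by (rule nn_integral_plan) simp
  also have "(\<integral>\<^sup>+x. ennreal (S x) * F (x, x) \<partial>M) = (\<integral>\<^sup>+x. 0 \<partial>M)"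
    by (intro nn_integral_cong) (simp add: diag)
  also have "(\<integral>\<^sup>+z. ennreal (moving (fst z) (snd z)) * F z \<partial>(M \<Otimes>\<^sub>M M)) + (\<integral>\<^sup>+x. 0 \<partial>M)
     \<le> (\<integral>\<^sup>+z. ennreal (moving (fst z) (snd z)) * ennreal K \<partial>(M \<Otimes>\<^sub>M M))"
  proof (simp, intro nn_integral_mono)
    fix z assume z: "z \<in> space (M \<Otimes>\<^sub>M M)"
    then have sp: "fst z \<in> space M" "snd z \<in> space M" by (auto simp: space_pair_measure)
    show "ennreal (moving (fst z) (snd z)) * F z \<le> ennreal (moving (fst z) (snd z)) * ennreal K"
    proof (cases "u (q (fst z)) (q (snd z)) > 0")
      case True
      then show ?thesis using F[OF sp] by (intro mult_left_mono) auto
    next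
      case False
      then have "u (q (fst z)) (q (snd z)) = 0" using u_nonneg[of "q (fst z)" "q (snd z)"] by simp
      then show ?thesis by (simp add: moving_def)
    qed
  qed
  also have "\<dots> = (\<integral>\<^sup>+z. ennreal (moving (fst z) (snd z)) \<partial>(M \<Otimes>\<^sub>M M)) * ennreal K"
    by (intro nn_integral_multc) auto
  also have "(\<integral>\<^sup>+z. ennreal (moving (fst z) (snd z)) \<partial>(M \<Otimes>\<^sub>M M))
      = (\<integral>\<^sup>+x. (\<integral>\<^sup>+y. ennreal (moving x y) \<partial>M) \<partial>M)"
    by (subst nn_integral_fst[symmetric]) auto
  also have "\<dots> = (\<integral>\<^sup>+x. ennreal (P x) \<partial>M)"
    using moving_fst by (rule nn_integral_cong_AE)
  also have "\<dots> = ennreal (\<Sum>v\<in>I. outflow v)"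
    using nn_integral_by_cells[OF P_int P_nonneg, of "\<lambda>_. 1"] by (simp add: out)
  finally show ?thesis
    using K by (simp add: ennreal_mult' mult.commute sum_nonneg u_nonneg)
qed

end

section \<open>Transport between nearby densities\<close>

text \<open>A king's walk from \<open>i\<close> to \<open>j\<close> on the integer grid. Moving mass along walks of \<open>n\<close> steps of length
  \<open>O(1/n)\<close> costs \<open>O(1/n)\<close> times the mass; a direct move would only give \<open>O(1)\<close>.\<close>

definition clamp_path :: "int \<times> int \<Rightarrow> int \<times> int \<Rightarrow> nat \<Rightarrow> int \<times> int" where
  "clamp_path i j k = (max (fst i - int k) (min (fst i + int k) (fst j)),
                       max (snd i - int k) (min (snd i + int k) (snd j)))"

lemma clamp_path_0 [simp]: "clamp_path i j 0 = i"
  by (simp add: clamp_path_def)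

definition grid :: "nat \<Rightarrow> (int \<times> int) set" where
  "grid n = {0..<int n} \<times> {0..<int n}"

lemma finite_grid [simp]: "finite (grid n)" by (simp add: grid_def)

lemma clamp_path_end: "i \<in> grid n \<Longrightarrow> j \<in> grid n \<Longrightarrow> clamp_path i j n = j"
  by (auto simp: clamp_path_def grid_def prod_eq_iff)

lemma clamp_path_in: "i \<in> grid n \<Longrightarrow> j \<in> grid n \<Longrightarrow> clamp_path i j k \<in> grid n"
  by (auto simp: clamp_path_def grid_def)

lemma clamp_path_step:
  "\<bar>fst (clamp_path i j (Suc k)) - fst (clamp_path i j k)\<bar> \<le> 1"
  "\<bar>snd (clamp_path i j (Suc k)) - snd (clamp_path i j k)\<bar> \<le> 1"
  by (auto simp: clamp_path_def)

text \<open>Every source \<open>i\<close> sends \<open>a i * b j / s\<close> to every target \<open>j\<close>; \<open>X\<close> is the mass in transit.\<close>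

lemma grid_flow_exists:
  fixes a b :: "int \<times> int \<Rightarrow> real"
  assumes n: "n > 0" and a: "\<And>v. 0 \<le> a v" and b: "\<And>v. 0 \<le> b v"
    and sa: "sum a (grid n) = s" and sb: "sum b (grid n) = s"
  obtains u X where "\<And>v w. 0 \<le> u v w" "\<And>v. 0 \<le> X v" "\<And>v. X v \<le> n * s"
    "\<And>v. v \<in> grid n \<Longrightarrow> (\<Sum>w\<in>grid n. u v w) = a v + X v"
    "\<And>w. w \<in> grid n \<Longrightarrow> (\<Sum>v\<in>grid n. u v w) = b w + X w"
    "(\<Sum>v\<in>grid n. \<Sum>w\<in>grid n. u v w) = n * s"
    "\<And>v w. 0 < u v w \<Longrightarrow> \<bar>fst w - fst v\<bar> \<le> 1 \<and> \<bar>snd w - snd v\<bar> \<le> 1"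
proof -
  let ?G = "grid n"
  define c where "c i j = a i * b j / s" for i j
  have s: "0 \<le> s" unfolding sa[symmetric] by (intro sum_nonneg a)
  have c: "0 \<le> c i j" for i j using a b s by (simp add: c_def)
  \<comment> \<open>The mass of all walks stepping from \<open>v\<close> to \<open>w\<close>,
    counted with multiplicity. A walk that arrives early waits at its target, so
    \<open>u v v\<close> can be positive.\<close>
  define u where "u v w = (\<Sum>i\<in>?G. \<Sum>j\<in>?G. c i j *
     (\<Sum>k<n. if clamp_path i j k = v \<and> clamp_path i j (Suc k) = w then 1 else 0))" for v w
  \<comment> \<open>Only the times 1 to \<open>n - 1\<close> count as transit: time 0 yields the
    source term \<open>a\<close> and time \<open>n\<close> the target term \<open>b\<close>.\<close>
  define X where "X v = (\<Sum>i\<in>?G. \<Sum>j\<in>?G. c i j * (\<Sum>k=1..<n. if clamp_path i j k = v then 1 else 0))" for v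
  \<comment> \<open>For \<open>s = 0\<close> the quotient in \<open>c\<close> is 0, and its
    marginals are still correct because \<open>a\<close> and \<open>b\<close> vanish on the
    grid.\<close>
  have zero: "a v = 0" "b v = 0" if "s = 0" "v \<in> ?G" for v
    using sum_nonneg_eq_0_iff[of ?G a] sum_nonneg_eq_0_iff[of ?G b] that sa sb a b by auto
  have ca: "(\<Sum>j\<in>?G. c i j) = a i" if "i \<in> ?G" for i
  proof -
    have "(\<Sum>j\<in>?G. c i j) = a i * s / s" unfolding c_def sb[symmetric]
      by (simp only: sum_distrib_left sum_divide_distrib)
    then show ?thesis using zero that by (cases "s = 0") auto
  qed
  have cb: "(\<Sum>i\<in>?G. c i j) = b j" if "j \<in> ?G" for j
  proof -
    have "(\<Sum>i\<in>?G. c i j) = s * b j / s" unfolding c_def sa[symmetric]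
      by (simp only: sum_distrib_right sum_divide_distrib)
    then show ?thesis using zero that by (cases "s = 0") auto
  qed
  have cc: "(\<Sum>i\<in>?G. \<Sum>j\<in>?G. c i j) = s" using ca sa by simp
  have sum_split: "(\<Sum>k<n. f k) = f 0 + (\<Sum>k=1..<n. f k)" for f :: "nat \<Rightarrow> real"
    using n by (simp add: lessThan_atLeast0 sum.atLeast_Suc_lessThan)
  have sum_split': "(\<Sum>k<n. f (Suc k)) = (\<Sum>k=1..<n. f k) + f n" for f :: "nat \<Rightarrow> real"
    using n sum_split[of f] by (simp add: sum.lessThan_Suc_shift[symmetric] flip: sum.lessThan_Suc)
      (metis add.commute add_diff_cancel_left' add_diff_eq sum.lessThan_Suc sum.lessThan_Suc_shift sum_split)
  have out: "(\<Sum>w\<in>?G. u v w) = (\<Sum>i\<in>?G. \<Sum>j\<in>?G. c i j * (\<Sum>k<n. if clamp_path i j k = v then 1 else 0))" for v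
  proof -
    have "(\<Sum>w\<in>?G. u v w) = (\<Sum>i\<in>?G. \<Sum>j\<in>?G. \<Sum>w\<in>?G. c i j *
       (\<Sum>k<n. if clamp_path i j k = v \<and> clamp_path i j (Suc k) = w then 1 else 0))"
      unfolding u_def by (subst sum.swap, rule sum.cong[OF refl], rule sum.swap)
    also have "\<dots> = (\<Sum>i\<in>?G. \<Sum>j\<in>?G. c i j * (\<Sum>k<n. if clamp_path i j k = v then 1 else 0))"
    proof (intro sum.cong refl)
      fix i j assume ij: "i \<in> ?G" "j \<in> ?G"
      have "(\<Sum>w\<in>?G. if clamp_path i j k = v \<and> clamp_path i j (Suc k) = w then 1 else 0) =
            (if clamp_path i j k = v then 1 else (0::real))" for k
        using clamp_path_in[OF ij, of "Suc k"] by (cases "clamp_path i j k = v") (simp_all add: sum.delta')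
      then show "(\<Sum>w\<in>?G. c i j * (\<Sum>k<n. if clamp_path i j k = v \<and> clamp_path i j (Suc k) = w then 1 else 0))
        = c i j * (\<Sum>k<n. if clamp_path i j k = v then 1 else 0)"
        by (subst sum_distrib_left[symmetric], subst sum.swap) simp
    qed
    finally show ?thesis .
  qed
  have inc: "(\<Sum>v\<in>?G. u v w) = (\<Sum>i\<in>?G. \<Sum>j\<in>?G. c i j * (\<Sum>k<n. if clamp_path i j (Suc k) = w then 1 else 0))" for w
  proof -
    have "(\<Sum>v\<in>?G. u v w) = (\<Sum>i\<in>?G. \<Sum>j\<in>?G. \<Sum>v\<in>?G. c i j *
       (\<Sum>k<n. if clamp_path i j k = v \<and> clamp_path i j (Suc k) = w then 1 else 0))"
      unfolding u_def by (subst sum.swap, rule sum.cong[OF refl], rule sum.swap)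
    also have "\<dots> = (\<Sum>i\<in>?G. \<Sum>j\<in>?G. c i j * (\<Sum>k<n. if clamp_path i j (Suc k) = w then 1 else 0))"
    proof (intro sum.cong refl)
      fix i j assume ij: "i \<in> ?G" "j \<in> ?G"
      have "(\<Sum>v\<in>?G. if clamp_path i j k = v \<and> clamp_path i j (Suc k) = w then 1 else 0) =
            (if clamp_path i j (Suc k) = w then 1 else (0::real))" for k
        using clamp_path_in[OF ij, of k] by (cases "clamp_path i j (Suc k) = w") (simp_all add: sum.delta')
      then show "(\<Sum>v\<in>?G. c i j * (\<Sum>k<n. if clamp_path i j k = v \<and> clamp_path i j (Suc k) = w then 1 else 0))
        = c i j * (\<Sum>k<n. if clamp_path i j (Suc k) = w then 1 else 0)"
        by (subst sum_distrib_left[symmetric], subst sum.swap) simp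
    qed
    finally show ?thesis .
  qed
  show thesis
  proof
    show "0 \<le> u v w" "0 \<le> X v" for v w unfolding u_def X_def by (auto intro!: sum_nonneg mult_nonneg_nonneg c)
    show "X v \<le> n * s" for v
    proof -
      have "X v \<le> (\<Sum>i\<in>?G. \<Sum>j\<in>?G. c i j * n)" unfolding X_def
      proof (intro sum_mono mult_left_mono c)
        fix i j
        have "(\<Sum>k=1..<n. if clamp_path i j k = v then 1 else (0::real)) \<le> (\<Sum>k=1..<n. 1)"
          by (intro sum_mono) auto
        then show "(\<Sum>k=1..<n. if clamp_path i j k = v then 1 else (0::real)) \<le> n" by simp
      qed
      also have "\<dots> = n * s" unfolding cc[symmetric] by (simp only: sum_distrib_left mult.commute)
      finally show ?thesis .
    qed
    show "(\<Sum>w\<in>?G. u v w) = a v + X v" if v: "v \<in> ?G" for v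
    proof -
      have "(\<Sum>w\<in>?G. u v w) = (\<Sum>i\<in>?G. \<Sum>j\<in>?G. c i j * (if i = v then 1 else 0)) + X v"
        unfolding out X_def sum_split by (simp add: distrib_left sum.distrib)
      also have "(\<Sum>i\<in>?G. \<Sum>j\<in>?G. c i j * (if i = v then 1 else 0)) = (\<Sum>i\<in>?G. if i = v then a v else 0)"
        by (intro sum.cong) (auto simp: ca)
      finally show ?thesis using v by simp
    qed
    show "(\<Sum>v\<in>?G. u v w) = b w + X w" if w: "w \<in> ?G" for w
    proof -
      have "(\<Sum>v\<in>?G. u v w) = (\<Sum>i\<in>?G. \<Sum>j\<in>?G. c i j * (if clamp_path i j n = w then 1 else 0)) + X w"
        unfolding inc X_def sum_split'[of "\<lambda>k. if clamp_path _ _ k = w then 1 else 0"]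
        by (simp add: distrib_left sum.distrib)
      also have "(\<Sum>i\<in>?G. \<Sum>j\<in>?G. c i j * (if clamp_path i j n = w then 1 else 0))
          = (\<Sum>i\<in>?G. \<Sum>j\<in>?G. if j = w then c i w else 0)"
        by (intro sum.cong) (auto simp: clamp_path_end)
      also have "\<dots> = (\<Sum>i\<in>?G. c i w)" using w by simp
      finally show ?thesis using cb[OF w] by simp
    qed
    have "(\<Sum>v\<in>?G. \<Sum>w\<in>?G. u v w)
       = (\<Sum>i\<in>?G. \<Sum>j\<in>?G. \<Sum>v\<in>?G. c i j * (\<Sum>k<n. if clamp_path i j k = v then 1 else 0))"
      unfolding out by (subst sum.swap, rule sum.cong[OF refl], rule sum.swap)
    also have "\<dots> = (\<Sum>i\<in>?G. \<Sum>j\<in>?G. c i j * n)"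
    proof (intro sum.cong refl)
      fix i j assume ij: "i \<in> ?G" "j \<in> ?G"
      have "(\<Sum>v\<in>?G. if clamp_path i j k = v then 1 else 0) = (1::real)" for k
        using clamp_path_in[OF ij, of k] by (simp add: sum.delta')
      then show "(\<Sum>v\<in>?G. c i j * (\<Sum>k<n. if clamp_path i j k = v then 1 else 0)) = c i j * n"
        by (subst sum_distrib_left[symmetric], subst sum.swap) simp
    qed
    also have "\<dots> = n * s" unfolding cc[symmetric] by (simp only: sum_distrib_left mult.commute)
    finally show "(\<Sum>v\<in>?G. \<Sum>w\<in>?G. u v w) = n * s" .
    show "\<bar>fst w - fst v\<bar> \<le> 1 \<and> \<bar>snd w - snd v\<bar> \<le> 1" if "0 < u v w" for v w
    proof (rule ccontr)
      assume "\<not> ?thesis"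
      then have "(clamp_path i j k = v \<and> clamp_path i j (Suc k) = w) = False" for i j k
        using clamp_path_step[of i j k] by auto
      then have "u v w = 0" unfolding u_def by (simp only: if_False) simp
      with that show False by simp
    qed
  qed
qed

section \<open>Partition of the square into n^2 equal cells\<close>

definition grid_index :: "nat \<Rightarrow> plane \<Rightarrow> int \<times> int" where
  "grid_index n x = (\<lfloor>n * x $ 1\<rfloor>, \<lfloor>n * x $ 2\<rfloor>)"

lemma grid_index_in:
  assumes "n > 0" "x \<in> cell"
  shows "grid_index n x \<in> grid n"
proof -
  have "0 \<le> n * x $ i \<and> n * x $ i < real n" for i
    using assms by (auto simp: cell_def)
  then show ?thesis by (simp add: grid_index_def grid_def floor_less_iff)
qed

lemma grid_index_measurable: "grid_index n \<in> measurable torus (count_space UNIV)"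
proof -
  have [measurable]: "(\<lambda>x::plane. x $ i) \<in> borel_measurable torus" for i
    by (intro continuous_imp_borel_torus continuous_intros)
  have "(\<lambda>x. (\<lfloor>n * x $ 1\<rfloor>, \<lfloor>n * x $ 2\<rfloor>)) \<in> measurable torus (count_space UNIV \<Otimes>\<^sub>M count_space UNIV)"
    by measurable
  then show ?thesis
    by (simp add: grid_index_def[abs_def] pair_measure_countable)
qed

text \<open>A lower bound on the area suffices, so an open box inside the cell does the work and the
  half-open sides need no care.\<close>

lemma cell_of_grid_measure:
  assumes n: "n > 0" and v: "v \<in> grid n"
  shows "1 / (real n)\<^sup>2 \<le> measure torus {x \<in> cell. grid_index n x = v}"
proof -
  let ?a = "(\<chi> i. if i = 1 then fst v / n else snd v / n) :: plane"
  let ?b = "(\<chi> i. if i = 1 then (fst v + 1) / n else (snd v + 1) / n) :: plane"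
  have comp: "?a $ 1 = fst v / n" "?a $ 2 = snd v / n" "?b $ 1 = (fst v + 1) / n" "?b $ 2 = (snd v + 1) / n"
    by simp_all
  have v': "0 \<le> fst v" "0 \<le> snd v" "fst v + 1 \<le> n" "snd v + 1 \<le> n" using v by (auto simp: grid_def)
  have sub: "box ?a ?b \<subseteq> {x \<in> cell. grid_index n x = v}"
  proof
    fix x assume "x \<in> box ?a ?b"
    then have x: "fst v / n < x $ 1" "x $ 1 < (fst v + 1) / n" "snd v / n < x $ 2" "x $ 2 < (snd v + 1) / n"
      using comp unfolding mem_box_cart by metis+
    then have x': "fst v < n * x $ 1" "n * x $ 1 < fst v + 1" "snd v < n * x $ 2" "n * x $ 2 < snd v + 1"
      using n by (simp_all add: field_simps)
    have "0 \<le> fst v / n" "0 \<le> snd v / n" "(fst v + 1) / n \<le> 1" "(snd v + 1) / n \<le> 1"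
      using v' n by (simp_all add: field_simps)
    then have "x \<in> cell" using x unfolding cell_def forall_2 by auto
    moreover have "grid_index n x = v"
      using x' by (simp add: grid_index_def prod_eq_iff floor_eq_iff)
    ultimately show "x \<in> {x \<in> cell. grid_index n x = v}" by simp
  qed
  have "emeasure lborel (box ?a ?b) = ennreal (\<Prod>i\<in>UNIV. ?b $ i - ?a $ i)"
    using n by (intro emeasure_lborel_box_cart) (auto simp: field_simps)
  also have "(\<Prod>i\<in>UNIV. ?b $ i - ?a $ i) = 1 / (real n)\<^sup>2"
    using n by (simp add: UNIV_2 diff_divide_distrib[symmetric] power2_eq_square)
  finally have "ennreal (1 / (real n)\<^sup>2) = emeasure torus (box ?a ?b)"
    using sub by (subst emeasure_torus) auto
  also have "\<dots> \<le> emeasure torus {x \<in> cell. grid_index n x = v}"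
  proof (intro emeasure_mono sub)
    show "{x \<in> cell. grid_index n x = v} \<in> sets torus"
      using measurable_sets[OF grid_index_measurable, of "{v}" n] by (simp add: vimage_def Int_def conj_commute)
  qed
  finally show ?thesis
    by (simp add: torus.emeasure_eq_measure)
qed


lemma integrable_if_cell:
  assumes "integrable torus f"
  shows "integrable torus (\<lambda>x. if grid_index n x = v then f x else (0::real))"
proof -
  note [measurable] = grid_index_measurable
  have [measurable]: "f \<in> borel_measurable torus" using assms by auto
  show ?thesis by (rule Bochner_Integration.integrable_bound[OF assms]) auto
qed

lemma sum_grid_integral:
  fixes f :: "plane \<Rightarrow> real"
  assumes "integrable torus f" "n > 0"
  shows "(\<Sum>v\<in>grid n. LINT x|torus. (if grid_index n x = v then f x else 0)) = (LINT x|torus. f x)"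
proof -
  have "(\<Sum>v\<in>grid n. LINT x|torus. (if grid_index n x = v then f x else 0))
     = (LINT x|torus. (\<Sum>v\<in>grid n. (if grid_index n x = v then f x else 0)))"
    by (intro Bochner_Integration.integral_sum[symmetric] integrable_if_cell assms)
  also have "\<dots> = (LINT x|torus. f x)"
    using grid_index_in[OF assms(2)] by (intro Bochner_Integration.integral_cong refl) (simp add: sum.delta')
  finally show ?thesis .
qed

text \<open>If two floors differ by at most 1, the coordinates differ by at most 2/n; two
  coordinates give twice the square of 2/n.\<close>

lemma near_cells:
  assumes n: "n > 0" and x: "x \<in> cell" and y: "y \<in> cell"
    and *: "\<bar>fst (grid_index n y) - fst (grid_index n x)\<bar> \<le> 1 \<and> \<bar>snd (grid_index n y) - snd (grid_index n x)\<bar> \<le> 1"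
  shows "(norm (x - y))\<^sup>2 \<le> 8 / (real n)\<^sup>2"
proof -
  have "\<bar>x $ i - y $ i\<bar> \<le> 2 / n" if "\<bar>\<lfloor>n * y $ i\<rfloor> - \<lfloor>n * x $ i\<rfloor>\<bar> \<le> 1" for i
  proof -
    have "\<bar>real n * x $ i - real n * y $ i\<bar> \<le> 2" using that by linarith
    then have "real n * \<bar>x $ i - y $ i\<bar> \<le> 2" by (simp add: abs_mult flip: right_diff_distrib)
    then show ?thesis using n by (simp add: field_simps)
  qed
  then have "\<bar>x $ 1 - y $ 1\<bar> \<le> 2 / n" "\<bar>x $ 2 - y $ 2\<bar> \<le> 2 / n"
    using * by (simp_all add: grid_index_def)
  then have "(x $ 1 - y $ 1)\<^sup>2 \<le> (2 / n)\<^sup>2" "(x $ 2 - y $ 2)\<^sup>2 \<le> (2 / n)\<^sup>2"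
    by (metis abs_ge_zero power2_abs power_mono)+
  then show ?thesis
    by (simp add: norm_vec_def L2_set_def UNIV_2 power_divide)
qed

text \<open>The surplus of \<open>f\<close> over \<open>g\<close> walks to the deficit in
  \<open>n\<close> short steps. At each intermediate stop common mass moves on in place of the
  arriving mass, so every cell must contain enough of it: \<open>small\<close> guarantees
  \<open>n * s\<close> per cell, even after at most \<open>s\<close> is given up to the deficit. At
  most \<open>n * s\<close> is moved, at cost 8/n^2 per unit.\<close>

lemma small_transport:
  fixes f g :: "plane \<Rightarrow> real" and n :: nat and s c :: real
  assumes n: "n > 0" and f: "integrable torus f" "\<And>x. 0 \<le> f x" and g: "integrable torus g"
    and c: "0 \<le> c" "\<And>x. c \<le> g x" and eq: "(LINT x|torus. f x) = (LINT x|torus. g x)"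
    and s: "s = (LINT x|torus. \<bar>f x - g x\<bar>)" and small: "(n + 1) * s \<le> c / n\<^sup>2"
  obtains \<gamma> where "sets \<gamma> = sets (torus \<Otimes>\<^sub>M torus)"
    "distr \<gamma> torus fst = density torus (\<lambda>x. ennreal (f x))"
    "distr \<gamma> torus snd = density torus (\<lambda>x. ennreal (g x))"
    "(\<integral>\<^sup>+z. ennreal ((norm (fst z - snd z))\<^sup>2) \<partial>\<gamma>) \<le> ennreal (8 * s / n)"
proof -
  let ?q = "grid_index n" and ?G = "grid n"
  note [measurable] = grid_index_measurable
  have [measurable]: "f \<in> borel_measurable torus" "g \<in> borel_measurable torus" using f g by auto
  define r p t where "r x = min (f x) (g x)" and "p x = max 0 (f x - g x)" and "t x = max 0 (g x - f x)" for x
  have int: "integrable torus r" "integrable torus p" "integrable torus t" "integrable torus (\<lambda>x. \<bar>f x - g x\<bar>)"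
    unfolding r_def p_def t_def using f g by auto
  have nonneg: "0 \<le> r x" "0 \<le> p x" "0 \<le> t x" for x
    using f(2)[of x] c(2)[of x] c(1) by (auto simp: r_def p_def t_def)
  define a where "a v = (LINT x|torus. (if ?q x = v then p x else 0))" for v
  define b where "b v = (LINT x|torus. (if ?q x = v then t x else 0))" for v
  define m where "m v = (LINT x|torus. (if ?q x = v then r x else 0))" for v
  have ab0: "0 \<le> a v" "0 \<le> b v" "0 \<le> m v" for v
    unfolding a_def b_def m_def using nonneg by (auto intro!: integral_nonneg_AE)
  have pt: "(LINT x|torus. p x) - (LINT x|torus. t x) = 0"
  proof -
    have "(LINT x|torus. p x) - (LINT x|torus. t x) = (LINT x|torus. f x - g x)"
      using int by (subst Bochner_Integration.integral_diff[symmetric]) (auto simp: p_def t_def intro!: Bochner_Integration.integral_cong)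
    then show ?thesis using f g eq by simp
  qed
  have tots: "(LINT x|torus. p x) \<le> s" "(LINT x|torus. t x) \<le> s"
    unfolding s by (intro integral_mono int; auto simp: p_def t_def)+
  define \<sigma> where "\<sigma> = (LINT x|torus. p x)"
  have sums: "sum a ?G = \<sigma>" "sum b ?G = \<sigma>"
    unfolding a_def b_def using pt by (simp_all add: sum_grid_integral int n \<sigma>_def)
  have \<sigma>: "\<sigma> \<le> s" using tots by (simp add: \<sigma>_def)
  have m_ge: "n * \<sigma> \<le> m v" if v: "v \<in> ?G" for v
  proof -
    have "c / n\<^sup>2 \<le> c * measure torus {x \<in> cell. ?q x = v}"
      using mult_left_mono[OF cell_of_grid_measure[OF n v] c(1)] by simp
    also have "\<dots> = (LINT x|torus. (if ?q x = v then c else 0))"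
    proof -
      have A: "{x \<in> cell. ?q x = v} \<in> sets torus"
        using measurable_sets[OF grid_index_measurable, of "{v}" n] by (simp add: vimage_def Int_def conj_commute)
      have "(LINT x|torus. (if ?q x = v then c else 0)) = (LINT x|torus. c * indicator {x \<in> cell. ?q x = v} x)"
        by (intro Bochner_Integration.integral_cong) auto
      moreover have "{x \<in> cell. ?q x = v} \<inter> cell = {x \<in> cell. ?q x = v}" by auto
      ultimately show ?thesis using A by simp
    qed
    \<comment> \<open>Common part and deficit add up to \<open>g\<close>, which is at least
      \<open>c\<close>. The deficit may be integrated over the whole square, since its total is at
      most \<open>s\<close>.\<close>
    also have "\<dots> \<le> (LINT x|torus. (if ?q x = v then r x else 0) + t x)"
      by (intro integral_mono Bochner_Integration.integrable_add integrable_if_cell int torus.integrable_const)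
        (use c nonneg in \<open>auto simp: r_def t_def max_def min_def\<close>)
    also have "\<dots> = m v + (LINT x|torus. t x)"
      unfolding m_def by (intro Bochner_Integration.integral_add integrable_if_cell int)
    also have "\<dots> \<le> m v + s" using tots by simp
    finally have "n * s \<le> m v" using small by (simp add: algebra_simps)
    moreover have "n * \<sigma> \<le> n * s" using \<sigma> by (intro mult_left_mono) auto
    ultimately show ?thesis by simp
  qed
  obtain u X where u: "\<And>v w. 0 \<le> u v w" and X: "\<And>v. 0 \<le> X v" "\<And>v. X v \<le> n * \<sigma>"
    and out: "\<And>v. v \<in> ?G \<Longrightarrow> (\<Sum>w\<in>?G. u v w) = a v + X v"
    and inc: "\<And>w. w \<in> ?G \<Longrightarrow> (\<Sum>v\<in>?G. u v w) = b w + X w"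
    and tot: "(\<Sum>v\<in>?G. \<Sum>w\<in>?G. u v w) = n * \<sigma>"
    and near: "\<And>v w. 0 < u v w \<Longrightarrow> \<bar>fst w - fst v\<bar> \<le> 1 \<and> \<bar>snd w - snd v\<bar> \<le> 1"
    using grid_flow_exists[OF n ab0(1,2) sums] by blast
  \<comment> \<open>the fraction of the common mass \<open>r\<close> that is set in motion in each cell\<close>
  define \<theta> where "\<theta> v = (if v \<in> ?G then X v / m v else 0)" for v
  have Xm: "X v \<le> m v" if "v \<in> ?G" for v
    using X(2)[of v] m_ge[OF that] by linarith
  have \<theta>: "0 \<le> \<theta> v" "\<theta> v \<le> 1" for v
  proof -
    show "0 \<le> \<theta> v" using X(1)[of v] ab0(3)[of v] by (simp add: \<theta>_def)
    show "\<theta> v \<le> 1" using Xm[of v] ab0(3)[of v]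
      by (cases "m v = 0") (simp_all add: \<theta>_def)
  qed
  have \<theta>m: "\<theta> v * m v = X v" if "v \<in> ?G" for v
    using Xm[OF that] X(1)[of v] that by (cases "m v = 0") (simp_all add: \<theta>_def)
  have r\<theta>: "integrable torus (\<lambda>x. \<theta> (?q x) * r x)"
  proof (rule Bochner_Integration.integrable_bound[OF int(1)])
    have "(\<lambda>x. \<theta> (?q x)) \<in> borel_measurable torus"
      by (rule measurable_compose[OF grid_index_measurable]) simp
    moreover have "r \<in> borel_measurable torus" using int by auto
    ultimately show "(\<lambda>x. \<theta> (?q x) * r x) \<in> borel_measurable torus" by (rule borel_measurable_times)
    have "norm (\<theta> (?q x) * r x) \<le> norm (r x)" for x
      using mult_left_le_one_le[OF nonneg(1)[of x] \<theta>[of "?q x"]] \<theta>(1)[of "?q x"] nonneg(1)[of x]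
      by (simp only: real_norm_def abs_mult abs_of_nonneg)
    then show "AE x in torus. norm (\<theta> (?q x) * r x) \<le> norm (r x)" by simp
  qed
  have cellX: "(LINT x|torus. (if ?q x = v then h x + \<theta> (?q x) * r x else 0))
      = (LINT x|torus. (if ?q x = v then h x else 0)) + X v"
    if v: "v \<in> ?G" and h: "integrable torus h" for v h
  proof -
    have "(LINT x|torus. (if ?q x = v then h x + \<theta> (?q x) * r x else 0))
        = (LINT x|torus. (if ?q x = v then h x else 0) + \<theta> v * (if ?q x = v then r x else 0))"
      by (intro Bochner_Integration.integral_cong) auto
    also have "\<dots> = (LINT x|torus. (if ?q x = v then h x else 0)) + \<theta> v * m v"
      unfolding m_def
      by (subst Bochner_Integration.integral_add)
        (auto intro!: integrable_if_cell h int Bochner_Integration.integrable_mult_right)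
    finally show ?thesis using \<theta>m[OF v] by simp
  qed
  \<comment> \<open>In each cell the relay mass leaves and arrives with the same profile, the
    fraction \<open>\<theta>\<close> of \<open>r\<close>. It therefore drops out of both marginals,
    which are \<open>r + p\<close>, that is \<open>f\<close>, and \<open>r + t\<close>, that is
    \<open>g\<close>.\<close>
  interpret F: mass_flow torus ?q ?G u "\<lambda>x. (1 - \<theta> (?q x)) * r x" "\<lambda>x. p x + \<theta> (?q x) * r x"
    "\<lambda>x. t x + \<theta> (?q x) * r x"
  proof unfold_locales
    show "integrable torus (\<lambda>x. (1 - \<theta> (?q x)) * r x)"
      using Bochner_Integration.integrable_diff[OF int(1) r\<theta>] by (simp add: left_diff_distrib)
    show "integrable torus (\<lambda>x. p x + \<theta> (?q x) * r x)" "integrable torus (\<lambda>x. t x + \<theta> (?q x) * r x)"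
      using int r\<theta> by auto
  qed (use n u \<theta> nonneg out inc in \<open>simp_all add: grid_index_in cellX int a_def b_def grid_index_measurable\<close>)
  show thesis
  proof
    show "sets F.plan = sets (torus \<Otimes>\<^sub>M torus)" by simp
    show "distr F.plan torus fst = density torus (\<lambda>x. ennreal (f x))"
      unfolding F.distr_plan_fst by (rule arg_cong[where f="density torus"]) (auto simp: r_def p_def fun_eq_iff left_diff_distrib min_def max_def)
    show "distr F.plan torus snd = density torus (\<lambda>x. ennreal (g x))"
      unfolding F.distr_plan_snd by (rule arg_cong[where f="density torus"]) (auto simp: r_def t_def fun_eq_iff left_diff_distrib min_def max_def)
    have [measurable]: "(\<lambda>x. x) \<in> borel_measurable torus" by (intro continuous_imp_borel_torus continuous_intros)
    have "(\<integral>\<^sup>+z. ennreal ((norm (fst z - snd z))\<^sup>2) \<partial>F.plan) \<le> ennreal (8 / n\<^sup>2 * (\<Sum>v\<in>?G. \<Sum>w\<in>?G. u v w))"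
    proof (rule F.plan_cost_le)
      have [measurable]: "fst \<in> borel_measurable (torus \<Otimes>\<^sub>M torus)" "snd \<in> borel_measurable (torus \<Otimes>\<^sub>M torus)"
        by (rule measurable_compose[OF measurable_fst], simp) (rule measurable_compose[OF measurable_snd], simp)
      show "(\<lambda>z. ennreal ((norm (fst z - snd z))\<^sup>2)) \<in> borel_measurable (torus \<Otimes>\<^sub>M torus)" by measurable
    next
      fix x y assume "x \<in> space torus" "y \<in> space torus" "u (?q x) (?q y) > 0"
      then show "ennreal ((norm (fst (x, y) - snd (x, y)))\<^sup>2) \<le> ennreal (8 / n\<^sup>2)"
        using near_cells[OF n, of x y] near by (auto intro!: ennreal_leI)
    qed auto
    also have "8 / n\<^sup>2 * (\<Sum>v\<in>?G. \<Sum>w\<in>?G. u v w) = 8 * \<sigma> / n"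
      using n by (simp add: tot power2_eq_square)
    also have "ennreal (8 * \<sigma> / n) \<le> ennreal (8 * s / n)"
      using \<sigma> by (intro ennreal_leI divide_right_mono) auto
    finally show "(\<integral>\<^sup>+z. ennreal ((norm (fst z - snd z))\<^sup>2) \<partial>F.plan) \<le> ennreal (8 * s / n)" .
  qed
qed

section \<open>Potentials\<close>

lemma Ck_Suc_differentiable: "Ck (Suc n) f \<Longrightarrow> f differentiable (at x)"
  by (simp add: differentiable_on_def)

lemma Ck_continuous: "Ck n f \<Longrightarrow> continuous_on UNIV f"
  by (cases n) (auto intro: differentiable_imp_continuous_on)

lemma frechet_derivative_grad:
  assumes "f differentiable (at x)"
  shows "frechet_derivative f (at x) v = grad f x \<bullet> v"
proof -
  interpret linear "frechet_derivative f (at x)" by (rule linear_frechet_derivative[OF assms])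
  have v: "(\<Sum>i\<in>UNIV. v $ i *\<^sub>R axis i 1) = v"
    using basis_expansion[of v] by (simp add: scalar_mult_eq_scaleR)
  have "frechet_derivative f (at x) (\<Sum>i\<in>UNIV. v $ i *\<^sub>R axis i 1)
     = (\<Sum>i\<in>UNIV. v $ i * frechet_derivative f (at x) (axis i 1))"
    by (simp only: sum scale real_scaleR_def)
  then show ?thesis by (simp add: v inner_vec_def grad_def mult.commute)
qed

lemma has_derivative_grad:
  assumes "f differentiable (at x)"
  shows "(f has_derivative (\<lambda>v. grad f x \<bullet> v)) (at x)"
proof -
  have "frechet_derivative f (at x) = (\<lambda>v. grad f x \<bullet> v)"
    by (intro ext frechet_derivative_grad assms)
  then show ?thesis using frechet_derivative_works[THEN iffD1, OF assms] by simp
qed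

lemma grad_eqI: "(f has_derivative (\<lambda>v. a \<bullet> v)) (at x) \<Longrightarrow> grad f x = a"
  by (simp add: grad_def frechet_derivative_at[symmetric] inner_axis vec_eq_iff)

lemma Ck_continuous_grad:
  assumes "Ck (Suc n) f"
  shows "continuous_on UNIV (grad f)"
  unfolding grad_def using assms by (intro continuous_on_vec_lambda) (auto intro: Ck_continuous)

section \<open>Taylor bounds on the unit square\<close>

lemma C1_lipschitz_unit_square:
  fixes f :: "plane \<Rightarrow> real"
  assumes "Ck 1 f"
  obtains L where "0 \<le> L" "\<And>x y. x \<in> cbox 0 1 \<Longrightarrow> y \<in> cbox 0 1 \<Longrightarrow> \<bar>f x - f y\<bar> \<le> L * norm (x - y)"
proof -
  have f: "f differentiable (at x)" for x using assms Ck_Suc_differentiable[of 0 f] by simp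
  have "continuous_on UNIV (\<lambda>x. norm (grad f x))"
    using assms Ck_continuous_grad[of 0 f] by (intro continuous_intros) simp
  then obtain L where L: "0 \<le> L" "\<And>x. x \<in> cbox 0 1 \<Longrightarrow> \<bar>norm (grad f x)\<bar> \<le> L"
    using continuous_bounded_cell by blast
  show thesis
  proof (rule that[OF L(1)])
    fix x y :: plane assume xy: "x \<in> cbox 0 1" "y \<in> cbox 0 1"
    have "norm (f x - f y) \<le> L * norm (x - y)"
    proof (rule differentiable_bound[OF convex_box(1)[of 0 1] _ _ xy])
      show "(f has_derivative (\<lambda>v. grad f z \<bullet> v)) (at z within cbox 0 1)" for z
        by (rule has_derivative_at_withinI[OF has_derivative_grad[OF f]])
      fix z :: plane assume "z \<in> cbox 0 1"
      show "onorm ((\<bullet>) (grad f z)) \<le> L"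
      proof (rule onorm_le)
        fix v
        have "norm (grad f z \<bullet> v) \<le> norm (grad f z) * norm v" by (simp add: Cauchy_Schwarz_ineq2)
        also have "\<dots> \<le> L * norm v" using L(2)[OF \<open>z \<in> cbox 0 1\<close>] by (intro mult_right_mono) auto
        finally show "norm (grad f z \<bullet> v) \<le> L * norm v" .
      qed
    qed
    then show "\<bar>f x - f y\<bar> \<le> L * norm (x - y)" by simp
  qed
qed

text \<open>Each partial derivative is C^1, hence Lipschitz on the compact convex square, and the
  linearization error along a segment is then quadratic. Only the upper half is recorded: it serves
  to bound the cost of a trial plan from above.\<close>

lemma C2_quadratic_bound:
  assumes "Ck 2 f"
  obtains L where "0 \<le> L"
    "\<And>x z. x \<in> cbox 0 1 \<Longrightarrow> z \<in> cbox 0 1 \<Longrightarrow> f x \<le> f z + grad f z \<bullet> (x - z) + L * (norm (x - z))\<^sup>2"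
proof -
  have f: "f differentiable (at x)" for x using assms Ck_Suc_differentiable[of 1 f] by (simp add: numeral_2_eq_2)
  have "Ck 1 (\<lambda>x. grad f x $ i)" for i
    using assms by (simp add: grad_def numeral_2_eq_2)
  then have "\<exists>L. 0 \<le> L \<and> (\<forall>x\<in>cbox 0 1. \<forall>y\<in>cbox 0 1. \<bar>grad f x $ i - grad f y $ i\<bar> \<le> L * norm (x - y))" for i
    using C1_lipschitz_unit_square[of "\<lambda>x. grad f x $ i"] by metis
  then obtain L where L: "\<And>i. 0 \<le> L i"
    "\<And>i x y. x \<in> cbox 0 1 \<Longrightarrow> y \<in> cbox 0 1 \<Longrightarrow> \<bar>grad f x $ i - grad f y $ i\<bar> \<le> L i * norm (x - y)"
    by metis
  define K where "K = (\<Sum>i\<in>UNIV. L i)"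
  have K0: "0 \<le> K" unfolding K_def by (intro sum_nonneg L)
  have K: "norm (grad f x - grad f y) \<le> K * norm (x - y)" if "x \<in> cbox 0 1" "y \<in> cbox 0 1" for x y
  proof -
    have "norm (grad f x - grad f y) \<le> (\<Sum>i\<in>UNIV. \<bar>(grad f x - grad f y) $ i\<bar>)"
      by (rule norm_le_l1_cart)
    also have "\<dots> \<le> (\<Sum>i\<in>UNIV. L i * norm (x - y))"
      using L(2)[OF that] by (intro sum_mono) simp
    finally show ?thesis by (simp add: K_def sum_distrib_right)
  qed
  show thesis
  proof (rule that[OF K0])
    fix x z :: plane assume xz: "x \<in> cbox 0 1" "z \<in> cbox 0 1"
    have seg: "closed_segment z x \<subseteq> cbox 0 1"
      using xz by (intro closed_segment_subset convex_box) auto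
    have "norm (f x - f z - (\<lambda>v. grad f z \<bullet> v) (x - z)) \<le> norm (x - z) * (K * norm (x - z))"
    proof (rule differentiable_bound_linearization[where S="closed_segment z x" and f'="\<lambda>y v. grad f y \<bullet> v"])
      show "z + t *\<^sub>R (x - z) \<in> closed_segment z x" if "t \<in> {0..1}" for t
        using that by (auto simp: closed_segment_def algebra_simps intro!: exI[of _ t])
      show "(f has_derivative (\<bullet>) (grad f y)) (at y within closed_segment z x)" for y
        by (rule has_derivative_at_withinI[OF has_derivative_grad[OF f]])
      fix y assume y: "y \<in> closed_segment z x"
      show "onorm ((\<bullet>) (grad f y) - (\<bullet>) (grad f z)) \<le> K * norm (x - z)"
      proof (rule onorm_le)
        fix v
        have "norm (((\<bullet>) (grad f y) - (\<bullet>) (grad f z)) v) = norm ((grad f y - grad f z) \<bullet> v)"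
          by (simp add: inner_diff_left)
        also have "\<dots> \<le> norm (grad f y - grad f z) * norm v" by (simp add: Cauchy_Schwarz_ineq2)
        also have "\<dots> \<le> (K * norm (y - z)) * norm v"
          using y seg xz by (intro mult_right_mono K) auto
        also have "\<dots> \<le> (K * norm (x - z)) * norm v"
          using segment_bound(1)[OF y] K0 by (intro mult_right_mono mult_left_mono) (auto simp: norm_minus_commute)
        finally show "norm (((\<bullet>) (grad f y) - (\<bullet>) (grad f z)) v) \<le> K * norm (x - z) * norm v" .
      qed
    qed auto
    then have "f x - f z - grad f z \<bullet> (x - z) \<le> K * (norm (x - z))\<^sup>2"
      by (simp add: abs_le_iff power2_eq_square mult_ac)
    then show "f x \<le> f z + grad f z \<bullet> (x - z) + K * (norm (x - z))\<^sup>2" by simp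
  qed
qed

text \<open>Restricted to the line through \<open>z\<close> and \<open>x\<close>, this is the
  tangent inequality in one variable; the chain rule identifies the slope.\<close>

lemma convex_on_above_tangent_plane:
  fixes f :: "'a::real_normed_vector \<Rightarrow> real"
  assumes cvx: "convex_on UNIV f" and f: "(f has_derivative f') (at z)"
  shows "f z + f' (x - z) \<le> f x"
proof -
  define \<phi> where "\<phi> t = f (z + t *\<^sub>R (x - z))" for t
  have "convex_on UNIV \<phi>"
  proof (rule convex_onI)
    fix t a b :: real assume t: "0 < t" "t < 1"
    have "z + ((1 - t) *\<^sub>R a + t *\<^sub>R b) *\<^sub>R (x - z) = (1 - t) *\<^sub>R (z + a *\<^sub>R (x - z)) + t *\<^sub>R (z + b *\<^sub>R (x - z))"
      by (simp add: algebra_simps)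
    then show "\<phi> ((1 - t) *\<^sub>R a + t *\<^sub>R b) \<le> (1 - t) * \<phi> a + t * \<phi> b"
      unfolding \<phi>_def using convex_onD[OF cvx, of t] t by simp
  qed auto
  moreover have "(\<phi> has_real_derivative f' (x - z)) (at 0)"
  proof -
    have lin: "linear f'" using f by (rule has_derivative_linear)
    have "((\<lambda>t. z + t *\<^sub>R (x - z)) has_derivative (\<lambda>t. t *\<^sub>R (x - z))) (at 0)"
      by (auto intro!: derivative_eq_intros)
    moreover have "(f has_derivative f') (at (z + 0 *\<^sub>R (x - z)))" using f by simp
    ultimately have "(\<phi> has_derivative (\<lambda>t. f' (t *\<^sub>R (x - z)))) (at 0)"
      unfolding \<phi>_def by (rule has_derivative_compose)
    moreover have "(\<lambda>t. f' (t *\<^sub>R (x - z))) = (*) (f' (x - z))"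
      by (simp add: linear_scale[OF lin] mult.commute fun_eq_iff)
    ultimately show ?thesis by (simp add: has_field_derivative_def)
  qed
  ultimately have "f' (x - z) * (1 - 0) \<le> \<phi> 1 - \<phi> 0"
    by (intro convex_on_imp_above_tangent[of UNIV]) auto
  then show ?thesis by (simp add: \<phi>_def)
qed

lemma has_derivative_brenier:
  assumes "\<psi> differentiable (at x)"
  shows "(brenier \<epsilon> \<psi> has_derivative (\<lambda>v. (x + \<epsilon> *\<^sub>R grad \<psi> x) \<bullet> v)) (at x)"
proof -
  have "((\<lambda>x. (x \<bullet> x) / 2 + \<epsilon> * \<psi> x) has_derivative (\<lambda>v. (x \<bullet> v + v \<bullet> x) / 2 + \<epsilon> * (grad \<psi> x \<bullet> v))) (at x)"
    by (auto intro!: derivative_eq_intros has_derivative_grad assms)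
  then show ?thesis
    by (simp add: brenier_def[abs_def] power2_norm_eq_inner inner_add_right inner_commute)
qed

lemma grad_brenier:
  "\<psi> differentiable (at x) \<Longrightarrow> grad (brenier \<epsilon> \<psi>) x = x + \<epsilon> *\<^sub>R grad \<psi> x"
  by (rule grad_eqI[OF has_derivative_brenier])

text \<open>Expanding the squares in the tangent inequality of the convex potential shows that
  \<psi> is convex up to a fixed paraboloid. The uniform bound on \<psi> and the optimality of the
  map both come from this form.\<close>

lemma potential_above_tangent:
  assumes cvx: "convex_on UNIV (brenier \<epsilon> \<psi>)" and d: "\<psi> differentiable (at z)"
  shows "\<epsilon> * \<psi> z + \<epsilon> * (grad \<psi> z \<bullet> (x - z)) - (norm (x - z))\<^sup>2 / 2 \<le> \<epsilon> * \<psi> x"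
  using convex_on_above_tangent_plane[OF cvx has_derivative_brenier[OF d], of x]
  unfolding brenier_def power2_norm_eq_inner
  by (simp add: inner_diff_left inner_diff_right inner_add_left inner_add_right inner_commute field_simps)

text \<open>At a maximum point the gradient vanishes, so \<epsilon> \<psi> falls below its maximum
  by at most half a squared distance. Periodicity lets that distance be measured inside the unit
  square, where its square is at most 2. Hence \<epsilon> \<psi> oscillates by at most 1, and its
  zero mean places 0 within its range.\<close>

lemma potential_bound:
  assumes \<epsilon>: "\<epsilon> > 0" and cvx: "convex_on UNIV (brenier \<epsilon> \<psi>)" and d: "\<And>x. \<psi> differentiable (at x)"
    and per: "periodic \<psi>" and mz: "mean_zero \<psi>"
  shows "\<bar>\<psi> x\<bar> \<le> 1 / \<epsilon>"
proof -
  have cont: "continuous_on UNIV \<psi>"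
    using d by (simp add: differentiable_imp_continuous_on differentiable_on_def differentiable_at_withinI)
  have "cbox 0 (1::plane) \<noteq> {}" by (simp add: interval_ne_empty_cart)
  then obtain z where z: "z \<in> cbox 0 1" "\<And>x. x \<in> cbox 0 1 \<Longrightarrow> \<psi> x \<le> \<psi> z"
    using continuous_attains_sup[OF compact_unit_square _ continuous_on_subset[OF cont subset_UNIV]] by blast
  have max: "\<psi> x \<le> \<psi> z" for x
    using z(2)[of "reduce x"] periodic_reduce[OF per, of x] cell_subset_cbox reduce_in_cell[of x] by force
  have "(\<lambda>v. grad \<psi> z \<bullet> v) = (\<lambda>v. 0)"
    by (rule differential_zero_maxmin[OF UNIV_I open_UNIV has_derivative_grad[OF d]]) (use max in auto)
  then have g0: "grad \<psi> z \<bullet> v = 0" for v by metis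
  have osc: "\<epsilon> * \<psi> z - 1 \<le> \<epsilon> * \<psi> x" for x
  proof -
    have "(norm (reduce x - z))\<^sup>2 \<le> 2"
    proof -
      have "\<bar>(reduce x - z) $ i\<bar> \<le> 1" for i
        using reduce_in_cell[of x] z(1) by (auto simp: cell_def mem_box_cart abs_le_iff)
          (smt (verit))+
      then have "((reduce x - z) $ i)\<^sup>2 \<le> 1" for i by (simp add: abs_square_le_1)
      then have "((reduce x - z) $ 1)\<^sup>2 + ((reduce x - z) $ 2)\<^sup>2 \<le> 1 + 1" by (intro add_mono)
      then show ?thesis by (simp add: norm_vec_def L2_set_def UNIV_2)
    qed
    then show ?thesis
      using potential_above_tangent[OF cvx d, of z "reduce x"] periodic_reduce[OF per, of x] by (simp add: g0)
  qed
  have int: "integrable torus \<psi>" by (rule integrable_torus_continuous[OF cont])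
  have "0 \<le> \<psi> z"
  proof -
    have "(LINT x|torus. \<psi> x) \<le> (LINT x|torus. \<psi> z)" by (intro integral_mono int max) simp
    then show ?thesis using mz by (simp add: mean_zero_def torus.prob_space del: space_torus)
  qed
  moreover have "\<epsilon> * \<psi> z \<le> 1"
  proof -
    have "(LINT x|torus. \<epsilon> * \<psi> z - 1) \<le> (LINT x|torus. \<epsilon> * \<psi> x)"
      using int by (intro integral_mono osc) auto
    then show ?thesis using mz by (simp add: mean_zero_def torus.prob_space del: space_torus)
  qed
  moreover have "\<epsilon> * \<psi> x \<le> \<epsilon> * \<psi> z" using max[of x] \<epsilon> by simp
  moreover have "0 \<le> \<epsilon> * \<psi> z" using calculation(1) \<epsilon> by simp
  ultimately have "\<epsilon> * \<psi> x \<le> 1" "- 1 \<le> \<epsilon> * \<psi> x" using osc[of x] by linarith+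
  then show ?thesis using \<epsilon> by (simp add: abs_le_iff field_simps)
qed

section \<open>Trigonometric test functions\<close>

lemma Ck_SucD: "Ck (Suc n) f \<Longrightarrow> Ck n f"
proof (induction n arbitrary: f)
  case 0
  then show ?case using Ck_continuous[of "Suc 0" f] by simp
next
  case (Suc n)
  then show ?case by auto
qed

lemma Ck_const: "Ck n (\<lambda>x. c)"
  by (induction n arbitrary: c) auto

lemma Ck_SucI:
  assumes "\<And>x. (f has_derivative D x) (at x)" "\<And>v. Ck n (\<lambda>x. D x v)"
  shows "Ck (Suc n) f"
proof -
  have "f differentiable_on UNIV"
    using assms(1) by (auto simp: differentiable_on_def differentiable_def intro: has_derivative_at_withinI)
  moreover have "frechet_derivative f (at x) = D x" for x
    using frechet_derivative_at[OF assms(1)] by simp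
  ultimately show ?thesis using assms(2) by simp
qed

lemma Ck_Suc_has_derivative: "Ck (Suc n) f \<Longrightarrow> (f has_derivative frechet_derivative f (at x)) (at x)"
  using Ck_Suc_differentiable frechet_derivative_works by blast

lemma Ck_add: "Ck n f \<Longrightarrow> Ck n g \<Longrightarrow> Ck n (\<lambda>x. f x + g x)"
proof (induction n arbitrary: f g)
  case 0
  then show ?case by (auto intro: continuous_intros)
next
  case (Suc n)
  show ?case
  proof (rule Ck_SucI)
    show "((\<lambda>x. f x + g x) has_derivative
      (\<lambda>v. frechet_derivative f (at x) v + frechet_derivative g (at x) v)) (at x)" for x
      by (intro has_derivative_add Ck_Suc_has_derivative[OF Suc.prems(1)] Ck_Suc_has_derivative[OF Suc.prems(2)])
  qed (use Suc in auto)
qed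

lemma Ck_mult: "Ck n f \<Longrightarrow> Ck n g \<Longrightarrow> Ck n (\<lambda>x. f x * g x)"
proof (induction n arbitrary: f g)
  case 0
  then show ?case by (auto intro: continuous_intros)
next
  case (Suc n)
  show ?case
  proof (rule Ck_SucI)
    show "((\<lambda>x. f x * g x) has_derivative
      (\<lambda>v. f x * frechet_derivative g (at x) v + frechet_derivative f (at x) v * g x)) (at x)" for x
      by (intro has_derivative_mult Ck_Suc_has_derivative[OF Suc.prems(1)] Ck_Suc_has_derivative[OF Suc.prems(2)])
    show "Ck n (\<lambda>x. f x * frechet_derivative g (at x) v + frechet_derivative f (at x) v * g x)" for v
      using Suc.prems by (intro Ck_add Suc.IH Ck_SucD[of n f] Ck_SucD[of n g]) auto
  qed
qed

text \<open>Sine and cosine differentiate into each other, so the induction has to treat them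
  together.\<close>

lemma Ck_sin_cos_component:
  "Ck n (\<lambda>x::plane. sin (c * (x $ i - d))) \<and> Ck n (\<lambda>x::plane. cos (c * (x $ i - d)))"
proof (induction n)
  case 0
  show ?case by (auto intro!: continuous_intros)
next
  case (Suc n)
  have "Ck (Suc n) (\<lambda>x::plane. sin (c * (x $ i - d)))"
  proof (rule Ck_SucI)
    show "((\<lambda>x::plane. sin (c * (x $ i - d))) has_derivative (\<lambda>v. cos (c * (x $ i - d)) * (c * v $ i))) (at x)" for x
      by (auto intro!: derivative_eq_intros bounded_linear.has_derivative[OF bounded_linear_vec_nth])
    show "Ck n (\<lambda>x::plane. cos (c * (x $ i - d)) * (c * v $ i))" for v :: plane
      using Suc by (intro Ck_mult Ck_const) auto
  qed
  moreover have "Ck (Suc n) (\<lambda>x::plane. cos (c * (x $ i - d)))"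
  proof (rule Ck_SucI)
    show "((\<lambda>x::plane. cos (c * (x $ i - d))) has_derivative (\<lambda>v. sin (c * (x $ i - d)) * (- c * v $ i))) (at x)" for x
      by (auto intro!: derivative_eq_intros bounded_linear.has_derivative[OF bounded_linear_vec_nth])
    show "Ck n (\<lambda>x::plane. sin (c * (x $ i - d)) * (- c * v $ i))" for v :: plane
      using Suc by (intro Ck_mult Ck_const) auto
  qed
  ultimately show ?case by blast
qed

lemma smooth_power: "smooth f \<Longrightarrow> smooth (\<lambda>x. f x ^ N)"
  unfolding smooth_def by (induction N) (auto intro: Ck_const Ck_mult)

lemma smooth_continuous: "smooth f \<Longrightarrow> continuous_on UNIV f"
  unfolding smooth_def using Ck_continuous by blast

text \<open>Subtracting the mean of \<open>h\<close> produces an admissible test function, and the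
  constant contributes nothing because \<open>g\<close> has mean zero.\<close>

lemma mean_zero_test_integral:
  assumes g: "continuous_on UNIV g" "mean_zero g"
    and test: "\<And>h. h \<in> smooth_mean_zero \<Longrightarrow> (LINT x|torus. g x * h x) = 0"
    and h: "smooth h" "periodic h"
  shows "(LINT x|torus. g x * h x) = 0"
proof -
  define c where "c = (LINT x|torus. h x)"
  have hc: "continuous_on UNIV h" by (rule smooth_continuous[OF h(1)])
  have "Ck n (\<lambda>x. h x + (- c))" for n
    using h by (intro Ck_add Ck_const) (simp add: smooth_def)
  then have "(\<lambda>x. h x + (- c)) \<in> smooth_mean_zero"
    using h integrable_torus_continuous[OF hc] torus.prob_space
    by (auto simp: smooth_mean_zero_def smooth_def periodic_def mean_zero_def c_def)
  from test[OF this] have "(LINT x|torus. g x * h x + (- c) * g x) = 0"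
    by (simp add: algebra_simps)
  then show ?thesis
    using g hc by (subst (asm) Bochner_Integration.integral_add)
      (auto simp: mean_zero_def intro!: integrable_torus_continuous continuous_intros)
qed

text \<open>Powers of a trigonometric polynomial that exceeds \<open>1\<close> only where \<open>g\<close> is positive concentrate
  at a given point of positivity.\<close>

lemma mean_zero_test_nonpos:
  fixes g :: "plane \<Rightarrow> real"
  assumes g: "continuous_on UNIV g" "periodic g" "mean_zero g"
    and test: "\<And>h. h \<in> smooth_mean_zero \<Longrightarrow> (LINT x|torus. g x * h x) = 0"
  shows "g y \<le> 0"
proof (rule ccontr)
  assume "\<not> g y \<le> 0"
  then have "reduce y \<in> {x. g x > 0}" using periodic_reduce[OF g(2), of y] by simp
  \<comment> \<open>The reduced point may lie on an edge of the square. Positivity is an open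
    condition, so the point can be moved inside, where a whole ball around it fits in the
    cell.\<close>
  moreover have "reduce y \<in> closure (box 0 1)"
    using cell_subset_cbox reduce_in_cell[of y] closure_box[of "0::plane" 1] by (force simp: interval_ne_empty_cart)
  moreover have op: "open {x. g x > 0}"
    using g(1) by (intro open_Collect_less continuous_intros) auto
  ultimately obtain a where a: "g a > 0" "a \<in> box 0 1"
    using open_Int_closure_eq_empty[OF op, of "box 0 1"] by auto
  define t where "t x = cos (2 * pi * (x $ 1 - a $ 1)) + cos (2 * pi * (x $ 2 - a $ 2))" for x :: plane
  have t_cont: "continuous_on UNIV t" unfolding t_def by (intro continuous_intros)
  have t_ge: "- 2 \<le> t x" and t_le: "t x \<le> 2" for x
    using cos_ge_minus_one[of "2 * pi * (x $ 1 - a $ 1)"] cos_ge_minus_one[of "2 * pi * (x $ 2 - a $ 2)"]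
      cos_le_one[of "2 * pi * (x $ 1 - a $ 1)"] cos_le_one[of "2 * pi * (x $ 2 - a $ 2)"]
    unfolding t_def by linarith+
  have t_eq2: "x - a \<in> lattice" if "t x = 2" for x
  proof -
    have "cos (2 * pi * (x $ 1 - a $ 1)) = 1" "cos (2 * pi * (x $ 2 - a $ 2)) = 1"
      using that cos_le_one[of "2 * pi * (x $ 1 - a $ 1)"] cos_le_one[of "2 * pi * (x $ 2 - a $ 2)"]
      unfolding t_def by linarith+
    then have "x $ 1 - a $ 1 \<in> \<int>" "x $ 2 - a $ 2 \<in> \<int>"
      by (auto simp: cos_one_2pi_int)
    then show ?thesis by (simp add: lattice_def forall_2)
  qed
  let ?U = "{x \<in> cbox 0 1. g x \<le> g a / 2}"
  have U: "compact ?U"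
  proof -
    have "closed {x. g x \<le> g a / 2}" using g(1) by (intro closed_Collect_le continuous_intros) auto
    then have "compact (cbox 0 1 \<inter> {x. g x \<le> g a / 2})" by (intro compact_Int_closed compact_cbox)
    then show ?thesis by (simp add: Int_def)
  qed
  \<comment> \<open>\<open>t\<close> equals 2 only at lattice translates of \<open>a\<close>, where
    \<open>g\<close> takes the value \<open>g a\<close>; these are not in \<open>?U\<close>, and
    compactness keeps \<open>t\<close> away from 2 on \<open>?U\<close>. If \<open>?U\<close> is
    empty, any number below 2 will do.\<close>
  obtain \<tau> where \<tau>: "\<tau> < 2" "\<And>x. x \<in> ?U \<Longrightarrow> t x \<le> \<tau>"
  proof (cases "?U = {}")
    case True
    have "t x \<le> 0" if "x \<in> ?U" for x using that unfolding True by (rule emptyE)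
    with zero_less_numeral show thesis by (rule that)
  next
    case False
    then obtain z where z: "z \<in> ?U" "\<And>x. x \<in> ?U \<Longrightarrow> t x \<le> t z"
      using continuous_attains_sup[OF U _ continuous_on_subset[OF t_cont subset_UNIV]] by blast
    have "t z \<noteq> 2"
    proof
      assume "t z = 2"
      from t_eq2[OF this] have "g (a + (z - a)) = g a" using g(2) unfolding periodic_def by blast
      then show False using z(1) a(1) by simp
    qed
    then have "t z < 2" using t_le[of z] by simp
    then show thesis using z(2) by (rule that)
  qed
  \<comment> \<open>This affine rescaling sends the value \<open>\<tau>\<close> of \<open>t\<close>
    to 1 and the value 2 to \<open>1 + 2 * \<kappa>\<close>; it stays nonnegative because
    \<open>t\<close> is at least -2 and \<open>\<tau> < 2\<close>.\<close>
  define Q where "Q x = t x * (1/4) + (1 - \<tau> / 4)" for x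
  have Q0: "0 \<le> Q x" for x using t_ge[of x] \<tau>(1) by (simp add: Q_def)
  have Q1: "Q x \<le> 1" if "x \<in> ?U" for x using \<tau>(2)[OF that] by (simp add: Q_def)
  define \<kappa> where "\<kappa> = (2 - \<tau>) / 8"
  have \<kappa>: "\<kappa> > 0" "Q a = 1 + 2 * \<kappa>" using \<tau>(1) by (simp_all add: \<kappa>_def Q_def t_def field_simps)
  have Q_cont: "continuous_on UNIV Q" unfolding Q_def by (intro continuous_intros t_cont)
  have Q_smooth: "smooth Q"
    unfolding smooth_def Q_def t_def using Ck_sin_cos_component by (intro allI Ck_add Ck_mult Ck_const) auto
  have Q_per: "periodic Q"
    unfolding periodic_def
  proof (intro allI ballI)
    fix x k assume k: "k \<in> lattice"
    have "cos (2 * pi * ((x + k) $ i - a $ i)) = cos (2 * pi * (x $ i - a $ i))" for i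
    proof -
      obtain n where n: "k $ i = of_int n" using k by (auto simp: lattice_def Ints_def)
      have "cos (2 * pi * (x $ i - a $ i) + 2 * pi * of_int n) = cos (2 * pi * (x $ i - a $ i))"
        by (simp only: cos_add cos_int_2pin sin_int_2pin mult_1_right mult_zero_right diff_zero)
      then show ?thesis by (simp add: n algebra_simps)
    qed
    then show "Q (x + k) = Q x" by (simp add: Q_def t_def)
  qed
  have "open ({x. g x > g a / 2} \<inter> {x. Q x > 1 + \<kappa>} \<inter> box 0 1)"
    using g(1) Q_cont by (intro open_Int open_Collect_less open_box continuous_intros) auto
  moreover have "a \<in> {x. g x > g a / 2} \<inter> {x. Q x > 1 + \<kappa>} \<inter> box 0 1"
    using a \<kappa> by simp
  ultimately obtain r where r: "r > 0" "ball a r \<subseteq> {x. g x > g a / 2} \<inter> {x. Q x > 1 + \<kappa>} \<inter> box 0 1"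
    unfolding open_contains_ball by blast
  have ball_cell: "ball a r \<subseteq> cell" using r(2) box_subset_cell by blast
  have ball_sets: "ball a r \<in> sets torus"
    unfolding torus_def sets_restrict_space_iff[of cell lborel] using ball_cell
    by (subst sets_restrict_space_iff) auto
  define m where "m = measure torus (ball a r)"
  have m: "m > 0"
    using content_ball_pos[OF r(1), of a] emeasure_torus[OF ball_cell] by (simp add: m_def measure_def)
  obtain B where B: "0 \<le> B" "\<And>x. x \<in> cbox 0 1 \<Longrightarrow> \<bar>g x\<bar> \<le> B" using continuous_bounded_cell[OF g(1)] by blast
  \<comment> \<open>On the ball the integrand grows geometrically in \<open>N\<close>. Elsewhere in
    the square \<open>g\<close> can be negative only on \<open>?U\<close>, where powers of
    \<open>Q\<close> are at most 1, so at most \<open>B\<close> is lost. As the whole integral is 0,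
    the growth is impossible.\<close>
  have "m * (g a / 2) * (1 + \<kappa>) ^ N \<le> B" for N
  proof -
    have cont: "continuous_on UNIV (\<lambda>x. g x * Q x ^ N)" by (intro continuous_intros g Q_cont)
    have "(LINT x|torus. (g a / 2 * (1 + \<kappa>) ^ N) * indicator (ball a r) x - B) \<le> (LINT x|torus. g x * Q x ^ N)"
    proof (rule integral_mono)
      show "integrable torus (\<lambda>x. (g a / 2 * (1 + \<kappa>) ^ N) * indicator (ball a r) x - B)"
        using ball_sets by (intro Bochner_Integration.integrable_diff integrable_mult_right integrable_real_indicator)
          (auto simp: torus.emeasure_eq_measure)
      show "integrable torus (\<lambda>x. g x * Q x ^ N)" by (rule integrable_torus_continuous[OF cont])
      fix x assume "x \<in> space torus"
      then have x: "x \<in> cbox 0 1" using cell_subset_cbox by auto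
      show "(g a / 2 * (1 + \<kappa>) ^ N) * indicator (ball a r) x - B \<le> g x * Q x ^ N"
      proof (cases "x \<in> ball a r")
        case True
        then have "g x > g a / 2" "Q x > 1 + \<kappa>" using r(2) by auto
        then have "g a / 2 * (1 + \<kappa>) ^ N \<le> g x * Q x ^ N"
          using a(1) \<kappa>(1) by (intro mult_mono power_mono) auto
        then show ?thesis using True B(1) by simp
      next
        case False
        have "- B \<le> g x * Q x ^ N"
        proof (cases "g x \<ge> 0")
          case True
          then have "0 \<le> g x * Q x ^ N" using Q0 by simp
          then show ?thesis using B(1) by linarith
        next
          case neg: False
          then have "Q x ^ N \<le> 1" using Q1[of x] x a(1) Q0 by (intro power_le_one) auto
          then have "g x * 1 \<le> g x * Q x ^ N" using neg by (intro mult_left_mono_neg) auto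
          then show ?thesis using B(2)[OF x] by linarith
        qed
        then show ?thesis using False by simp
      qed
    qed
    also have "(LINT x|torus. g x * Q x ^ N) = 0"
    proof (rule mean_zero_test_integral[OF g(1,3) test])
      show "smooth (\<lambda>x. Q x ^ N)" by (rule smooth_power[OF Q_smooth])
      show "periodic (\<lambda>x. Q x ^ N)" using Q_per by (simp add: periodic_def)
    qed
    also have "(LINT x|torus. (g a / 2 * (1 + \<kappa>) ^ N) * indicator (ball a r) x - B)
        = (g a / 2 * (1 + \<kappa>) ^ N) * m - B"
      using ball_sets ball_cell
      by (subst Bochner_Integration.integral_diff)
        (auto simp: torus.emeasure_eq_measure torus.prob_space m_def Int_absorb2 simp del: space_torus)
    finally show ?thesis by (simp add: algebra_simps)
  qed
  moreover obtain N where "B / (m * (g a / 2)) < (1 + \<kappa>) ^ N"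
    using real_arch_pow[of "1 + \<kappa>"] \<kappa>(1) by auto
  moreover have "0 < m * (g a / 2)" using m a(1) by simp
  ultimately show False
    by (metis divide_less_eq mult.commute not_le)
qed

lemma mean_zero_test_zero:
  fixes g :: "plane \<Rightarrow> real"
  assumes g: "continuous_on UNIV g" "periodic g" "mean_zero g"
    and test: "\<And>h. h \<in> smooth_mean_zero \<Longrightarrow> (LINT x|torus. g x * h x) = 0"
  shows "g = (\<lambda>x. 0)"
proof
  fix y
  have "g y \<le> 0" by (rule mean_zero_test_nonpos[OF g test])
  moreover have "- g y \<le> 0"
  proof (rule mean_zero_test_nonpos[of "\<lambda>x. - g x"])
    show "continuous_on UNIV (\<lambda>x. - g x)" by (intro continuous_intros g)
  qed (use g test in \<open>auto simp: periodic_def mean_zero_def\<close>)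
  ultimately show "g y = 0" by simp
qed

section \<open>Couplings of densities\<close>

text \<open>Continuity replaces smoothness here because the functional is later evaluated at \<rho>
  - t (\<psi>' - \<psi>), and potentials are only known to be C^2.\<close>

definition densities :: "real \<Rightarrow> (plane \<Rightarrow> real) set" where
  "densities \<epsilon> = {\<rho>. continuous_on UNIV \<rho> \<and> periodic \<rho> \<and> mean_zero \<rho> \<and> (\<forall>x. 0 < 1 + \<epsilon> * \<rho> x)}"

lemma positive_densities_subset: "positive_densities \<epsilon> \<subseteq> densities \<epsilon>"
  by (auto simp: positive_densities_def densities_def smooth_mean_zero_def smooth_continuous)

lemma sets_dens [simp]: "sets (dens_measure \<epsilon> \<rho>) = sets torus"
  by (simp add: dens_measure_def)

lemma space_dens [simp]: "space (dens_measure \<epsilon> \<rho>) = cell"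
  by (simp add: dens_measure_def)

lemma densities_integral:
  assumes "\<rho> \<in> densities \<epsilon>"
  shows "integrable torus (\<lambda>x. 1 + \<epsilon> * \<rho> x)" "(LINT x|torus. 1 + \<epsilon> * \<rho> x) = 1"
proof -
  have c: "continuous_on UNIV \<rho>" and mz: "mean_zero \<rho>" using assms by (auto simp: densities_def)
  show "integrable torus (\<lambda>x. 1 + \<epsilon> * \<rho> x)"
    by (intro integrable_torus_continuous continuous_intros c)
  show "(LINT x|torus. 1 + \<epsilon> * \<rho> x) = 1"
    using integrable_torus_continuous[OF c] mz
    by (simp add: mean_zero_def torus.prob_space del: space_torus)
qed

lemma integral_dens:
  fixes h :: "plane \<Rightarrow> real"
  assumes "\<rho> \<in> densities \<epsilon>" "h \<in> borel_measurable torus"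
  shows "(LINT x|dens_measure \<epsilon> \<rho>. h x) = (LINT x|torus. (1 + \<epsilon> * \<rho> x) * h x)"
    and "integrable (dens_measure \<epsilon> \<rho>) h \<longleftrightarrow> integrable torus (\<lambda>x. (1 + \<epsilon> * \<rho> x) * h x)"
proof -
  have m: "(\<lambda>x. 1 + \<epsilon> * \<rho> x) \<in> borel_measurable torus"
    using densities_integral(1)[OF assms(1)] by auto
  have nn: "AE x in torus. 0 \<le> 1 + \<epsilon> * \<rho> x"
    using assms(1) by (intro AE_I2) (auto simp: densities_def less_imp_le)
  show "(LINT x|dens_measure \<epsilon> \<rho>. h x) = (LINT x|torus. (1 + \<epsilon> * \<rho> x) * h x)"
    unfolding dens_measure_def using integral_density[OF assms(2) m nn] by simp
  show "integrable (dens_measure \<epsilon> \<rho>) h \<longleftrightarrow> integrable torus (\<lambda>x. (1 + \<epsilon> * \<rho> x) * h x)"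
    unfolding dens_measure_def using integrable_density[OF assms(2) m nn] by simp
qed

lemma prob_space_dens:
  assumes "\<rho> \<in> densities \<epsilon>"
  shows "prob_space (dens_measure \<epsilon> \<rho>)"
proof
  have m: "(\<lambda>x. 1 + \<epsilon> * \<rho> x) \<in> borel_measurable torus"
    using densities_integral(1)[OF assms] by auto
  have "emeasure (dens_measure \<epsilon> \<rho>) (space (dens_measure \<epsilon> \<rho>)) = (\<integral>\<^sup>+x. ennreal (1 + \<epsilon> * \<rho> x) * indicator (space torus) x \<partial>torus)"
    unfolding dens_measure_def using m sets.top[of torus] by (subst emeasure_density) auto
  also have "\<dots> = (\<integral>\<^sup>+x. ennreal (1 + \<epsilon> * \<rho> x) \<partial>torus)"
    by (intro nn_integral_cong) simp
  also have "\<dots> = ennreal (LINT x|torus. 1 + \<epsilon> * \<rho> x)"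
    using assms by (intro nn_integral_eq_integral densities_integral[OF assms] AE_I2) (auto simp: densities_def less_imp_le)
  finally show "emeasure (dens_measure \<epsilon> \<rho>) (space (dens_measure \<epsilon> \<rho>)) = 1"
    by (simp add: densities_integral(2)[OF assms])
qed

section \<open>Integration against couplings and finiteness of the cost\<close>

lemma coupling_measurable:
  assumes "\<pi> \<in> couplings \<mu> \<nu>"
  shows "fst \<in> measurable \<pi> \<mu>" "snd \<in> measurable \<pi> \<nu>"
proof -
  have s: "sets \<pi> = sets (\<mu> \<Otimes>\<^sub>M \<nu>)" using assms by (simp add: couplings_def)
  show "fst \<in> measurable \<pi> \<mu>" "snd \<in> measurable \<pi> \<nu>"
    unfolding measurable_cong_sets[OF s refl] by simp_all
qed

lemma coupling_integral:
  fixes h k :: "'a \<Rightarrow> real"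
  assumes \<pi>: "\<pi> \<in> couplings \<mu> \<nu>" and h: "integrable \<mu> h" and k: "integrable \<nu> k"
  shows "integrable \<pi> (\<lambda>z. k (snd z) - h (fst z))"
    and "(LINT z|\<pi>. k (snd z) - h (fst z)) = (LINT x|\<nu>. k x) - (LINT x|\<mu>. h x)"
proof -
  have d: "distr \<pi> \<mu> fst = \<mu>" "distr \<pi> \<nu> snd = \<nu>" using \<pi> by (simp_all add: couplings_def)
  note m = coupling_measurable[OF \<pi>]
  have 1: "integrable \<pi> (\<lambda>z. h (fst z))" using integrable_distr_eq[OF m(1), of h] h d by auto
  have 2: "integrable \<pi> (\<lambda>z. k (snd z))" using integrable_distr_eq[OF m(2), of k] k d by auto
  show "integrable \<pi> (\<lambda>z. k (snd z) - h (fst z))" using 1 2 by simp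
  show "(LINT z|\<pi>. k (snd z) - h (fst z)) = (LINT x|\<nu>. k x) - (LINT x|\<mu>. h x)"
    using 1 2 integral_distr[OF m(1), of h] integral_distr[OF m(2), of k] h k d by auto
qed

text \<open>\<open>F\<close> may change sign: \<open>ennreal\<close> truncates its negative part,
  which can only increase the right-hand side.\<close>

lemma ennreal_integral_le_nn_integral:
  fixes F :: "'a \<Rightarrow> real"
  assumes F: "integrable M F"
  shows "ennreal (LINT x|M. F x) \<le> (\<integral>\<^sup>+x. ennreal (F x) \<partial>M)"
proof -
  have i: "integrable M (\<lambda>x. max 0 (F x))" using F by simp
  have "ennreal (LINT x|M. F x) \<le> ennreal (LINT x|M. max 0 (F x))"
    by (intro ennreal_leI integral_mono F i) simp
  also have "\<dots> = (\<integral>\<^sup>+x. ennreal (max 0 (F x)) \<partial>M)"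
    using i by (intro nn_integral_eq_integral[symmetric]) auto
  also have "\<dots> = (\<integral>\<^sup>+x. ennreal (F x) \<partial>M)"
    by (intro nn_integral_cong) (auto simp: max_def ennreal_neg)
  finally show ?thesis .
qed

abbreviation transport_cost :: "(plane \<times> plane) measure \<Rightarrow> ennreal" where
  "transport_cost \<pi> \<equiv> \<integral>\<^sup>+ z. ennreal ((torus_dist (fst z) (snd z))\<^sup>2) \<partial>\<pi>"

lemma prob_space_coupling:
  assumes "\<pi> \<in> couplings \<mu> \<nu>" "prob_space \<mu>"
  shows "prob_space \<pi>"
proof -
  have "distr \<pi> \<mu> fst = \<mu>" using assms(1) by (simp add: couplings_def)
  then show ?thesis using prob_space_distrD[OF coupling_measurable(1)[OF assms(1)]] assms(2) by simp
qed

lemma product_coupling: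
  assumes "prob_space \<mu>" "prob_space \<nu>"
  shows "\<mu> \<Otimes>\<^sub>M \<nu> \<in> couplings \<mu> \<nu>"
proof -
  interpret \<mu>: prob_space \<mu> by fact
  interpret \<nu>: prob_space \<nu> by fact
  interpret pair_prob_space \<mu> \<nu> ..
  have "distr (\<mu> \<Otimes>\<^sub>M \<nu>) \<nu> snd = \<nu>"
  proof (rule measure_eqI)
    fix A assume "A \<in> sets (distr (\<mu> \<Otimes>\<^sub>M \<nu>) \<nu> snd)"
    then have A: "A \<in> sets \<nu>" by simp
    have "snd -` A \<inter> space (\<mu> \<Otimes>\<^sub>M \<nu>) = space \<mu> \<times> A"
      using sets.sets_into_space[OF A] by (auto simp: space_pair_measure)
    then show "emeasure (distr (\<mu> \<Otimes>\<^sub>M \<nu>) \<nu> snd) A = emeasure \<nu> A"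
      using A by (simp add: emeasure_distr \<nu>.emeasure_pair_measure_Times \<mu>.emeasure_space_1)
  qed simp
  then show ?thesis by (simp add: couplings_def \<nu>.distr_pair_fst)
qed

lemma torus_dist_sq_le_2: "x \<in> cell \<Longrightarrow> y \<in> cell \<Longrightarrow> (torus_dist x y)\<^sup>2 \<le> 2"
proof -
  assume "x \<in> cell" "y \<in> cell"
  then have "\<bar>x $ i - y $ i\<bar> \<le> 1" for i by (auto simp: cell_def abs_le_iff) (smt (verit))+
  then have "(x $ i - y $ i)\<^sup>2 \<le> 1" for i by (simp add: abs_square_le_1)
  then have "(x $ 1 - y $ 1)\<^sup>2 + (x $ 2 - y $ 2)\<^sup>2 \<le> 1 + 1" by (intro add_mono)
  then have "(norm (x - y))\<^sup>2 \<le> 2" by (simp add: norm_vec_def L2_set_def UNIV_2)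
  moreover have "0 \<in> lattice" by (simp add: lattice_def)
  ultimately show ?thesis using torus_dist_sq_le[of 0 x y] by simp
qed

text \<open>\<open>enn2real\<close> sends infinity to 0, so a lower bound on all costs passes to
  \<open>W2\<close> only when some plan has finite cost. The product plan does, since the cost is
  bounded.\<close>

lemma optimal_cost_finite:
  assumes "\<rho> \<in> densities \<epsilon>"
  shows "(INF \<pi>\<in>couplings (dens_measure \<epsilon> \<rho>) torus. transport_cost \<pi>) < \<infinity>"
proof -
  let ?\<pi> = "dens_measure \<epsilon> \<rho> \<Otimes>\<^sub>M torus"
  have \<pi>: "?\<pi> \<in> couplings (dens_measure \<epsilon> \<rho>) torus"
    by (intro product_coupling prob_space_dens assms prob_space_torus)
  interpret prob_space ?\<pi> by (rule prob_space_coupling[OF \<pi> prob_space_dens[OF assms]])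
  have "transport_cost ?\<pi> \<le> (\<integral>\<^sup>+z. 2 \<partial>?\<pi>)"
    by (intro nn_integral_mono) (auto simp: space_pair_measure intro!: torus_dist_sq_le_2 simp flip: ennreal_numeral)
  also have "\<dots> < \<infinity>" by (simp add: emeasure_space_1)
  finally have "transport_cost ?\<pi> < \<infinity>" .
  then show ?thesis using \<pi> by (meson INF_lower order_le_less_trans)
qed

lemma W2_sq: "(W2 \<mu> \<nu>)\<^sup>2 = enn2real (INF \<pi>\<in>couplings \<mu> \<nu>. transport_cost \<pi>)"
  by (simp add: W2_def)

section \<open>First-order bounds on the transport cost\<close>

locale transport_potential =
  fixes \<epsilon> :: real and \<rho> \<psi> :: "plane \<Rightarrow> real"
  assumes \<epsilon>: "\<epsilon> > 0" and \<rho>: "\<rho> \<in> densities \<epsilon>" and potential: "is_potential \<epsilon> \<rho> \<psi>"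
begin

lemma C2: "Ck 2 \<psi>" and per: "periodic \<psi>" and mz: "mean_zero \<psi>"
  and cvx: "convex_on UNIV (brenier \<epsilon> \<psi>)"
  using potential by (simp_all add: is_potential_def)

lemma diff: "\<psi> differentiable (at x)"
  using C2 Ck_Suc_differentiable[of 1 \<psi>] by (simp add: numeral_2_eq_2)

lemma cont: "continuous_on UNIV \<psi>"
  using C2 by (rule Ck_continuous)

lemma grad_cont: "continuous_on UNIV (grad \<psi>)"
  using C2 Ck_continuous_grad[of 1 \<psi>] by (simp add: numeral_2_eq_2)

lemma bound: "\<bar>\<psi> x\<bar> \<le> 1 / \<epsilon>"
  by (rule potential_bound[OF \<epsilon> cvx diff per mz])

definition T :: "plane \<Rightarrow> plane" where
  "T z = z + \<epsilon> *\<^sub>R grad \<psi> z"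

lemma T_meas: "(\<lambda>z. reduce (T z)) \<in> measurable torus torus"
proof (rule measurable_into_torus)
  have "T \<in> borel_measurable torus"
    unfolding T_def[abs_def] by (intro continuous_imp_borel_torus continuous_intros grad_cont)
  then show "(\<lambda>z. reduce (T z)) \<in> borel_measurable torus"
    by (rule measurable_compose[OF _ reduce_measurable])
qed simp

lemma T_push: "distr (dens_measure \<epsilon> \<rho>) torus (\<lambda>z. reduce (T z)) = torus"
  using potential by (simp add: is_potential_def grad_brenier[OF diff] T_def)

text \<open>The convex conjugate of the potential, written so that it is periodic.\<close>

definition ctransform :: "plane \<Rightarrow> real" where
  "ctransform y = (INF x. (norm (x - y))\<^sup>2 / 2 + \<epsilon> * \<psi> x)"

lemma \<epsilon>\<psi>_bound: "\<bar>\<epsilon> * \<psi> x\<bar> \<le> 1"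
  using bound[of x] \<epsilon> by (simp add: abs_mult field_simps)

lemma ctransform_bdd: "bdd_below (range (\<lambda>x. (norm (x - y))\<^sup>2 / 2 + \<epsilon> * \<psi> x))"
proof (intro bdd_belowI2)
  fix x show "- 1 \<le> (norm (x - y))\<^sup>2 / 2 + \<epsilon> * \<psi> x"
    using \<epsilon>\<psi>_bound[of x] zero_le_power2[of "norm (x - y)"] by linarith
qed

lemma ctransform_le: "ctransform y \<le> (norm (x - y))\<^sup>2 / 2 + \<epsilon> * \<psi> x"
  unfolding ctransform_def by (rule cINF_lower[OF ctransform_bdd]) simp

lemma ctransform_greatest: "(\<And>x. v \<le> (norm (x - y))\<^sup>2 / 2 + \<epsilon> * \<psi> x) \<Longrightarrow> v \<le> ctransform y"
  unfolding ctransform_def by (rule cINF_greatest) auto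

lemma ctransform_abs_le: "\<bar>ctransform y\<bar> \<le> 1"
proof -
  have "ctransform y \<le> 1" using ctransform_le[of y y] \<epsilon>\<psi>_bound[of y] by (simp add: abs_le_iff)
  moreover have "- 1 \<le> ctransform y"
  proof (rule ctransform_greatest)
    fix x show "- 1 \<le> (norm (x - y))\<^sup>2 / 2 + \<epsilon> * \<psi> x"
      using \<epsilon>\<psi>_bound[of x] zero_le_power2[of "norm (x - y)"] by linarith
  qed
  ultimately show ?thesis by simp
qed

lemma ctransform_shift: "k \<in> lattice \<Longrightarrow> ctransform y \<le> ctransform (y + k)"
proof (rule ctransform_greatest)
  fix x assume "k \<in> lattice"
  then have "\<psi> (x - k) = \<psi> x"
    using per lattice_uminus[of k] unfolding periodic_def by (metis add_uminus_conv_diff)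
  then show "ctransform y \<le> (norm (x - (y + k)))\<^sup>2 / 2 + \<epsilon> * \<psi> x"
    using ctransform_le[of y "x - k"] by (simp add: algebra_simps)
qed

lemma ctransform_reduce: "ctransform (reduce y) = ctransform y"
proof -
  let ?k = "(\<chi> i. of_int \<lfloor>y $ i\<rfloor>) :: plane"
  have "ctransform y \<le> ctransform (y + - ?k)" by (intro ctransform_shift lattice_uminus lattice_floor)
  moreover have "ctransform (reduce y) \<le> ctransform (reduce y + ?k)" by (intro ctransform_shift lattice_floor)
  ultimately show ?thesis by (simp add: reduce_eq)
qed

text \<open>The infimum ranges over uncountably many points, but each term is continuous in
  \<open>y\<close>, so the strict sublevel sets are unions of open sets.\<close>

lemma ctransform_measurable: "ctransform \<in> borel_measurable borel"
proof (subst borel_measurable_iff_less, intro allI)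
  fix a
  have "{y \<in> space borel. ctransform y < a} = (\<Union>x. {y. (norm (x - y))\<^sup>2 / 2 + \<epsilon> * \<psi> x < a})"
    unfolding ctransform_def using cINF_less_iff[OF UNIV_not_empty ctransform_bdd] by auto
  moreover have "open (\<Union>x. {y. (norm (x - y))\<^sup>2 / 2 + \<epsilon> * \<psi> x < a})"
    by (intro open_UN ballI open_Collect_less continuous_intros) simp_all
  ultimately show "{y \<in> space borel. ctransform y < a} \<in> sets borel" by simp
qed

text \<open>The infimum is attained at \<open>z\<close>: with target \<open>T z\<close>, the term of
  the squared distance that is linear in \<open>x - z\<close> cancels the gradient term of
  \<open>potential_above_tangent\<close>.\<close>

lemma ctransform_T: "ctransform (T z) = (\<epsilon>\<^sup>2 * (norm (grad \<psi> z))\<^sup>2) / 2 + \<epsilon> * \<psi> z"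
proof (rule antisym)
  have zT: "norm (z - T z) = \<epsilon> * norm (grad \<psi> z)" using \<epsilon> by (simp add: T_def)
  show "ctransform (T z) \<le> (\<epsilon>\<^sup>2 * (norm (grad \<psi> z))\<^sup>2) / 2 + \<epsilon> * \<psi> z"
    using ctransform_le[of "T z" z] by (simp add: zT power_mult_distrib)
  show "(\<epsilon>\<^sup>2 * (norm (grad \<psi> z))\<^sup>2) / 2 + \<epsilon> * \<psi> z \<le> ctransform (T z)"
  proof (rule ctransform_greatest)
    fix x
    have "(norm (x - T z))\<^sup>2 = (norm (x - z))\<^sup>2 - 2 * (\<epsilon> * (grad \<psi> z \<bullet> (x - z))) + \<epsilon>\<^sup>2 * (norm (grad \<psi> z))\<^sup>2"
      unfolding power2_norm_eq_inner T_def
      by (simp add: inner_diff_left inner_diff_right inner_add_left inner_add_right inner_commute power2_eq_square algebra_simps)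
    then show "(\<epsilon>\<^sup>2 * (norm (grad \<psi> z))\<^sup>2) / 2 + \<epsilon> * \<psi> z \<le> (norm (x - T z))\<^sup>2 / 2 + \<epsilon> * \<psi> x"
      using potential_above_tangent[OF cvx diff, of z x] by linarith
  qed
qed

text \<open>A lattice shift of \<open>x\<close> leaves \<psi> unchanged, so the Euclidean inequality
  holds for every translate and therefore for the torus distance.\<close>

lemma ctransform_torus_dist: "ctransform y - \<epsilon> * \<psi> x \<le> (torus_dist x y)\<^sup>2 / 2"
proof (rule half_torus_dist_sq_greatest)
  fix k assume "k \<in> lattice"
  then have "\<psi> (x - k) = \<psi> x"
    using per lattice_uminus[of k] unfolding periodic_def by (metis add_uminus_conv_diff)
  then show "ctransform y - \<epsilon> * \<psi> x \<le> (norm (x - y - k))\<^sup>2 / 2"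
    using ctransform_le[of y "x - k"] by (simp add: algebra_simps)
qed

text \<open>Half the mean squared displacement of \<open>T\<close>, that is, half its Euclidean cost
  on the lift. \<open>H_self\<close> identifies it with \<open>\<epsilon>\<^sup>2\<close> times the
  functional at \<open>\<rho>\<close>.\<close>

definition kinetic :: real where
  "kinetic = (LINT x|torus. (1 + \<epsilon> * \<rho> x) * ((\<epsilon>\<^sup>2 * (norm (grad \<psi> x))\<^sup>2) / 2))"

text \<open>The tangent of the functional at \<open>\<rho>\<close>, scaled by
  \<open>\<epsilon>\<^sup>2\<close> to be comparable with half the squared Wasserstein
  distance.\<close>

definition lin :: "(plane \<Rightarrow> real) \<Rightarrow> real" where
  "lin \<rho>' = kinetic - \<epsilon>\<^sup>2 * (LINT x|torus. \<psi> x * (\<rho>' x - \<rho> x))"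

definition defect :: "(plane \<Rightarrow> real) \<Rightarrow> real" where
  "defect \<rho>' = (LINT x|torus. \<bar>\<epsilon> * \<rho>' x - \<epsilon> * \<rho> x\<bar>)"

lemma \<rho>_cont: "continuous_on UNIV \<rho>"
  using \<rho> by (simp add: densities_def)

text \<open>The two \<psi> terms differ by exactly the pairing in \<open>lin\<close>. In this form
  the tangent is the value of a dual pair: the first integral is that of the conjugate, the second
  that of the potential.\<close>

lemma lin_eq:
  assumes \<rho>': "\<rho>' \<in> densities \<epsilon>"
  shows "lin \<rho>' = (LINT x|torus. (1 + \<epsilon> * \<rho> x) * ((\<epsilon>\<^sup>2 * (norm (grad \<psi> x))\<^sup>2) / 2 + \<epsilon> * \<psi> x))
      - (LINT x|torus. (1 + \<epsilon> * \<rho>' x) * (\<epsilon> * \<psi> x))"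
proof -
  have c': "continuous_on UNIV \<rho>'" using \<rho>' by (simp add: densities_def)
  note [continuous_intros] = cont grad_cont \<rho>_cont c'
  note int = integrable_torus_continuous
  have "(LINT x|torus. (1 + \<epsilon> * \<rho> x) * ((\<epsilon>\<^sup>2 * (norm (grad \<psi> x))\<^sup>2) / 2 + \<epsilon> * \<psi> x))
      - (LINT x|torus. (1 + \<epsilon> * \<rho>' x) * (\<epsilon> * \<psi> x))
     = (LINT x|torus. (1 + \<epsilon> * \<rho> x) * ((\<epsilon>\<^sup>2 * (norm (grad \<psi> x))\<^sup>2) / 2 + \<epsilon> * \<psi> x) - (1 + \<epsilon> * \<rho>' x) * (\<epsilon> * \<psi> x))"
    by (intro Bochner_Integration.integral_diff[symmetric] int continuous_intros) auto
  also have "\<dots> = (LINT x|torus. (1 + \<epsilon> * \<rho> x) * ((\<epsilon>\<^sup>2 * (norm (grad \<psi> x))\<^sup>2) / 2) - \<epsilon>\<^sup>2 * (\<psi> x * (\<rho>' x - \<rho> x)))"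
    by (intro Bochner_Integration.integral_cong) (simp_all add: algebra_simps power2_eq_square)
  also have "\<dots> = kinetic - (LINT x|torus. \<epsilon>\<^sup>2 * (\<psi> x * (\<rho>' x - \<rho> x)))"
    unfolding kinetic_def by (intro Bochner_Integration.integral_diff int continuous_intros) auto
  finally show ?thesis by (simp add: lin_def)
qed

lemma integral_ctransform:
  "(LINT y|torus. ctransform y) = (LINT x|torus. (1 + \<epsilon> * \<rho> x) * ((\<epsilon>\<^sup>2 * (norm (grad \<psi> x))\<^sup>2) / 2 + \<epsilon> * \<psi> x))"
proof -
  have "(LINT y|torus. ctransform y) = (LINT y|distr (dens_measure \<epsilon> \<rho>) torus (\<lambda>z. reduce (T z)). ctransform y)"
    by (simp only: T_push)
  also have "\<dots> = (LINT z|dens_measure \<epsilon> \<rho>. ctransform (reduce (T z)))"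
    using T_meas measurable_cong_sets[OF sets_dens refl, of \<epsilon> \<rho> torus]
    by (intro integral_distr borel_measurable_torusI ctransform_measurable) simp
  also have "\<dots> = (LINT z|dens_measure \<epsilon> \<rho>. (\<epsilon>\<^sup>2 * (norm (grad \<psi> z))\<^sup>2) / 2 + \<epsilon> * \<psi> z)"
    by (simp add: ctransform_reduce ctransform_T)
  also have "\<dots> = (LINT x|torus. (1 + \<epsilon> * \<rho> x) * ((\<epsilon>\<^sup>2 * (norm (grad \<psi> x))\<^sup>2) / 2 + \<epsilon> * \<psi> x))"
    by (intro integral_dens[OF \<rho>] continuous_imp_borel_torus continuous_intros cont grad_cont) auto
  finally show ?thesis .
qed

lemma cost_lower:
  assumes \<rho>': "\<rho>' \<in> densities \<epsilon>" and \<pi>: "\<pi> \<in> couplings (dens_measure \<epsilon> \<rho>') torus"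
  shows "ennreal (2 * lin \<rho>') \<le> transport_cost \<pi>"
proof -
  have c': "continuous_on UNIV \<rho>'" using \<rho>' by (simp add: densities_def)
  have meas: "(\<lambda>x. \<epsilon> * \<psi> x) \<in> borel_measurable torus"
    by (intro continuous_imp_borel_torus continuous_intros cont)
  have h: "integrable (dens_measure \<epsilon> \<rho>') (\<lambda>x. 2 * (\<epsilon> * \<psi> x))"
    unfolding integral_dens(2)[OF \<rho>' borel_measurable_times[OF borel_measurable_const meas]]
    by (intro integrable_torus_continuous continuous_intros cont c')
  have k: "integrable torus (\<lambda>y. 2 * ctransform y)"
    using ctransform_abs_le
    by (intro Bochner_Integration.integrable_mult_right torus.integrable_const_bound[of _ 1]
        borel_measurable_torusI ctransform_measurable) auto
  have "(LINT z|\<pi>. 2 * ctransform (snd z) - 2 * (\<epsilon> * \<psi> (fst z)))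
      = (LINT y|torus. 2 * ctransform y) - (LINT x|dens_measure \<epsilon> \<rho>'. 2 * (\<epsilon> * \<psi> x))"
    by (rule coupling_integral(2)[OF \<pi> h k])
  also have "\<dots> = 2 * (LINT y|torus. ctransform y) - 2 * (LINT x|dens_measure \<epsilon> \<rho>'. \<epsilon> * \<psi> x)"
    by (intro arg_cong2[where f="(-)"] integral_mult_right_zero)
  also have "\<dots> = 2 * lin \<rho>'"
    by (simp only: lin_eq[OF \<rho>'] integral_ctransform integral_dens(1)[OF \<rho>' meas] right_diff_distrib)
  finally have "ennreal (2 * lin \<rho>') \<le> (\<integral>\<^sup>+z. ennreal (2 * ctransform (snd z) - 2 * (\<epsilon> * \<psi> (fst z))) \<partial>\<pi>)"
    using ennreal_integral_le_nn_integral[OF coupling_integral(1)[OF \<pi> h k]] by simp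
  also have "\<dots> \<le> transport_cost \<pi>"
  proof (intro nn_integral_mono ennreal_leI)
    fix z :: "plane \<times> plane"
    show "2 * ctransform (snd z) - 2 * (\<epsilon> * \<psi> (fst z)) \<le> (torus_dist (fst z) (snd z))\<^sup>2"
      using ctransform_torus_dist[of "snd z" "fst z"] by simp
  qed
  finally show ?thesis .
qed

text \<open>Following a plan between the two densities by \<open>T\<close> gives an admissible plan.
  The constant depends on \<rho> and its potential only, which leaves \<open>n\<close> free for the
  later limit. The sign condition is recorded because \<open>ennreal\<close> would hide a negative
  bound.\<close>

lemma cost_upper_exists:
  obtains C where "C \<ge> 0" "\<And>\<rho>' n c. \<rho>' \<in> densities \<epsilon> \<Longrightarrow> n > 0 \<Longrightarrow> 0 \<le> c \<Longrightarrow> (\<And>x. c \<le> 1 + \<epsilon> * \<rho> x) \<Longrightarrow>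
     (real n + 1) * defect \<rho>' \<le> c / (real n)\<^sup>2 \<Longrightarrow>
     \<exists>\<pi>\<in>couplings (dens_measure \<epsilon> \<rho>') torus. transport_cost \<pi> \<le> ennreal (2 * lin \<rho>' + C * defect \<rho>' / n)
       \<and> 0 \<le> 2 * lin \<rho>' + C * defect \<rho>' / n"
proof -
  obtain L where L: "0 \<le> L" "\<And>x z. x \<in> cbox 0 1 \<Longrightarrow> z \<in> cbox 0 1 \<Longrightarrow>
      \<psi> x \<le> \<psi> z + grad \<psi> z \<bullet> (x - z) + L * (norm (x - z))\<^sup>2"
    using C2_quadratic_bound[OF C2] by blast
  \<comment> \<open>Expanding the squared norm of \<open>x - T y\<close> leaves one squared norm of
    \<open>x - y\<close>; trading the gradient term for a difference of values of \<psi> adds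
    \<open>2 * \<epsilon> * L\<close> of them. The factor 8 below comes from
    \<open>small_transport\<close>.\<close>
  define K where "K = 1 + 2 * \<epsilon> * L"
  have K: "K \<ge> 0" using L(1) \<epsilon> by (simp add: K_def)
  show thesis
  proof (rule that[of "8 * K"])
    show "0 \<le> 8 * K" using K by simp
    fix \<rho>' and n :: nat and c :: real
    assume \<rho>': "\<rho>' \<in> densities \<epsilon>" and n: "n > 0" and c: "0 \<le> c" "\<And>x. c \<le> 1 + \<epsilon> * \<rho> x"
      and small: "(real n + 1) * defect \<rho>' \<le> c / (real n)\<^sup>2"
    define s where "s = defect \<rho>'"
    have s0: "0 \<le> s" unfolding s_def defect_def by (intro integral_nonneg_AE) auto
    have c': "continuous_on UNIV \<rho>'" using \<rho>' by (simp add: densities_def)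
    obtain \<gamma> where \<gamma>: "sets \<gamma> = sets (torus \<Otimes>\<^sub>M torus)"
      "distr \<gamma> torus fst = density torus (\<lambda>x. ennreal (1 + \<epsilon> * \<rho>' x))"
      "distr \<gamma> torus snd = density torus (\<lambda>x. ennreal (1 + \<epsilon> * \<rho> x))"
      "(\<integral>\<^sup>+z. ennreal ((norm (fst z - snd z))\<^sup>2) \<partial>\<gamma>) \<le> ennreal (8 * s / n)"
    proof (rule small_transport[OF n densities_integral(1)[OF \<rho>'] _ densities_integral(1)[OF \<rho>] c])
      show "0 \<le> 1 + \<epsilon> * \<rho>' x" for x using \<rho>' by (auto simp: densities_def less_imp_le)
      show "(LINT x|torus. 1 + \<epsilon> * \<rho>' x) = (LINT x|torus. 1 + \<epsilon> * \<rho> x)"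
        by (simp only: densities_integral(2)[OF \<rho>'] densities_integral(2)[OF \<rho>])
      show "s = (LINT x|torus. \<bar>1 + \<epsilon> * \<rho>' x - (1 + \<epsilon> * \<rho> x)\<bar>)" by (simp add: s_def defect_def)
      show "real (n + 1) * s \<le> c / real (n\<^sup>2)" using small by (simp add: s_def add.commute)
    qed blast
    have g: "\<gamma> \<in> couplings (dens_measure \<epsilon> \<rho>') (dens_measure \<epsilon> \<rho>)"
    proof -
      have "distr \<gamma> (dens_measure \<epsilon> \<rho>') fst = distr \<gamma> torus fst" "distr \<gamma> (dens_measure \<epsilon> \<rho>) snd = distr \<gamma> torus snd"
        by (rule distr_cong; simp)+
      moreover have "sets \<gamma> = sets (dens_measure \<epsilon> \<rho>' \<Otimes>\<^sub>M dens_measure \<epsilon> \<rho>)"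
        unfolding \<gamma>(1) by (rule sets_pair_measure_cong[symmetric]) simp_all
      ultimately show ?thesis using \<gamma>(2,3) by (simp add: couplings_def dens_measure_def)
    qed
    have space_\<gamma>: "space \<gamma> = cell \<times> cell"
      using sets_eq_imp_space_eq[OF \<gamma>(1)] by (simp add: space_pair_measure)
    interpret \<gamma>: prob_space \<gamma> by (rule prob_space_coupling[OF g prob_space_dens[OF \<rho>']])
    note gm = coupling_measurable[OF g]
    have fst_t: "fst \<in> measurable \<gamma> torus" and snd_t: "snd \<in> measurable \<gamma> torus"
      using gm unfolding measurable_cong_sets[OF refl sets_dens] by auto
    define \<Phi> where "\<Phi> z = (fst z, reduce (T (snd z)))" for z :: "plane \<times> plane"
    have \<Phi>: "\<Phi> \<in> measurable \<gamma> (torus \<Otimes>\<^sub>M torus)"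
      unfolding \<Phi>_def by (intro measurable_Pair fst_t measurable_compose[OF snd_t T_meas])
    define \<pi> where "\<pi> = distr \<gamma> (torus \<Otimes>\<^sub>M torus) \<Phi>"
    have \<pi>: "\<pi> \<in> couplings (dens_measure \<epsilon> \<rho>') torus"
    proof -
      have "distr \<pi> torus fst = distr \<gamma> torus fst"
        unfolding \<pi>_def by (subst distr_distr[OF _ \<Phi>]) (auto simp: \<Phi>_def comp_def)
      moreover have "distr \<pi> torus snd = distr (distr \<gamma> torus snd) torus (\<lambda>z. reduce (T z))"
        unfolding \<pi>_def by (subst distr_distr[OF _ \<Phi>], simp, subst distr_distr[OF T_meas snd_t]) (auto simp: \<Phi>_def comp_def)
      moreover have "distr \<pi> (dens_measure \<epsilon> \<rho>') fst = distr \<pi> torus fst"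
        by (rule distr_cong) simp_all
      moreover have "sets \<pi> = sets (dens_measure \<epsilon> \<rho>' \<Otimes>\<^sub>M torus)"
        unfolding \<pi>_def sets_distr by (rule sets_pair_measure_cong[symmetric]) simp_all
      ultimately show ?thesis
        using \<gamma>(2,3) T_push by (simp add: couplings_def dens_measure_def)
    qed
    \<comment> \<open>A function of one endpoint minus a function of the other, so its integral
      depends on the marginals alone.\<close>
    define F where "F z = 2 * (\<epsilon> * \<psi> (snd z) + (\<epsilon>\<^sup>2 * (norm (grad \<psi> (snd z)))\<^sup>2) / 2) - 2 * (\<epsilon> * \<psi> (fst z))" for z
    define G where "G z = (norm (fst z - snd z))\<^sup>2" for z :: "plane \<times> plane"
    have pw: "(torus_dist (fst z) (reduce (T (snd z))))\<^sup>2 \<le> F z + K * G z" if "z \<in> space \<gamma>" for z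
    proof -
      obtain x y where z: "z = (x, y)" by (cases z)
      have xy: "x \<in> cbox 0 1" "y \<in> cbox 0 1" using that cell_subset_cbox by (auto simp: space_\<gamma> z)
      have "(torus_dist x (reduce (T y)))\<^sup>2 \<le> (norm (x - T y))\<^sup>2" by (rule torus_dist_reduce_le)
      also have "\<dots> = (norm (x - y))\<^sup>2 - 2 * \<epsilon> * (grad \<psi> y \<bullet> (x - y)) + \<epsilon>\<^sup>2 * (norm (grad \<psi> y))\<^sup>2"
        unfolding power2_norm_eq_inner T_def
        by (simp add: inner_diff_left inner_diff_right inner_add_left inner_add_right inner_commute power2_eq_square algebra_simps)
      also have "\<dots> \<le> F z + K * G z"
        using mult_left_mono[OF L(2)[OF xy], of "2 * \<epsilon>"] \<epsilon>
        by (simp add: F_def G_def K_def z algebra_simps)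
      finally show ?thesis by (simp add: z)
    qed
    have F: "integrable \<gamma> F" "(LINT z|\<gamma>. F z) = 2 * lin \<rho>'"
    proof -
      let ?h = "\<lambda>x. 2 * (\<epsilon> * \<psi> x)" and ?k = "\<lambda>x. 2 * (\<epsilon> * \<psi> x + (\<epsilon>\<^sup>2 * (norm (grad \<psi> x))\<^sup>2) / 2)"
      have m: "?h \<in> borel_measurable torus" "?k \<in> borel_measurable torus"
        by (intro continuous_imp_borel_torus continuous_intros cont grad_cont; simp)+
      have h: "integrable (dens_measure \<epsilon> \<rho>') ?h" unfolding integral_dens(2)[OF \<rho>' m(1)]
        by (intro integrable_torus_continuous continuous_intros cont c')
      have k: "integrable (dens_measure \<epsilon> \<rho>) ?k" unfolding integral_dens(2)[OF \<rho> m(2)]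
        by (intro integrable_torus_continuous continuous_intros cont grad_cont \<rho>_cont) auto
      show "integrable \<gamma> F" unfolding F_def by (rule coupling_integral(1)[OF g h k])
      have "(LINT z|\<gamma>. F z) = (LINT x|torus. (1 + \<epsilon> * \<rho> x) * ?k x) - (LINT x|torus. (1 + \<epsilon> * \<rho>' x) * ?h x)"
        unfolding F_def coupling_integral(2)[OF g h k] integral_dens(1)[OF \<rho>' m(1)] integral_dens(1)[OF \<rho> m(2)] ..
      also have "(LINT x|torus. (1 + \<epsilon> * \<rho> x) * ?k x)
          = (LINT x|torus. 2 * ((1 + \<epsilon> * \<rho> x) * ((\<epsilon>\<^sup>2 * (norm (grad \<psi> x))\<^sup>2) / 2 + \<epsilon> * \<psi> x)))"
        by (intro Bochner_Integration.integral_cong) (simp_all add: algebra_simps)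
      also have "(LINT x|torus. (1 + \<epsilon> * \<rho>' x) * ?h x) = (LINT x|torus. 2 * ((1 + \<epsilon> * \<rho>' x) * (\<epsilon> * \<psi> x)))"
        by (intro Bochner_Integration.integral_cong) (simp_all add: algebra_simps)
      finally show "(LINT z|\<gamma>. F z) = 2 * lin \<rho>'" by (simp add: lin_eq[OF \<rho>'])
    qed
    have Gm: "G \<in> borel_measurable \<gamma>"
    proof -
      have id: "(\<lambda>x. x) \<in> borel_measurable torus" by (intro continuous_imp_borel_torus continuous_intros)
      have [measurable]: "fst \<in> borel_measurable \<gamma>" "snd \<in> borel_measurable \<gamma>"
        using measurable_compose[OF fst_t id] measurable_compose[OF snd_t id] by simp_all
      show ?thesis unfolding G_def by measurable
    qed
    have nnG: "(\<integral>\<^sup>+z. ennreal (G z) \<partial>\<gamma>) \<le> ennreal (8 * s / n)" using \<gamma>(4) by (simp add: G_def)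
    have Gint: "integrable \<gamma> G"
      using Gm nnG by (intro integrableI_nonneg) (auto simp: G_def intro: le_less_trans)
    have G: "(LINT z|\<gamma>. G z) \<le> 8 * s / n"
    proof -
      have "ennreal (LINT z|\<gamma>. G z) \<le> ennreal (8 * s / n)"
        using nnG Gint by (subst nn_integral_eq_integral[symmetric]) (auto simp: G_def)
      then show ?thesis using s0 by (subst (asm) ennreal_le_iff) auto
    qed
    have FG: "integrable \<gamma> (\<lambda>z. F z + K * G z)" using F Gint by simp
    have nonneg: "0 \<le> F z + K * G z" if "z \<in> space \<gamma>" for z
      using pw[OF that] by (meson order_trans zero_le_power2)
    have "transport_cost \<pi> = (\<integral>\<^sup>+z. ennreal ((torus_dist (fst z) (reduce (T (snd z))))\<^sup>2) \<partial>\<gamma>)"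
    proof -
      have id: "(\<lambda>x. x) \<in> borel_measurable torus" by (intro continuous_imp_borel_torus continuous_intros)
      have "(\<lambda>z. (fst z, snd z)) \<in> measurable (torus \<Otimes>\<^sub>M torus) (borel \<Otimes>\<^sub>M borel)"
        by (intro measurable_Pair measurable_compose[OF measurable_fst id] measurable_compose[OF measurable_snd id])
      then have id2: "(\<lambda>z. z) \<in> measurable (torus \<Otimes>\<^sub>M torus) (borel \<Otimes>\<^sub>M borel)" by simp
      have "(\<lambda>z. torus_dist (fst z) (snd z)) \<in> borel_measurable (torus \<Otimes>\<^sub>M torus)"
        using measurable_compose[OF id2 torus_dist_measurable] .
      then show ?thesis unfolding \<pi>_def by (subst nn_integral_distr[OF \<Phi>]) (auto simp: \<Phi>_def)
    qed
    also have "\<dots> \<le> (\<integral>\<^sup>+z. ennreal (F z + K * G z) \<partial>\<gamma>)"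
      by (intro nn_integral_mono ennreal_leI pw)
    also have "\<dots> = ennreal (LINT z|\<gamma>. F z + K * G z)"
      using FG nonneg by (intro nn_integral_eq_integral AE_I2) auto
    also have eq: "(LINT z|\<gamma>. F z + K * G z) = 2 * lin \<rho>' + K * (LINT z|\<gamma>. G z)"
      using F Gint by simp
    finally have 1: "transport_cost \<pi> \<le> ennreal (2 * lin \<rho>' + K * (LINT z|\<gamma>. G z))" .
    have 2: "2 * lin \<rho>' + K * (LINT z|\<gamma>. G z) \<le> 2 * lin \<rho>' + 8 * K * s / n"
      using mult_left_mono[OF G K] by (simp add: mult_ac)
    have "0 \<le> (LINT z|\<gamma>. F z + K * G z)" using nonneg by (intro integral_nonneg_AE AE_I2)
    with eq 2 have 3: "0 \<le> 2 * lin \<rho>' + 8 * K * s / n" by simp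
    have "transport_cost \<pi> \<le> ennreal (2 * lin \<rho>' + 8 * K * s / n)"
      by (rule order_trans[OF 1 ennreal_leI[OF 2]])
    with \<pi> 3 show "\<exists>\<pi>\<in>couplings (dens_measure \<epsilon> \<rho>') torus.
       transport_cost \<pi> \<le> ennreal (2 * lin \<rho>' + 8 * K * defect \<rho>' / n)
       \<and> 0 \<le> 2 * lin \<rho>' + 8 * K * defect \<rho>' / n"
      unfolding s_def by blast
  qed
qed

end

section \<open>Differentiability\<close>

lemma L2_norm_nonneg: "0 \<le> L2_norm f"
  unfolding L2_norm_def by (intro real_sqrt_ge_zero integral_nonneg_AE) auto

lemma L2_norm_sq: "(L2_norm f)\<^sup>2 = (LINT x|torus. (f x)\<^sup>2)"
  unfolding L2_norm_def by (intro real_sqrt_pow2 integral_nonneg_AE) auto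

lemma L2_norm_cmult: "L2_norm (\<lambda>x. t * f x) = \<bar>t\<bar> * L2_norm f"
  by (simp add: L2_norm_def power_mult_distrib real_sqrt_mult)

lemma L2_Cauchy_Schwarz:
  assumes f: "continuous_on UNIV f" and g: "continuous_on UNIV g"
  shows "\<bar>LINT x|torus. f x * g x\<bar> \<le> L2_norm f * L2_norm g"
proof -
  define a b c where "a = (LINT x|torus. (f x)\<^sup>2)" and "b = (LINT x|torus. (g x)\<^sup>2)" and "c = (LINT x|torus. f x * g x)"
  have int: "integrable torus (\<lambda>x. (f x)\<^sup>2)" "integrable torus (\<lambda>x. (g x)\<^sup>2)" "integrable torus (\<lambda>x. f x * g x)"
    by (intro integrable_torus_continuous continuous_intros f g)+
  have quad: "0 \<le> a + 2 * t * c + t\<^sup>2 * b" for t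
  proof -
    have "0 \<le> (LINT x|torus. (f x + t * g x)\<^sup>2)" by (intro integral_nonneg_AE) auto
    also have "\<dots> = (LINT x|torus. (f x)\<^sup>2 + 2 * t * (f x * g x) + t\<^sup>2 * (g x)\<^sup>2)"
      by (intro Bochner_Integration.integral_cong) (simp_all add: power2_eq_square algebra_simps)
    also have "\<dots> = a + 2 * t * c + t\<^sup>2 * b" using int by (simp add: a_def b_def c_def)
    finally show ?thesis .
  qed
  have "0 \<le> b" unfolding b_def by (intro integral_nonneg_AE) auto
  have "c\<^sup>2 \<le> a * b"
  proof (cases "b = 0")
    case True
    have "c = 0"
    proof (rule ccontr)
      assume "c \<noteq> 0"
      then show False using quad[of "- (a + 1) / (2 * c)"] True by (simp add: field_simps)
    qed
    then show ?thesis using True by simp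
  next
    case False
    then have "b > 0" using \<open>0 \<le> b\<close> by simp
    have "0 \<le> a + 2 * (- c / b) * c + (- c / b)\<^sup>2 * b" by (rule quad)
    also have "\<dots> = a - c\<^sup>2 / b" using False by (simp add: power2_eq_square field_simps)
    finally show ?thesis using \<open>b > 0\<close> by (simp add: field_simps)
  qed
  then have "sqrt (c\<^sup>2) \<le> sqrt (a * b)" by (rule real_sqrt_le_mono)
  then show ?thesis by (simp add: real_sqrt_mult L2_norm_def a_def b_def c_def)
qed

lemma L1_le_L2_norm:
  assumes f: "continuous_on UNIV f"
  shows "(LINT x|torus. \<bar>f x\<bar>) \<le> L2_norm f"
proof -
  have "\<bar>LINT x|torus. \<bar>f x\<bar> * 1\<bar> \<le> L2_norm (\<lambda>x. \<bar>f x\<bar>) * L2_norm (\<lambda>x. 1)"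
    by (intro L2_Cauchy_Schwarz continuous_intros f)
  then show ?thesis by (simp add: L2_norm_def torus.prob_space del: space_torus)
qed

lemma densities_lower_bound:
  assumes "\<rho> \<in> densities \<epsilon>"
  obtains c where "c > 0" "\<And>x. c \<le> 1 + \<epsilon> * \<rho> x"
proof -
  have c: "continuous_on UNIV \<rho>" and p: "periodic \<rho>" and pos: "\<And>x. 0 < 1 + \<epsilon> * \<rho> x"
    using assms by (auto simp: densities_def)
  have "continuous_on (cbox 0 1) (\<lambda>x. 1 + \<epsilon> * \<rho> x)"
    by (intro continuous_intros continuous_on_subset[OF c]) simp
  moreover have "cbox 0 (1::plane) \<noteq> {}" by (simp add: interval_ne_empty_cart)
  ultimately obtain z where z: "\<And>x. x \<in> cbox 0 1 \<Longrightarrow> 1 + \<epsilon> * \<rho> z \<le> 1 + \<epsilon> * \<rho> x"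
    using continuous_attains_inf[OF compact_unit_square] by blast
  have "1 + \<epsilon> * \<rho> z \<le> 1 + \<epsilon> * \<rho> x" for x
    using z[of "reduce x"] periodic_reduce[OF p, of x] cell_subset_cbox reduce_in_cell[of x] by (metis subsetD)
  with pos that show thesis by blast
qed

section \<open>Tangent bounds and directional derivatives of the functional\<close>

context transport_potential
begin

lemma lin_self: "lin \<rho> = kinetic"
  by (simp add: lin_def)

lemma H_lower:
  assumes \<rho>': "\<rho>' \<in> densities \<epsilon>"
  shows "lin \<rho>' / \<epsilon>\<^sup>2 \<le> H_fun \<epsilon> \<rho>'"
proof -
  let ?V = "INF \<pi>\<in>couplings (dens_measure \<epsilon> \<rho>') torus. transport_cost \<pi>"
  have "ennreal (2 * lin \<rho>') \<le> ?V" by (intro INF_greatest cost_lower \<rho>')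
  then have le: "enn2real (ennreal (2 * lin \<rho>')) \<le> enn2real ?V"
    using optimal_cost_finite[OF \<rho>'] by (intro enn2real_mono) simp_all
  have "2 * lin \<rho>' \<le> enn2real ?V"
  \<comment> \<open>A negative value is lost in the cast to \<open>ennreal\<close>, but then the
    claim is trivial.\<close>
  proof (cases "0 \<le> lin \<rho>'")
    case True
    then show ?thesis using le by simp
  next
    case False
    then show ?thesis using enn2real_nonneg[of ?V] by linarith
  qed
  then show ?thesis using \<epsilon> by (simp add: H_fun_def W2_sq divide_simps) 
qed

lemma H_upper_exists:
  obtains C where "C \<ge> 0" "\<And>\<rho>' n c. \<rho>' \<in> densities \<epsilon> \<Longrightarrow> n > 0 \<Longrightarrow> 0 \<le> c \<Longrightarrow> (\<And>x. c \<le> 1 + \<epsilon> * \<rho> x) \<Longrightarrow>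
     (real n + 1) * defect \<rho>' \<le> c / (real n)\<^sup>2 \<Longrightarrow>
     H_fun \<epsilon> \<rho>' \<le> lin \<rho>' / \<epsilon>\<^sup>2 + C * defect \<rho>' / n"
proof -
  obtain C where C: "C \<ge> 0" "\<And>\<rho>' n c. \<rho>' \<in> densities \<epsilon> \<Longrightarrow> n > 0 \<Longrightarrow> 0 \<le> c \<Longrightarrow> (\<And>x. c \<le> 1 + \<epsilon> * \<rho> x) \<Longrightarrow>
     (real n + 1) * defect \<rho>' \<le> c / (real n)\<^sup>2 \<Longrightarrow>
     \<exists>\<pi>\<in>couplings (dens_measure \<epsilon> \<rho>') torus. transport_cost \<pi> \<le> ennreal (2 * lin \<rho>' + C * defect \<rho>' / n)
       \<and> 0 \<le> 2 * lin \<rho>' + C * defect \<rho>' / n"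
    by (rule cost_upper_exists) blast
  show thesis
  proof (rule that[of "C / (2 * \<epsilon>\<^sup>2)"])
    show "0 \<le> C / (2 * \<epsilon>\<^sup>2)" using C(1) by simp
    fix \<rho>' and n :: nat and c :: real
    assume *: "\<rho>' \<in> densities \<epsilon>" "n > 0" "0 \<le> c" "\<And>x. c \<le> 1 + \<epsilon> * \<rho> x"
      "(real n + 1) * defect \<rho>' \<le> c / (real n)\<^sup>2"
    define R where "R = 2 * lin \<rho>' + C * defect \<rho>' / n"
    let ?V = "INF \<pi>\<in>couplings (dens_measure \<epsilon> \<rho>') torus. transport_cost \<pi>"
    from C(2)[OF *] obtain \<pi> where \<pi>: "\<pi> \<in> couplings (dens_measure \<epsilon> \<rho>') torus" "transport_cost \<pi> \<le> ennreal R" "0 \<le> R"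
      unfolding R_def by blast
    have "?V \<le> ennreal R" using INF_lower[OF \<pi>(1), of transport_cost] \<pi>(2) by (rule order_trans)
    then have "enn2real ?V \<le> R" using \<pi>(3) by (rule enn2real_leI[rotated])
    then have "1 / (2 * \<epsilon>\<^sup>2) * enn2real ?V \<le> 1 / (2 * \<epsilon>\<^sup>2) * R" by (intro mult_left_mono) auto
    also have "\<dots> = lin \<rho>' / \<epsilon>\<^sup>2 + C / (2 * \<epsilon>\<^sup>2) * defect \<rho>' / n"
      using \<epsilon> *(2) by (simp add: R_def field_simps)
    finally show "H_fun \<epsilon> \<rho>' \<le> lin \<rho>' / \<epsilon>\<^sup>2 + C / (2 * \<epsilon>\<^sup>2) * defect \<rho>' / n"
      by (simp add: H_fun_def W2_sq)
  qed
qed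

lemma H_self: "H_fun \<epsilon> \<rho> = kinetic / \<epsilon>\<^sup>2"
proof (rule antisym)
  obtain C where C: "\<And>\<rho>' n c. \<rho>' \<in> densities \<epsilon> \<Longrightarrow> n > 0 \<Longrightarrow> 0 \<le> c \<Longrightarrow> (\<And>x. c \<le> 1 + \<epsilon> * \<rho> x) \<Longrightarrow>
     (real n + 1) * defect \<rho>' \<le> c / (real n)\<^sup>2 \<Longrightarrow>
     H_fun \<epsilon> \<rho>' \<le> lin \<rho>' / \<epsilon>\<^sup>2 + C * defect \<rho>' / n"
    by (rule H_upper_exists) blast
  have "0 \<le> 1 + \<epsilon> * \<rho> x" for x using \<rho> by (auto simp: densities_def less_imp_le)
  \<comment> \<open>The defect of \<rho> itself is 0, so the crude choice of 1 for \<open>n\<close>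
    and 0 for \<open>c\<close> is admissible and no error remains.\<close>
  then show "H_fun \<epsilon> \<rho> \<le> kinetic / \<epsilon>\<^sup>2" using C[OF \<rho>, of 1 0] by (simp add: lin_self defect_def)
  show "kinetic / \<epsilon>\<^sup>2 \<le> H_fun \<epsilon> \<rho>" using H_lower[OF \<rho>] by (simp add: lin_self)
qed

lemma lin_eq_H: "lin \<rho>' / \<epsilon>\<^sup>2 = H_fun \<epsilon> \<rho> - (LINT x|torus. \<psi> x * (\<rho>' x - \<rho> x))"
  using \<epsilon> by (simp add: lin_def H_self diff_divide_distrib)

lemma H_subgradient:
  assumes "\<rho>' \<in> densities \<epsilon>"
  shows "H_fun \<epsilon> \<rho> - (LINT x|torus. \<psi> x * (\<rho>' x - \<rho> x)) \<le> H_fun \<epsilon> \<rho>'"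
  using H_lower[OF assms] by (simp add: lin_eq_H)

lemma H_first_order:
  assumes e: "e > 0"
  shows "\<exists>d>0. \<forall>\<rho>'\<in>densities \<epsilon>. L2_norm (\<lambda>x. \<rho>' x - \<rho> x) < d \<longrightarrow>
    H_fun \<epsilon> \<rho>' \<le> H_fun \<epsilon> \<rho> - (LINT x|torus. \<psi> x * (\<rho>' x - \<rho> x)) + e * L2_norm (\<lambda>x. \<rho>' x - \<rho> x)"
proof -
  obtain C where C: "C \<ge> 0" "\<And>\<rho>' n c. \<rho>' \<in> densities \<epsilon> \<Longrightarrow> n > 0 \<Longrightarrow> 0 \<le> c \<Longrightarrow> (\<And>x. c \<le> 1 + \<epsilon> * \<rho> x) \<Longrightarrow>
     (real n + 1) * defect \<rho>' \<le> c / (real n)\<^sup>2 \<Longrightarrow>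
     H_fun \<epsilon> \<rho>' \<le> lin \<rho>' / \<epsilon>\<^sup>2 + C * defect \<rho>' / n"
    by (rule H_upper_exists) blast
  obtain c where c: "c > 0" "\<And>x. c \<le> 1 + \<epsilon> * \<rho> x" using densities_lower_bound[OF \<rho>] by blast
  \<comment> \<open>\<open>n\<close> makes the error per unit of norm,
    \<open>C * \<epsilon> / n\<close>, smaller than \<open>e\<close>. Then \<open>d\<close> is
    chosen so that the defect, at most \<open>\<epsilon> * d\<close>, meets the smallness condition
    for this \<open>n\<close>.\<close>
  obtain n :: nat where n: "C * \<epsilon> / e < n" using reals_Archimedean2 by blast
  have n0: "n > 0" using n C(1) \<epsilon> e by (metis divide_nonneg_pos less_imp_le mult_nonneg_nonneg not_less of_nat_0 gr0I)
  define d where "d = c / ((real n)\<^sup>2 * (real n + 1) * \<epsilon>)"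
  have d: "d > 0" using c(1) n0 \<epsilon> by (simp add: d_def)
  show ?thesis
  proof (intro exI conjI ballI impI)
    show "d > 0" by (rule d)
    fix \<rho>' assume \<rho>': "\<rho>' \<in> densities \<epsilon>" and small: "L2_norm (\<lambda>x. \<rho>' x - \<rho> x) < d"
    let ?N = "L2_norm (\<lambda>x. \<rho>' x - \<rho> x)"
    define s where "s = defect \<rho>'"
    have "s = \<epsilon> * (LINT x|torus. \<bar>\<rho>' x - \<rho> x\<bar>)"
      using \<epsilon> by (simp add: s_def defect_def abs_mult flip: right_diff_distrib)
    moreover have "(LINT x|torus. \<bar>\<rho>' x - \<rho> x\<bar>) \<le> ?N"
      using \<rho>' \<rho>_cont by (intro L1_le_L2_norm continuous_intros) (auto simp: densities_def)
    ultimately have s: "s \<le> \<epsilon> * ?N" using \<epsilon> by simp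
    have "(real n + 1) * s \<le> (real n + 1) * (\<epsilon> * d)"
      using s small \<epsilon> by (intro mult_left_mono) (auto intro: order_trans)
    also have "\<dots> = c / (real n)\<^sup>2" using \<epsilon> n0 by (simp add: d_def divide_simps) 
    finally have "H_fun \<epsilon> \<rho>' \<le> lin \<rho>' / \<epsilon>\<^sup>2 + C * s / n"
      unfolding s_def using c by (intro C(2)[OF \<rho>' n0, of c]) auto
    also have "C * s / n \<le> C * (\<epsilon> * ?N) / n" using s C(1) by (intro divide_right_mono mult_left_mono) auto
    also have "C * (\<epsilon> * ?N) / n = C * \<epsilon> / n * ?N" by simp
    also have "C * \<epsilon> / n * ?N \<le> e * ?N"
      using n n0 e by (intro mult_right_mono L2_norm_nonneg) (simp add: field_simps)
    finally show "H_fun \<epsilon> \<rho>' \<le> H_fun \<epsilon> \<rho> - (LINT x|torus. \<psi> x * (\<rho>' x - \<rho> x)) + e * ?N"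
      by (simp add: lin_eq_H)
  qed
qed

lemma add_small_in_densities:
  assumes c: "\<And>x. c \<le> 1 + \<epsilon> * \<rho> x" and h: "continuous_on UNIV h" "periodic h" "mean_zero h"
    and small: "\<And>x. \<epsilon> * \<bar>h x\<bar> < c"
  shows "(\<lambda>x. \<rho> x + h x) \<in> densities \<epsilon>"
proof -
  have "0 < 1 + \<epsilon> * (\<rho> x + h x)" for x
  proof -
    have "- (\<epsilon> * \<bar>h x\<bar>) \<le> \<epsilon> * h x" using \<epsilon> mult_left_mono[of "- \<bar>h x\<bar>" "h x" \<epsilon>] by simp
    then show ?thesis using c[of x] small[of x] by (simp add: distrib_left)
  qed
  moreover have "mean_zero (\<lambda>x. \<rho> x + h x)"
    using \<rho> h by (simp add: mean_zero_def densities_def integrable_torus_continuous)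
  ultimately show ?thesis
    using \<rho> h by (auto simp: densities_def periodic_def intro: continuous_intros)
qed

text \<open>\<open>H_subgradient\<close> and \<open>H_first_order\<close> enclose the increment
  between the linear term and an arbitrarily small multiple of the step above it, for either sign of
  \<open>\<tau>\<close>.\<close>

lemma H_gateaux:
  assumes h: "h \<in> smooth_mean_zero"
  shows "((\<lambda>\<tau>. H_fun \<epsilon> (\<lambda>x. \<rho> x + \<tau> * h x)) has_real_derivative - (LINT x|torus. \<psi> x * h x)) (at 0)"
proof -
  have hc: "continuous_on UNIV h" and hp: "periodic h" and hm: "mean_zero h"
    using h by (auto simp: smooth_mean_zero_def smooth_continuous)
  obtain c where c: "c > 0" "\<And>x. c \<le> 1 + \<epsilon> * \<rho> x" using densities_lower_bound[OF \<rho>] by blast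
  obtain B where B: "0 \<le> B" "\<And>x. x \<in> cbox 0 1 \<Longrightarrow> \<bar>h x\<bar> \<le> B" using continuous_bounded_cell[OF hc] by blast
  have hB: "\<bar>h x\<bar> \<le> B" for x
    using B(2)[of "reduce x"] periodic_reduce[OF hp, of x] cell_subset_cbox reduce_in_cell[of x] by (metis subsetD)
  let ?N = "L2_norm h" and ?I = "LINT x|torus. \<psi> x * h x"
  have N: "0 \<le> ?N" by (rule L2_norm_nonneg)
  \<comment> \<open>The range of \<open>\<tau>\<close> keeps the perturbed density positive
    everywhere; \<open>B + 1\<close> instead of \<open>B\<close> avoids division by zero.\<close>
  have dens: "(\<lambda>x. \<rho> x + \<tau> * h x) \<in> densities \<epsilon>" if \<tau>: "\<bar>\<tau>\<bar> < c / (\<epsilon> * (B + 1))" for \<tau>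
  proof (rule add_small_in_densities[OF c(2)])
    fix x
    have "\<epsilon> * \<bar>\<tau> * h x\<bar> \<le> \<epsilon> * (\<bar>\<tau>\<bar> * (B + 1))"
      using hB[of x] \<epsilon> by (auto simp: abs_mult intro!: mult_left_mono)
    also have "\<dots> < c" using \<tau> \<epsilon> B(1) pos_less_divide_eq[of "\<epsilon> * (B + 1)" "\<bar>\<tau>\<bar>" c] by (simp add: mult_ac)
    finally show "\<epsilon> * \<bar>\<tau> * h x\<bar> < c" .
  qed (use hc hp hm in \<open>auto simp: periodic_def mean_zero_def intro: continuous_intros\<close>)
  have "((\<lambda>\<tau>. H_fun \<epsilon> (\<lambda>x. \<rho> x + \<tau> * h x)) has_derivative (\<lambda>\<tau>. (- ?I) * \<tau>)) (at 0)"
    unfolding has_derivative_at_alt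
  proof (intro conjI allI impI)
    show "bounded_linear (\<lambda>\<tau>. (- ?I) * \<tau>)" by (rule bounded_linear_mult_right)
    fix e :: real assume e: "e > 0"
    obtain d where d: "d > 0" "\<And>\<rho>'. \<rho>' \<in> densities \<epsilon> \<Longrightarrow> L2_norm (\<lambda>x. \<rho>' x - \<rho> x) < d \<Longrightarrow>
      H_fun \<epsilon> \<rho>' \<le> H_fun \<epsilon> \<rho> - (LINT x|torus. \<psi> x * (\<rho>' x - \<rho> x)) + e / (?N + 1) * L2_norm (\<lambda>x. \<rho>' x - \<rho> x)"
      using H_first_order[of "e / (?N + 1)"] e N by auto
    define \<delta> where "\<delta> = min (c / (\<epsilon> * (B + 1))) (d / (?N + 1))"
    have \<delta>: "\<delta> > 0" using c d \<epsilon> B(1) N by (simp add: \<delta>_def)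
    have "\<bar>H_fun \<epsilon> (\<lambda>x. \<rho> x + \<tau> * h x) - H_fun \<epsilon> \<rho> + ?I * \<tau>\<bar> \<le> e * \<bar>\<tau>\<bar>" if \<tau>: "\<bar>\<tau>\<bar> < \<delta>" for \<tau>
    proof -
      have \<rho>': "(\<lambda>x. \<rho> x + \<tau> * h x) \<in> densities \<epsilon>" using \<tau> by (intro dens) (simp add: \<delta>_def)
      have n: "L2_norm (\<lambda>x. \<rho> x + \<tau> * h x - \<rho> x) = \<bar>\<tau>\<bar> * ?N" by (simp add: L2_norm_cmult)
      have i: "(LINT x|torus. \<psi> x * (\<rho> x + \<tau> * h x - \<rho> x)) = \<tau> * ?I" by (simp add: mult.left_commute)
      have "\<bar>\<tau>\<bar> * (?N + 1) < d" using \<tau> N by (simp add: \<delta>_def field_simps)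
      moreover have "\<bar>\<tau>\<bar> * ?N \<le> \<bar>\<tau>\<bar> * (?N + 1)" by (intro mult_left_mono) auto
      ultimately have "\<bar>\<tau>\<bar> * ?N < d" by linarith
      then have up: "H_fun \<epsilon> (\<lambda>x. \<rho> x + \<tau> * h x) \<le> H_fun \<epsilon> \<rho> - \<tau> * ?I + e / (?N + 1) * (\<bar>\<tau>\<bar> * ?N)"
        using d(2)[OF \<rho>'] unfolding n i by blast
      have "e / (?N + 1) * (\<bar>\<tau>\<bar> * ?N) = e * \<bar>\<tau>\<bar> * (?N / (?N + 1))" by simp
      also have "\<dots> \<le> e * \<bar>\<tau>\<bar> * 1" using e N by (intro mult_left_mono) (auto simp: field_simps)
      finally show ?thesis using up H_subgradient[OF \<rho>'] unfolding i
        by (simp add: abs_le_iff mult.commute)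
    qed
    with \<delta> show "\<exists>d>0. \<forall>y. norm (y - 0) < d \<longrightarrow>
       norm (H_fun \<epsilon> (\<lambda>x. \<rho> x + y * h x) - H_fun \<epsilon> (\<lambda>x. \<rho> x + 0 * h x) - - ?I * (y - 0)) \<le> e * norm (y - 0)"
      by (intro exI[of _ \<delta>]) simp
  qed
  then show ?thesis unfolding has_field_derivative_def .
qed

end

text \<open>Both potentials represent the derivative of the same functional along all test
  directions, so they coincide. This is what gives the definite description \<open>psi\<close> its
  meaning, with no appeal to uniqueness of optimal maps.\<close>

lemma potential_unique:
  assumes \<epsilon>: "\<epsilon> > 0" and \<rho>: "\<rho> \<in> densities \<epsilon>" and "is_potential \<epsilon> \<rho> \<psi>" "is_potential \<epsilon> \<rho> \<phi>"
  shows "\<psi> = \<phi>"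
proof -
  interpret A: transport_potential \<epsilon> \<rho> \<psi> by unfold_locales fact+
  interpret B: transport_potential \<epsilon> \<rho> \<phi> by unfold_locales fact+
  have "(\<lambda>x. \<psi> x - \<phi> x) = (\<lambda>x. 0)"
  proof (rule mean_zero_test_zero)
    show "continuous_on UNIV (\<lambda>x. \<psi> x - \<phi> x)" by (intro continuous_intros A.cont B.cont)
    show "periodic (\<lambda>x. \<psi> x - \<phi> x)" using A.per B.per by (simp add: periodic_def)
    show "mean_zero (\<lambda>x. \<psi> x - \<phi> x)"
      using A.mz B.mz integrable_torus_continuous[OF A.cont] integrable_torus_continuous[OF B.cont]
      by (simp add: mean_zero_def)
    fix h assume h: "h \<in> smooth_mean_zero"
    have hc: "continuous_on UNIV h" using h by (auto simp: smooth_mean_zero_def smooth_continuous)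
    have "(LINT x|torus. \<psi> x * h x) = (LINT x|torus. \<phi> x * h x)"
      using DERIV_unique[OF A.H_gateaux[OF h] B.H_gateaux[OF h]] by simp
    then show "(LINT x|torus. (\<psi> x - \<phi> x) * h x) = 0"
      by (simp add: left_diff_distrib integrable_torus_continuous continuous_intros A.cont B.cont hc)
  qed
  then show ?thesis by (simp add: fun_eq_iff)
qed

lemma transport_potential_psi:
  assumes "\<epsilon> > 0" "\<rho> \<in> perturbative \<eta> \<epsilon>"
  shows "transport_potential \<epsilon> \<rho> (psi \<epsilon> \<rho>)"
proof
  show \<rho>: "\<rho> \<in> densities \<epsilon>" using assms(2) positive_densities_subset by (auto simp: perturbative_def)
  obtain \<psi> where \<psi>: "is_potential \<epsilon> \<rho> \<psi>" using assms(2) by (auto simp: perturbative_def)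
  show "is_potential \<epsilon> \<rho> (psi \<epsilon> \<rho>)"
    unfolding psi_def by (rule theI[where P = "is_potential \<epsilon> \<rho>", OF \<psi>])
      (rule potential_unique[OF assms(1) \<rho> _ \<psi>])
qed (rule assms)

lemma (in transport_potential) has_L2_frechet_H:
  "has_L2_frechet (H_fun \<epsilon>) (positive_densities \<epsilon>) \<rho> (\<lambda>h. - (LINT x|torus. \<psi> x * h x))"
  unfolding has_L2_frechet_def
proof (intro conjI ballI allI impI)
  have sc: "continuous_on UNIV h" if "h \<in> smooth_mean_zero" for h
    using that by (auto simp: smooth_mean_zero_def smooth_continuous)
  show "- (LINT x|torus. \<psi> x * (a * g x + b * h x)) = a * - (LINT x|torus. \<psi> x * g x) + b * - (LINT x|torus. \<psi> x * h x)"
    if "g \<in> smooth_mean_zero" "h \<in> smooth_mean_zero" for g h a b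
  proof -
    have "(LINT x|torus. \<psi> x * (a * g x + b * h x)) = (LINT x|torus. a * (\<psi> x * g x) + b * (\<psi> x * h x))"
      by (simp add: algebra_simps)
    also have "\<dots> = a * (LINT x|torus. \<psi> x * g x) + b * (LINT x|torus. \<psi> x * h x)"
      by (simp add: integrable_torus_continuous continuous_intros cont sc that)
    finally show ?thesis by simp
  qed
  show "\<exists>C. \<forall>h\<in>smooth_mean_zero. \<bar>- (LINT x|torus. \<psi> x * h x)\<bar> \<le> C * L2_norm h"
    using L2_Cauchy_Schwarz[OF cont sc] by (intro exI[of _ "L2_norm \<psi>"]) simp
  fix e :: real assume "e > 0"
  from H_first_order[OF this] obtain d where d: "d > 0" "\<And>\<rho>'. \<rho>' \<in> densities \<epsilon> \<Longrightarrow> L2_norm (\<lambda>x. \<rho>' x - \<rho> x) < d \<Longrightarrow>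
      H_fun \<epsilon> \<rho>' \<le> H_fun \<epsilon> \<rho> - (LINT x|torus. \<psi> x * (\<rho>' x - \<rho> x)) + e * L2_norm (\<lambda>x. \<rho>' x - \<rho> x)"
    by blast
  have "\<bar>H_fun \<epsilon> (\<lambda>x. \<rho> x + h x) - H_fun \<epsilon> \<rho> - - (LINT x|torus. \<psi> x * h x)\<bar> \<le> e * L2_norm h"
    if "(\<lambda>x. \<rho> x + h x) \<in> positive_densities \<epsilon>" "L2_norm h < d" for h
  proof -
    have dens: "(\<lambda>x. \<rho> x + h x) \<in> densities \<epsilon>" using that positive_densities_subset by blast
    show ?thesis using d(2)[OF dens] H_subgradient[OF dens] that(2) by (simp add: abs_le_iff)
  qed
  then show "\<exists>d>0. \<forall>h\<in>smooth_mean_zero. (\<lambda>x. \<rho> x + h x) \<in> positive_densities \<epsilon> \<and> L2_norm h < d \<longrightarrow>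
      \<bar>H_fun \<epsilon> (\<lambda>x. \<rho> x + h x) - H_fun \<epsilon> \<rho> - - (LINT x|torus. \<psi> x * h x)\<bar> \<le> e * L2_norm h"
    using d(1) by blast
qed

text \<open>Three inequalities are added: the upper bound from \<rho> and the tangent from \<rho>',
  both at the trial density \<sigma>, and the tangent from \<rho> at \<rho>'. All values of the
  functional cancel. With \<phi> = \<psi>' - \<psi> and L^2 norms, t |\<phi>|^2 is left bounded by
  (e/2) t |\<phi>| + |\<phi>| |\<rho>' - \<rho>|.\<close>

lemma (in transport_potential) potential_L2_continuous:
  assumes e: "e > 0"
  shows "\<exists>d>0. \<forall>\<rho>' \<psi>'. transport_potential \<epsilon> \<rho>' \<psi>' \<longrightarrow> L2_norm (\<lambda>x. \<rho>' x - \<rho> x) < d \<longrightarrow>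
    L2_norm (\<lambda>x. \<psi>' x - \<psi> x) \<le> e"
proof -
  obtain c where c: "c > 0" "\<And>x. c \<le> 1 + \<epsilon> * \<rho> x" using densities_lower_bound[OF \<rho>] by blast
  obtain d1 where d1: "d1 > 0" "\<And>\<rho>'. \<rho>' \<in> densities \<epsilon> \<Longrightarrow> L2_norm (\<lambda>x. \<rho>' x - \<rho> x) < d1 \<Longrightarrow>
      H_fun \<epsilon> \<rho>' \<le> H_fun \<epsilon> \<rho> - (LINT x|torus. \<psi> x * (\<rho>' x - \<rho> x)) + e / 2 * L2_norm (\<lambda>x. \<rho>' x - \<rho> x)"
    using H_first_order[of "e / 2"] e by auto
  \<comment> \<open>As |\<phi>| is at most 2/\<epsilon>, the first bound keeps the trial density
    positive and the second keeps it within \<open>d1\<close> of \<rho>. Neither refers to \<rho>',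
    so \<open>t\<close> can be fixed in advance.\<close>
  define t where "t = min (c / 4) (d1 * \<epsilon> / 4)"
  have t: "t > 0" "t \<le> c / 4" "t \<le> d1 * \<epsilon> / 4" using c d1 \<epsilon> by (simp_all add: t_def)
  show ?thesis
  \<comment> \<open>The first-order error uses up half of \<open>e * t\<close>; this radius grants
    the other half to the term with \<rho>' - \<rho>.\<close>
  proof (intro exI[of _ "e * t / 2"] conjI allI impI)
    show "0 < e * t / 2" using e t by simp
    fix \<rho>' \<psi>' assume "transport_potential \<epsilon> \<rho>' \<psi>'" and close: "L2_norm (\<lambda>x. \<rho>' x - \<rho> x) < e * t / 2"
    then interpret B: transport_potential \<epsilon> \<rho>' \<psi>' by simp
    define \<phi> where "\<phi> x = \<psi>' x - \<psi> x" for x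
    let ?N = "L2_norm \<phi>" and ?r = "L2_norm (\<lambda>x. \<rho>' x - \<rho> x)"
    note [continuous_intros] = cont B.cont \<rho>_cont B.\<rho>_cont
    have \<phi>c [continuous_intros]: "continuous_on UNIV \<phi>" unfolding \<phi>_def by (intro continuous_intros)
    note int = integrable_torus_continuous
    have \<phi>b: "\<bar>\<phi> x\<bar> \<le> 2 / \<epsilon>" for x using bound[of x] B.bound[of x] unfolding \<phi>_def by (simp add: abs_le_iff)
    have N: "?N \<le> 2 / \<epsilon>"
    proof -
      have "(LINT x|torus. (\<phi> x)\<^sup>2) \<le> (LINT x|torus. (2 / \<epsilon>)\<^sup>2)"
      proof (intro integral_mono int continuous_intros)
        fix x show "(\<phi> x)\<^sup>2 \<le> (2 / \<epsilon>)\<^sup>2" using \<phi>b[of x] by (metis abs_ge_zero power2_abs power_mono)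
      qed
      then have "?N\<^sup>2 \<le> (2 / \<epsilon>)\<^sup>2" by (simp add: L2_norm_sq torus.prob_space del: space_torus)
      then show ?thesis by (rule power2_le_imp_le) (use \<epsilon> in simp)
    qed
    define \<sigma> where "\<sigma> x = \<rho> x + (- t) * \<phi> x" for x
    have \<sigma>: "\<sigma> \<in> densities \<epsilon>" unfolding \<sigma>_def
    proof (rule add_small_in_densities[OF c(2)])
      show "continuous_on UNIV (\<lambda>x. - t * \<phi> x)" by (intro continuous_intros)
      show "periodic (\<lambda>x. - t * \<phi> x)" using per B.per by (simp add: periodic_def \<phi>_def)
      show "mean_zero (\<lambda>x. - t * \<phi> x)"
        using mz B.mz int[OF cont] int[OF B.cont] by (simp add: mean_zero_def \<phi>_def)
      fix x
      have "\<epsilon> * \<bar>- t * \<phi> x\<bar> = \<epsilon> * t * \<bar>\<phi> x\<bar>" using t by (simp add: abs_mult)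
      also have "\<dots> \<le> \<epsilon> * t * (2 / \<epsilon>)" using \<epsilon> t \<phi>b by (intro mult_left_mono) auto
      also have "\<dots> < c" using \<epsilon> t c by simp
      finally show "\<epsilon> * \<bar>- t * \<phi> x\<bar> < c" .
    qed
    have n\<sigma>: "L2_norm (\<lambda>x. \<sigma> x - \<rho> x) = t * ?N"
      using L2_norm_cmult[of "- t" \<phi>] t by (simp add: \<sigma>_def)
    have "t * ?N \<le> d1 * \<epsilon> / 4 * (2 / \<epsilon>)" using N t \<epsilon> d1 L2_norm_nonneg by (intro mult_mono) auto
    also have "\<dots> < d1" using \<epsilon> d1 by simp
    finally have up: "H_fun \<epsilon> \<sigma> \<le> H_fun \<epsilon> \<rho> - (LINT x|torus. \<psi> x * (\<sigma> x - \<rho> x)) + e / 2 * (t * ?N)"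
      using d1(2)[OF \<sigma>] unfolding n\<sigma> by blast
    have low1: "H_fun \<epsilon> \<rho>' - (LINT x|torus. \<psi>' x * (\<sigma> x - \<rho>' x)) \<le> H_fun \<epsilon> \<sigma>" by (rule B.H_subgradient[OF \<sigma>])
    have low2: "H_fun \<epsilon> \<rho> - (LINT x|torus. \<psi> x * (\<rho>' x - \<rho> x)) \<le> H_fun \<epsilon> \<rho>'" by (rule H_subgradient[OF B.\<rho>])
    have "(LINT x|torus. \<psi> x * (\<sigma> x - \<rho> x)) + (LINT x|torus. \<psi> x * (\<rho>' x - \<rho> x))* (-1) - (LINT x|torus. \<psi>' x * (\<sigma> x - \<rho>' x))
       = (LINT x|torus. \<psi> x * (\<sigma> x - \<rho> x) + (\<psi> x * (\<rho>' x - \<rho> x)) * (-1) - \<psi>' x * (\<sigma> x - \<rho>' x))"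
    proof -
      have \<sigma>c: "continuous_on UNIV \<sigma>" using \<sigma> by (simp add: densities_def)
      have "integrable torus (\<lambda>x. \<psi> x * (\<sigma> x - \<rho> x))" "integrable torus (\<lambda>x. \<psi> x * (\<rho>' x - \<rho> x))"
        "integrable torus (\<lambda>x. \<psi>' x * (\<sigma> x - \<rho>' x))"
        by (intro int continuous_intros \<sigma>c)+
      then show ?thesis by simp
    qed
    also have "\<dots> = (LINT x|torus. t * (\<phi> x)\<^sup>2 + \<phi> x * (\<rho>' x - \<rho> x))"
      by (intro Bochner_Integration.integral_cong) (simp_all add: \<sigma>_def \<phi>_def power2_eq_square algebra_simps)
    also have "\<dots> = t * ?N\<^sup>2 + (LINT x|torus. \<phi> x * (\<rho>' x - \<rho> x))"
    proof -
      have "integrable torus (\<lambda>x. (\<phi> x)\<^sup>2)" "integrable torus (\<lambda>x. \<phi> x * (\<rho>' x - \<rho> x))"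
        by (intro int continuous_intros)+
      then show ?thesis by (simp add: L2_norm_sq)
    qed
    finally have "t * ?N\<^sup>2 + (LINT x|torus. \<phi> x * (\<rho>' x - \<rho> x)) \<le> e / 2 * (t * ?N)"
      using up low1 low2 by linarith
    moreover have "\<bar>LINT x|torus. \<phi> x * (\<rho>' x - \<rho> x)\<bar> \<le> ?N * ?r"
      by (intro L2_Cauchy_Schwarz continuous_intros)
    ultimately have "t * ?N\<^sup>2 \<le> e / 2 * (t * ?N) + ?N * ?r" by (simp add: abs_le_iff)
    also have "\<dots> \<le> e / 2 * (t * ?N) + ?N * (e * t / 2)"
      using close L2_norm_nonneg by (intro add_left_mono mult_left_mono) auto
    also have "\<dots> = t * (e * ?N)" by simp
    finally have "?N * ?N \<le> e * ?N" using t(1) by (simp add: power2_eq_square)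
    then show "L2_norm (\<lambda>x. \<psi>' x - \<psi> x) \<le> e"
      using L2_norm_nonneg[of \<phi>] e unfolding \<phi>_def[abs_def, symmetric] by (cases "?N = 0") auto
  qed
qed

text \<open>The definite description needs uniqueness as well: two continuous periodic mean-zero
  representatives differ by a function that annihilates every test function, hence by 0.\<close>

lemma (in transport_potential) functional_derivative_H:
  "functional_derivative (H_fun \<epsilon>) \<rho> = (\<lambda>x. - \<psi> x)"
  unfolding functional_derivative_def
proof (rule the_equality)
  show *: "has_functional_derivative (H_fun \<epsilon>) \<rho> (\<lambda>x. - \<psi> x)"
    unfolding has_functional_derivative_def
  proof (intro conjI ballI)
    show "continuous_on UNIV (\<lambda>x. - \<psi> x)" by (intro continuous_intros cont)
    show "((\<lambda>\<tau>. H_fun \<epsilon> (\<lambda>x. \<rho> x + \<tau> * h x)) has_real_derivative (LINT x|torus. - \<psi> x * h x)) (at 0)"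
      if "h \<in> smooth_mean_zero" for h using H_gateaux[OF that] by simp
  qed (use per mz in \<open>auto simp: periodic_def mean_zero_def\<close>)
  fix g assume g: "has_functional_derivative (H_fun \<epsilon>) \<rho> g"
  then have gc: "continuous_on UNIV g" and gp: "periodic g" and gm: "mean_zero g"
    by (auto simp: has_functional_derivative_def)
  have "(\<lambda>x. g x + \<psi> x) = (\<lambda>x. 0)"
  proof (rule mean_zero_test_zero)
    show "continuous_on UNIV (\<lambda>x. g x + \<psi> x)" by (intro continuous_intros gc cont)
    show "periodic (\<lambda>x. g x + \<psi> x)" using per gp by (simp add: periodic_def)
    show "mean_zero (\<lambda>x. g x + \<psi> x)"
      using mz gm integrable_torus_continuous[OF gc] integrable_torus_continuous[OF cont] by (simp add: mean_zero_def)
    fix h assume h: "h \<in> smooth_mean_zero"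
    have hc: "continuous_on UNIV h" using h by (auto simp: smooth_mean_zero_def smooth_continuous)
    have "(LINT x|torus. g x * h x) = - (LINT x|torus. \<psi> x * h x)"
      using g h DERIV_unique[OF _ H_gateaux[OF h]] unfolding has_functional_derivative_def by blast
    then show "(LINT x|torus. (g x + \<psi> x) * h x) = 0"
      by (simp add: distrib_right integrable_torus_continuous continuous_intros gc cont hc)
  qed
  then show "g = (\<lambda>x. - \<psi> x)" by (simp add: fun_eq_iff eq_neg_iff_add_eq_0)
qed

lemma C1_functional_H:
  assumes \<epsilon>: "\<epsilon> > 0"
  shows "C1_functional (H_fun \<epsilon>) (positive_densities \<epsilon>) (perturbative \<eta> \<epsilon>)"
  unfolding C1_functional_def
proof (intro exI[of _ "\<lambda>\<rho> h. - (LINT x|torus. psi \<epsilon> \<rho> x * h x)"] conjI ballI allI impI)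
  note tp = transport_potential_psi[OF \<epsilon>]
  show "has_L2_frechet (H_fun \<epsilon>) (positive_densities \<epsilon>) \<rho> (\<lambda>h. - (LINT x|torus. psi \<epsilon> \<rho> x * h x))"
    if "\<rho> \<in> perturbative \<eta> \<epsilon>" for \<rho>
    by (rule transport_potential.has_L2_frechet_H[OF tp[OF that]])
  fix \<rho> and e :: real assume \<rho>: "\<rho> \<in> perturbative \<eta> \<epsilon>" and e: "e > 0"
  interpret A: transport_potential \<epsilon> \<rho> "psi \<epsilon> \<rho>" by (rule tp[OF \<rho>])
  from A.potential_L2_continuous[OF e] obtain d where d: "d > 0"
    "\<And>\<rho>' \<psi>'. transport_potential \<epsilon> \<rho>' \<psi>' \<Longrightarrow> L2_norm (\<lambda>x. \<rho>' x - \<rho> x) < d \<Longrightarrow> L2_norm (\<lambda>x. \<psi>' x - psi \<epsilon> \<rho> x) \<le> e"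
    by blast
  have "\<bar>- (LINT x|torus. psi \<epsilon> \<rho>' x * h x) - - (LINT x|torus. psi \<epsilon> \<rho> x * h x)\<bar> \<le> e * L2_norm h"
    if \<rho>': "\<rho>' \<in> perturbative \<eta> \<epsilon>" and close: "L2_norm (\<lambda>x. \<rho>' x - \<rho> x) < d" and h: "h \<in> smooth_mean_zero" for \<rho>' h
  proof -
    interpret B: transport_potential \<epsilon> \<rho>' "psi \<epsilon> \<rho>'" by (rule tp[OF \<rho>'])
    have hc: "continuous_on UNIV h" using h by (auto simp: smooth_mean_zero_def smooth_continuous)
    have "(LINT x|torus. (psi \<epsilon> \<rho>' x - psi \<epsilon> \<rho> x) * h x) = (LINT x|torus. psi \<epsilon> \<rho>' x * h x) - (LINT x|torus. psi \<epsilon> \<rho> x * h x)"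
      by (simp add: left_diff_distrib integrable_torus_continuous continuous_intros A.cont B.cont hc)
    moreover have "\<bar>LINT x|torus. (psi \<epsilon> \<rho>' x - psi \<epsilon> \<rho> x) * h x\<bar> \<le> L2_norm (\<lambda>x. psi \<epsilon> \<rho>' x - psi \<epsilon> \<rho> x) * L2_norm h"
      by (intro L2_Cauchy_Schwarz continuous_intros A.cont B.cont hc)
    moreover have "\<dots> \<le> e * L2_norm h"
      by (intro mult_right_mono d(2)[OF tp[OF \<rho>'] close] L2_norm_nonneg)
    ultimately show ?thesis by (simp add: abs_le_iff)
  qed
  with d(1) show "\<exists>d>0. \<forall>\<rho>'\<in>perturbative \<eta> \<epsilon>. L2_norm (\<lambda>x. \<rho>' x - \<rho> x) < d \<longrightarrow> (\<forall>h\<in>smooth_mean_zero.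
      \<bar>- (LINT x|torus. psi \<epsilon> \<rho>' x * h x) - - (LINT x|torus. psi \<epsilon> \<rho> x * h x)\<bar> \<le> e * L2_norm h)"
    by blast
qed

theorem theorem3p1:
  shows "\<exists>c>0. \<forall>\<eta>\<^sub>0. 0 < \<eta>\<^sub>0 \<and> \<eta>\<^sub>0 \<le> c \<longrightarrow> (\<forall>\<epsilon>>0.
     C1_functional (H_fun \<epsilon>) (positive_densities \<epsilon>) (perturbative \<eta>\<^sub>0 \<epsilon>) \<and>
     (\<forall>\<rho>\<in>perturbative \<eta>\<^sub>0 \<epsilon>.
        (\<forall>h\<in>smooth_mean_zero.
           ((\<lambda>\<tau>. H_fun \<epsilon> (\<lambda>x. \<rho> x + \<tau> * h x))
              has_real_derivative - (LINT x|torus. psi \<epsilon> \<rho> x * h x)) (at 0)) \<and>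
        functional_derivative (H_fun \<epsilon>) \<rho> = (\<lambda>x. - psi \<epsilon> \<rho> x)))"
proof (intro exI[of _ 1] conjI allI impI ballI)
  fix \<eta>\<^sub>0 \<epsilon> :: real assume \<epsilon>: "\<epsilon> > 0"
  show "C1_functional (H_fun \<epsilon>) (positive_densities \<epsilon>) (perturbative \<eta>\<^sub>0 \<epsilon>)" by (rule C1_functional_H[OF \<epsilon>])
  fix \<rho> assume "\<rho> \<in> perturbative \<eta>\<^sub>0 \<epsilon>"
  then interpret transport_potential \<epsilon> \<rho> "psi \<epsilon> \<rho>" by (rule transport_potential_psi[OF \<epsilon>])
  show "functional_derivative (H_fun \<epsilon>) \<rho> = (\<lambda>x. - psi \<epsilon> \<rho> x)" by (rule functional_derivative_H)
  show "((\<lambda>\<tau>. H_fun \<epsilon> (\<lambda>x. \<rho> x + \<tau> * h x)) has_real_derivative - (LINT x|torus. psi \<epsilon> \<rho> x * h x)) (at 0)"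
    if "h \<in> smooth_mean_zero" for h by (rule H_gateaux[OF that])
qed simp

end
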